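(* Let $b:[0,1]\to\mathbb{R}$ be continuous, let $\sigma\neq 0$ be real, let $B(u):=\int_0^u b(v)\,dv$, and assume that $B(1)=0$ and that $b$ is (strictly) decreasing on $[0,1]$. Let $P^n_\infty$ (the stationary distribution of the projected particle system with $n$ particles) and $P_\infty$ (the centered stationary distribution of the nonlinear diffusion process) be the probability distributions on $\mathbb{R}^n$ and $\mathbb{R}$ respectively defined in the context. Then: (i) the sequence $(P^n_\infty)_{n\geq 1}$ is $P_\infty$-chaotic; (ii) for all $k\geq 1$ and all $q\in[1,+\infty)$, $$\lim_{n\to+\infty}\mathrm{W}_q\left(P^{k,n}_\infty,(P_\infty)^{\otimes k}\right)=0.$$
   Context: For $n\geq 1$ and $k\in\{1,\dots,n\}$, set $b_n(k):=n\left(B(k/n)-B((k-1)/n)\right)$. Let $M_n:=\{(z_1,\dots,z_n)\in\mathbb{R}^n: z_1+\cdots+z_n=0\}$, equipped with its surface measure $dz$ (the $(n-1)$-dimensional Lebesgue measure induced by the Euclidean structure of $\mathbb{R}^n$). For $z\in\mathbb{R}^n$, $z_{(1)}\leq\cdots\leq z_{(n)}$ denote its order statistics (coordinates sorted in nondecreasing order). Under the stated assumptions on $b$, $$\mathcal{Z}_n:=\int_{z\in M_n}\exp\left(\frac{2}{\sigma^2}\sum_{k=1}^n b_n(k)z_{(k)}\right)dz<+\infty,$$ and $P^n_\infty$ is defined as the probability distribution on $\mathbb{R}^n$, concentrated on $M_n$, with density $$p^n_\infty(z):=\frac{1}{\mathcal{Z}_n}\exp\left(\frac{2}{\sigma^2}\sum_{k=1}^n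 b_n(k)z_{(k)}\right)$$ with respect to $dz$ on $M_n$. It is symmetric (invariant under permutations of coordinates), and it is known to be the unique stationary distribution of the projected particle system, i.e. the $M_n$-valued diffusion $$dZ^n_i(t)=\left(b_n\left(\sum_{j=1}^n\mathbf{1}_{\{Z^n_j(t)\leq Z^n_i(t)\}}\right)-B(1)\right)dt+\sigma\frac{n-1}{n}\,dW_i(t)-\frac{\sigma}{n}\sum_{j\neq i}dW_j(t),\quad 1\leq i\leq n,$$ with $(W_1,\dots,W_n)$ a standard Brownian motion in $\mathbb{R}^n$. Under the stated assumptions on $b$, one has $B>0$ on $(0,1)$, and the function $\Phi:(0,1)\to\mathbb{R}$, $$\Phi(u):=\int_0^u\frac{v\sigma^2}{2B(v)}\,dv-\int_u^1\frac{(1-v)\sigma^2}{2B(v)}\,dv,$$ is a well-defined increasing bijection from $(0,1)$ onto $\mathbb{R}$. $P_\infty$ is defined as the probability distribution on $\mathbb{R}$ with cumulative distribution function $F_\infty:=\Phi^{-1}$; it has density $p_\infty(x)=\frac{2}{\sigma^2}B(F_\infty(x))$. It is known to be the unique centered stationary distribution of the nonlinear diffusion $dX(t)=b(F_t(X(t)))\,dt+\sigma\,dW(t)$, $F_t(x)=\mathbb{P}(X(t)\leq x)$. For a probability distribution $P^n$ on $\mathbb{R}^n$ and $k\in\{1,\dots,n\}$, $P^{k,n}$ denotes the marginal distribution of the first $k$ coordinates under $P^n$ (so $P^{k,n}_\infty$ is the marginal of $P^n_\infty$). If, for each $n\geq 1$, $P^n$ is a symmetric probability distribution on $\mathbb{R}^n$,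 and $P$ is a probability distribution on $\mathbb{R}$, the sequence $(P^n)_{n\geq 1}$ is called $P$-chaotic if, for all $k\geq 1$, $P^{k,n}$ converges weakly to the product measure $P^{\otimes k}$ as $n\to+\infty$. For $k\geq 1$ and $q\in[1,+\infty)$, the Wasserstein distance of order $q$ between probability distributions $\mu,\nu$ on $\mathbb{R}^k$ is $$\mathrm{W}_q(\mu,\nu):=\inf_{(X,Y)\in\Pi(\mu,\nu)}\left(\mathbb{E}[|X-Y|^q]\right)^{1/q},$$ where $\Pi(\mu,\nu)$ is the set of pairs of random variables with marginal distributions $\mu$ and $\nu$, and $|x|:=(|x_1|^q+\cdots+|x_k|^q)^{1/q}$ on $\mathbb{R}^k$. *)

theory Defs
  imports "HOL-Probability.Probability"
begin

text \<open>
  Points of \<open>\<real>\<^sup>n\<close> are functions in \<^term>\<open>{1..n} \<rightarrow>\<^sub>E (UNIV :: real set)\<close>, so coordinates are numbered from 1.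
  A probability distribution on \<open>\<real>\<^sup>n\<close> is a measure on the product \<open>\<sigma>\<close>-algebra
  \<^term>\<open>Pi\<^sub>M {1..n} (\<lambda>_. borel :: real measure)\<close>, which is the Borel \<open>\<sigma>\<close>-algebra of \<open>\<real>\<^sup>n\<close>.
\<close>

abbreviation Rn :: "nat \<Rightarrow> (nat \<Rightarrow> real) measure" where
  "Rn n \<equiv> Pi\<^sub>M {1..n} (\<lambda>_. borel)"

definition distribution_on :: "nat \<Rightarrow> (nat \<Rightarrow> real) measure \<Rightarrow> bool" where
  "distribution_on n P \<longleftrightarrow> prob_space P \<and> sets P = sets (Rn n)"

definition B_fun :: "(real \<Rightarrow> real) \<Rightarrow> real \<Rightarrow> real" where
  "B_fun b u = (LINT v:{0..u}|lborel. b v)"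

definition b_coeff :: "(real \<Rightarrow> real) \<Rightarrow> nat \<Rightarrow> nat \<Rightarrow> real" where
  "b_coeff b n k = real n * (B_fun b (real k / real n) - B_fun b ((real k - 1) / real n))"

definition order_stat :: "nat \<Rightarrow> (nat \<Rightarrow> real) \<Rightarrow> nat \<Rightarrow> real" where
  "order_stat n z k = sort (map z [1..<Suc n]) ! (k - 1)"

text \<open>
  The surface measure of the hyperplane \<open>M\<^sub>n = {z. z\<^sub>1 + \<dots> + z\<^sub>n = 0}\<close>, as a measure on \<open>\<real>\<^sup>n\<close>
  concentrated on \<open>M\<^sub>n\<close>. The hyperplane is the graph of \<open>g(y) = - (y\<^sub>1 + \<dots> + y\<^sub>n\<^sub>-\<^sub>1)\<close> over
  \<open>\<real>\<^sup>n\<^sup>-\<^sup>1\<close>, and the surface element of a graph is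
  \<open>sqrt (1 + |\<nabla>g|\<^sup>2) dy\<close>, which is \<open>sqrt n dy\<close> here. For \<open>n = 1\<close> it is the unit mass at the origin.
\<close>

definition zero_sum_measure :: "nat \<Rightarrow> (nat \<Rightarrow> real) measure" where
  "zero_sum_measure n =
     scale_measure (ennreal (sqrt (real n)))
       (distr (Pi\<^sub>M {1..<n} (\<lambda>_. lborel)) (Rn n) (\<lambda>y. y(n := - (\<Sum>i\<in>{1..<n}. y i))))"

definition gibbs_weight :: "(real \<Rightarrow> real) \<Rightarrow> real \<Rightarrow> nat \<Rightarrow> (nat \<Rightarrow> real) \<Rightarrow> real" where
  "gibbs_weight b \<sigma> n z = exp (2 / \<sigma>\<^sup>2 * (\<Sum>k=1..n. b_coeff b n k * order_stat n z k))"

definition partition_fun :: "(real \<Rightarrow> real) \<Rightarrow> real \<Rightarrow> nat \<Rightarrow> ennreal" where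
  "partition_fun b \<sigma> n = (\<integral>\<^sup>+ z. ennreal (gibbs_weight b \<sigma> n z) \<partial>zero_sum_measure n)"

definition Pn_inf :: "(real \<Rightarrow> real) \<Rightarrow> real \<Rightarrow> nat \<Rightarrow> (nat \<Rightarrow> real) measure" where
  "Pn_inf b \<sigma> n =
     density (zero_sum_measure n)
       (\<lambda>z. 1 / partition_fun b \<sigma> n * ennreal (gibbs_weight b \<sigma> n z))"

definition Phi :: "(real \<Rightarrow> real) \<Rightarrow> real \<Rightarrow> real \<Rightarrow> real" where
  "Phi b \<sigma> u =
     (LINT v:{0..u}|lborel. v * \<sigma>\<^sup>2 / (2 * B_fun b v))
     - (LINT v:{u..1}|lborel. (1 - v) * \<sigma>\<^sup>2 / (2 * B_fun b v))"

definition F_inf :: "(real \<Rightarrow> real) \<Rightarrow> real \<Rightarrow> real \<Rightarrow> real" where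
  "F_inf b \<sigma> = the_inv_into {0<..<1} (Phi b \<sigma>)"

definition P_inf :: "(real \<Rightarrow> real) \<Rightarrow> real \<Rightarrow> real measure" where
  "P_inf b \<sigma> = interval_measure (F_inf b \<sigma>)"

text \<open>Only meant for \<open>k \<le> n\<close>.\<close>

definition marginal :: "nat \<Rightarrow> (nat \<Rightarrow> real) measure \<Rightarrow> (nat \<Rightarrow> real) measure" where
  "marginal k P = distr P (Rn k) (\<lambda>x. restrict x {1..k})"

definition symmetric_distribution :: "nat \<Rightarrow> (nat \<Rightarrow> real) measure \<Rightarrow> bool" where
  "symmetric_distribution n P \<longleftrightarrow>
     distribution_on n P \<and>
     (\<forall>\<pi>. \<pi> permutes {1..n} \<longrightarrow> distr P (Rn n) (\<lambda>x. \<lambda>i\<in>{1..n}. x (\<pi> i)) = P)"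

text \<open>
  Weak convergence on \<open>\<real>\<^sup>k\<close>, tested against bounded continuous functions. The topology
  is the product topology on \<^term>\<open>{1..k} \<rightarrow>\<^sub>E (UNIV :: real set)\<close>.
\<close>

definition weak_conv_Rn ::
    "nat \<Rightarrow> (nat \<Rightarrow> (nat \<Rightarrow> real) measure) \<Rightarrow> (nat \<Rightarrow> real) measure \<Rightarrow> bool" where
  "weak_conv_Rn k Q P \<longleftrightarrow>
     (\<forall>f :: (nat \<Rightarrow> real) \<Rightarrow> real.
        continuous_map (product_topology (\<lambda>_. euclidean) {1..k}) euclidean f \<longrightarrow>
        bounded (f ` ({1..k} \<rightarrow>\<^sub>E UNIV)) \<longrightarrow>
        (\<lambda>n. \<integral>x. f x \<partial>Q n) \<longlonglongrightarrow> (\<integral>x. f x \<partial>P))"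

definition chaotic :: "(nat \<Rightarrow> (nat \<Rightarrow> real) measure) \<Rightarrow> real measure \<Rightarrow> bool" where
  "chaotic Q P \<longleftrightarrow>
     (\<forall>n\<ge>1. symmetric_distribution n (Q n)) \<and>
     real_distribution P \<and>
     (\<forall>k\<ge>1. weak_conv_Rn k (\<lambda>n. marginal k (Q n)) (Pi\<^sub>M {1..k} (\<lambda>_. P)))"

definition lq_norm :: "real \<Rightarrow> nat \<Rightarrow> (nat \<Rightarrow> real) \<Rightarrow> real" where
  "lq_norm q k x = (\<Sum>i\<in>{1..k}. \<bar>x i\<bar> powr q) powr (1 / q)"

text \<open>
  A pair of random variables with prescribed marginals enters the definition only through
  its joint law.
\<close>

definition couplings ::
    "nat \<Rightarrow> (nat \<Rightarrow> real) measure \<Rightarrow> (nat \<Rightarrow> real) measure \<Rightarrow> ((nat \<Rightarrow> real) \<times> (nat \<Rightarrow> real)) measure set" where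
  "couplings k \<mu> \<nu> =
     {\<gamma>. prob_space \<gamma> \<and> sets \<gamma> = sets (Rn k \<Otimes>\<^sub>M Rn k) \<and>
         distr \<gamma> (Rn k) fst = \<mu> \<and> distr \<gamma> (Rn k) snd = \<nu>}"

definition ennreal_powr :: "ennreal \<Rightarrow> real \<Rightarrow> ennreal" where
  "ennreal_powr x p = (if x = \<top> then \<top> else ennreal (enn2real x powr p))"

text \<open>The value is \<open>\<top>\<close> if every coupling has infinite cost.\<close>

definition wasserstein ::
    "real \<Rightarrow> nat \<Rightarrow> (nat \<Rightarrow> real) measure \<Rightarrow> (nat \<Rightarrow> real) measure \<Rightarrow> ennreal" where
  "wasserstein q k \<mu> \<nu> =
     (INF \<gamma>\<in>couplings k \<mu> \<nu>.
        ennreal_powr (\<integral>\<^sup>+ (x, y). ennreal (lq_norm q k (\<lambda>i. x i - y i) powr q) \<partial>\<gamma>) (1 / q))"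

end

theory Submission
  imports Defs "HOL-Combinatorics.Combinatorics" "HOL-Real_Asymp.Real_Asymp"
begin

text \<open>
  Write \<open>B\<close> for the primitive of the drift and \<open>\<beta> v = \<sigma>\<^sup>2 / (2 * B v)\<close>, so that \<open>\<Phi>\<close> has derivative
  \<open>\<beta>\<close>. An explicit description of the order statistics and one
  coupling give the result.

  Order statistics. Summation by parts turns the exponent of the Gibbs weight into
  \<open>- \<Sum>j. rate n j * g j\<close>, where \<open>g j \<ge> 0\<close> is the gap between the \<open>j\<close>-th and the \<open>(j + 1)\<close>-st order
  statistic and \<open>rate n j = n / \<beta> (j / n) > 0\<close>. The gaps are linear coordinates on the hyperplane, so
  under the stationary distribution they are independent exponential variables, and the \<open>k\<close>-th order
  statistic is \<open>from_gaps n g k = \<Sum>j. (j / n - of_bool (k \<le> j)) * g j\<close>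
  (\<open>nn_integral_symmetric_weight\<close>). Its mean is a difference of two Riemann sums for the two
  integrals that make up \<open>\<Phi> (k / n)\<close>, and its variance is of order \<open>1 / n\<close> when \<open>k / n\<close> stays away
  from 0 and 1. So the order statistic of rank \<open>k n\<close> tends to \<open>\<Phi> u\<close> in probability if
  \<open>k n / n \<rightarrow> u\<close> (\<open>quantile_in_probability\<close>).

  Coupling. Draw \<open>x 1, \<dots>, x n\<close> independently from the limit law, independently of the gaps, and put
  particle \<open>i\<close> at \<open>from_gaps n g r\<close>, where \<open>r\<close> is the rank of \<open>x i\<close> in the sample. The particle vector
  has the stationary distribution, because both laws are invariant under permutations and have the
  same order statistics (\<open>law_of_particles\<close>). Its first \<open>k\<close> coordinates and \<open>x 1, \<dots>, x k\<close> are
  therefore a coupling of the two laws that are to be compared. For this coupling, particle \<open>i\<close> is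
  \<open>transport n (x i)\<close> for one random nondecreasing function \<open>transport n\<close>, which sends \<open>t\<close> to
  \<open>from_gaps n g\<close> at the number of sample points that are at most \<open>t\<close>. For fixed \<open>t\<close> the empirical
  distribution function tends to \<open>F t\<close>, so \<open>transport n t\<close> tends to \<open>\<Phi> (F t) = t\<close>. Monotonicity
  upgrades this to \<open>particle i - x i \<rightarrow> 0\<close> in probability (\<open>particles_in_probability\<close>).

  Integrability. Since \<open>B\<close> is bounded below by a multiple of \<open>v * (1 - v)\<close>, the exponential moments of
  the order statistics are bounded by telescoping products, uniformly after averaging over the rank
  (\<open>Pn_exp_moment\<close>), and the limit law has exponential tails (\<open>P_exp_moment\<close>). So the convergence
  also holds in every \<open>L\<^sup>q\<close> (\<open>particles_in_Lq\<close>). The cost of the coupling bounds the Wasserstein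
  distance, and convergence in probability gives weak convergence of the marginals.
\<close>

section \<open>The drift and its primitive\<close>

locale decreasing_drift =
  fixes b :: "real \<Rightarrow> real" and \<sigma> :: real
  assumes b_cont: "continuous_on {0..1} b"
    and sigma_nonzero: "\<sigma> \<noteq> 0"
    and B_one: "B_fun b 1 = 0"
    and b_decreasing: "strict_antimono_on {0..1} b"
begin

abbreviation B :: "real \<Rightarrow> real" where "B \<equiv> B_fun b"

lemma B_zero [simp]: "B 0 = 0"
  unfolding B_fun_def set_lebesgue_integral_def
  by (rule integral_eq_zero_AE, rule AE_mp[OF AE_lborel_singleton[of 0]]) (auto simp: indicator_def)

lemma B_has_derivative_within:
  assumes "0 \<le> u" "u \<le> 1"
  shows "(B has_real_derivative b u) (at u within {0..1})"
proof -
  have "B x = integral {0..x} b" if "x \<in> {0..1}" for x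
    unfolding B_fun_def
    by (intro set_borel_integral_eq_integral borel_integrable_atLeastAtMost'
          continuous_on_subset[OF b_cont]) (use that in auto)
  moreover have "((\<lambda>x. integral {0..x} b) has_real_derivative b u) (at u within {0..1})"
    using integral_has_real_derivative[OF b_cont, of u] assms by auto
  ultimately show ?thesis
    using assms by (auto intro: has_field_derivative_transform_within[where f="\<lambda>x. integral {0..x} b" and d=1])
qed

lemma B_cont: "continuous_on {0..1} B"
proof (rule DERIV_continuous_on)
  show "(B has_real_derivative b u) (at u within {0..1})" if "u \<in> {0..1}" for u
    using B_has_derivative_within that by simp
qed

lemma B_has_derivative:
  assumes "0 < u" "u < 1"
  shows "(B has_real_derivative b u) (at u)"
  using B_has_derivative_within[of u] assms at_within_interior[of u "{0..1}"] by auto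

lemma B_mvt:
  assumes "0 \<le> x" "x < y" "y \<le> 1"
  obtains \<xi> where "x < \<xi>" "\<xi> < y" "B y - B x = (y - x) * b \<xi>"
proof -
  have "\<exists>l z. x < z \<and> z < y \<and> DERIV B z :> l \<and> B y - B x = (y - x) * l"
  proof (rule MVT)
    fix z assume "x < z" "z < y"
    then show "B differentiable (at z)" using B_has_derivative[of z] assms by (auto simp: real_differentiable_def)
  qed (use assms in \<open>auto intro!: continuous_on_subset[OF B_cont]\<close>)
  then obtain l z where z: "x < z" "z < y" "DERIV B z :> l" "B y - B x = (y - x) * l" by blast
  moreover have "l = b z" using B_has_derivative[of z] z assms by (auto intro: DERIV_unique)
  ultimately show ?thesis using that by auto
qed

lemma b_less: "0 \<le> x \<Longrightarrow> x < y \<Longrightarrow> y \<le> 1 \<Longrightarrow> b y < b x"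
  using b_decreasing unfolding monotone_on_def by simp

text \<open>
  By the mean value theorem the two difference quotients are values of \<open>b\<close>, the left one at a smaller
  argument. Stated without division, this form yields positivity of \<open>B\<close> and the monotonicity of
  \<open>v / B v\<close> and \<open>(1 - v) / B v\<close> by putting 0 or 1 at one end.
\<close>

lemma B_strictly_concave:
  assumes "0 \<le> x" "x < y" "y < z" "z \<le> 1"
  shows "(B z - B y) * (y - x) < (B y - B x) * (z - y)"
proof -
  obtain p where p: "x < p" "p < y" "B y - B x = (y - x) * b p"
    using B_mvt[of x y] assms by auto
  obtain q where q: "y < q" "q < z" "B z - B y = (z - y) * b q"
    using B_mvt[of y z] assms by auto
  have "b q < b p" using b_less[of p q] p q assms by auto
  then have "((z - y) * (y - x)) * b q < ((z - y) * (y - x)) * b p"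
    using assms by (intro mult_strict_left_mono mult_pos_pos) auto
  then show ?thesis unfolding p q by (simp add: mult_ac)
qed

lemma B_pos:
  assumes "0 < u" "u < 1"
  shows "0 < B u"
proof -
  have "(B 1 - B u) * (u - 0) < (B u - B 0) * (1 - u)"
    by (rule B_strictly_concave) (use assms in auto)
  then show ?thesis unfolding B_one B_zero by (simp add: algebra_simps)
qed

text \<open>
  This is the derivative of \<open>\<Phi>\<close>; see \<open>Phi_deriv\<close>.
\<close>

definition beta :: "real \<Rightarrow> real" where "beta v = \<sigma>\<^sup>2 / (2 * B v)"

lemma beta_pos: "0 < u \<Longrightarrow> u < 1 \<Longrightarrow> 0 < beta u"
  using B_pos sigma_nonzero by (simp add: beta_def)

lemma beta_cont: "continuous_on {0<..<1} beta"
proof -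
  have "continuous_on {0<..<1} B" by (rule continuous_on_subset[OF B_cont]) auto
  then show ?thesis
    unfolding beta_def by (intro continuous_on_divide continuous_on_mult continuous_on_const) (use B_pos in force)+
qed

text \<open>
  The two integrands of \<open>\<Phi>\<close> are monotone. This gives their integrability at the endpoint where \<open>B\<close>
  vanishes and makes the Riemann sums easy to compare with the integrals.
\<close>

lemma left_weight_mono:
  assumes "0 < v" "v \<le> w" "w < 1"
  shows "v * beta v \<le> w * beta w"
proof (cases "v = w")
  case False
  then have "B w * v \<le> B v * w"
    using B_strictly_concave[of 0 v w] assms by (simp add: algebra_simps)
  then have "v / B v \<le> w / B w"
    using B_pos[of v] B_pos[of w] assms by (simp add: field_simps)
  from mult_left_mono[OF this, of "\<sigma>\<^sup>2 / 2"] show ?thesis by (simp add: beta_def mult_ac)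
qed simp

lemma right_weight_antimono:
  assumes "0 < v" "v \<le> w" "w < 1"
  shows "(1 - w) * beta w \<le> (1 - v) * beta v"
proof (cases "v = w")
  case False
  then have "B v * (1 - w) \<le> B w * (1 - v)"
    using B_strictly_concave[of v w 1] assms B_one by (simp add: algebra_simps)
  then have "(1 - w) / B w \<le> (1 - v) / B v"
    using B_pos[of v] B_pos[of w] assms by (simp add: field_simps)
  from mult_left_mono[OF this, of "\<sigma>\<^sup>2 / 2"] show ?thesis by (simp add: beta_def mult_ac)
qed simp

text \<open>
  Concavity puts \<open>B\<close> above the chords that join \<open>(1/2, B (1/2))\<close> to the two zeros of \<open>B\<close>.
\<close>

lemma beta_upper:
  obtains C where "0 < C" "\<And>v. 0 < v \<Longrightarrow> v < 1 \<Longrightarrow> beta v \<le> C / (v * (1 - v))"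
proof
  define C where "C = beta (1/2)"
  show "0 < C" using beta_pos[of "1/2"] by (simp add: C_def)
  fix v :: real assume v: "0 < v" "v < 1"
  show "beta v \<le> C / (v * (1 - v))"
  proof (cases "v \<le> 1/2")
    case True
    have "v * (1 - v) * beta v \<le> v * beta v"
      using v beta_pos[of v] by (intro mult_right_mono) (auto simp: mult_le_cancel_left1)
    also have "\<dots> \<le> C" using left_weight_mono[of v "1/2"] v True \<open>0 < C\<close> unfolding C_def by simp
    finally show ?thesis using v by (simp add: field_simps)
  next
    case False
    have "v * (1 - v) * beta v \<le> (1 - v) * beta v"
      using v beta_pos[of v] by (intro mult_right_mono) (auto simp: mult_le_cancel_right1)
    also have "\<dots> \<le> C" using right_weight_antimono[of "1/2" v] v False \<open>0 < C\<close> unfolding C_def by simp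
    finally show ?thesis using v by (simp add: field_simps)
  qed
qed

text \<open>
  The slope of \<open>B\<close> is bounded by its slopes \<open>b 0\<close> and \<open>b 1\<close> at the endpoints. Together with
  \<open>beta_upper\<close>, this makes \<open>\<Phi>\<close> comparable with the logit function.
\<close>

lemma beta_lower:
  obtains c where "0 < c" "\<And>v. 0 < v \<Longrightarrow> v < 1 \<Longrightarrow> c / (v * (1 - v)) \<le> beta v"
proof
  define A where "A = max (b 0) (- b 1)"
  have B_le: "B v \<le> A * v" "B v \<le> A * (1 - v)" if v: "0 < v" "v < 1" for v
  proof -
    obtain p where p: "0 < p" "p < v" "B v - B 0 = (v - 0) * b p" using B_mvt[of 0 v] v by auto
    have "v * b p \<le> v * A" using b_less[of 0 p] p v unfolding A_def by (intro mult_left_mono) auto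
    then show "B v \<le> A * v" using p by (simp add: mult_ac)
    obtain q where q: "v < q" "q < 1" "B 1 - B v = (1 - v) * b q" using B_mvt[of v 1] v by auto
    have "(1 - v) * - b q \<le> (1 - v) * A" using b_less[of q 1] q v unfolding A_def by (intro mult_left_mono) auto
    then show "B v \<le> A * (1 - v)" using q B_one by (simp add: mult_ac)
  qed
  have A: "0 < A" using B_le(1)[of "1/2"] B_pos[of "1/2"] by simp
  show "0 < \<sigma>\<^sup>2 / (4 * A)" using A sigma_nonzero by simp
  fix v :: real assume v: "0 < v" "v < 1"
  have "B v = v * B v + (1 - v) * B v" by (simp add: algebra_simps)
  also have "\<dots> \<le> v * (A * (1 - v)) + (1 - v) * (A * v)"
    using B_le[OF v] v by (intro add_mono mult_left_mono) auto
  finally have "B v \<le> 2 * A * (v * (1 - v))" by (simp add: algebra_simps)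
  then have "\<sigma>\<^sup>2 / (2 * (2 * A * (v * (1 - v)))) \<le> \<sigma>\<^sup>2 / (2 * B v)"
    using B_pos[OF v] v A by (intro divide_left_mono mult_pos_pos) auto
  then show "\<sigma>\<^sup>2 / (4 * A) / (v * (1 - v)) \<le> beta v" by (simp add: beta_def mult_ac)
qed

end

text \<open>
  Monotonicity bounds \<open>f\<close> on every interval \<open>{0<..u}\<close> with \<open>u < 1\<close>, so the integral over such an
  interval is finite although \<open>f\<close> may be unbounded near 1.
\<close>

lemma primitive_from_zero:
  fixes f :: "real \<Rightarrow> real"
  assumes cont: "continuous_on {0<..<1} f"
    and nonneg: "\<And>v. 0 < v \<Longrightarrow> v < 1 \<Longrightarrow> 0 \<le> f v"
    and mono: "\<And>v w. 0 < v \<Longrightarrow> v \<le> w \<Longrightarrow> w < 1 \<Longrightarrow> f v \<le> f w"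
  shows "0 < u \<Longrightarrow> u < 1 \<Longrightarrow> ((\<lambda>u. LINT v:{0..u}|lborel. f v) has_real_derivative f u) (at u)"
    and "((\<lambda>u. LINT v:{0..u}|lborel. f v) \<longlongrightarrow> 0) (at_right 0)"
proof -
  define F where "F u = (LINT v:{0..u}|lborel. f v)" for u
  have meas: "(\<lambda>v. indicator {0<..u} v *\<^sub>R f v) \<in> borel_measurable lborel" if "u < 1" for u
  proof -
    have "(\<lambda>v. indicator {0<..u} v *\<^sub>R f v) = (\<lambda>v. indicator {0<..u} v *\<^sub>R (indicator {0<..<1} v *\<^sub>R f v))"
      using that by (auto simp: indicator_def fun_eq_iff)
    moreover have "(\<lambda>v. indicator {0<..<1} v *\<^sub>R f v) \<in> borel_measurable borel"
      by (rule borel_measurable_continuous_on_indicator[OF _ cont]) auto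
    ultimately show ?thesis by simp
  qed
  have int': "set_integrable lborel {0<..u} f" if u: "u < 1" for u
    unfolding set_integrable_def
  proof (rule Bochner_Integration.integrable_bound)
    show "integrable lborel (\<lambda>v. indicator {0<..u} v *\<^sub>R f u)"
      by (cases "0 \<le> u") (auto intro!: integrable_real_indicator)
    show "AE v in lborel. norm (indicator {0<..u} v *\<^sub>R f v) \<le> norm (indicator {0<..u} v *\<^sub>R f u)"
      using mono[of _ u] nonneg u by (auto simp: indicator_def abs_of_nonneg intro!: AE_I2)
  qed (use meas u in auto)
  have F': "F u = (LINT v:{0<..u}|lborel. f v)" for u
    unfolding F_def set_lebesgue_integral_def
    by (rule integral_discrete_difference[where X="{0}"]) (auto simp: indicator_def)
  show "(F \<longlongrightarrow> 0) (at_right 0)"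
  proof (rule tendsto_sandwich[where f="\<lambda>_. 0" and h="\<lambda>u. u * f (1/2)"])
    show "((\<lambda>u. u * f (1/2)) \<longlongrightarrow> 0) (at_right 0)" by (auto intro!: tendsto_eq_intros)
    have bd: "0 \<le> F u \<and> F u \<le> u * f (1/2)" if u: "0 < u" "u < 1/2" for u
    proof -
      have "F u \<le> (LINT v:{0<..u}|lborel. f (1/2))"
        unfolding F' using u by (intro set_integral_mono int' mono) (auto simp: set_integrable_def)
      also have "\<dots> = u * f (1/2)" using u by (simp add: set_lebesgue_integral_def)
      finally have "F u \<le> u * f (1/2)" .
      moreover have "0 \<le> F u" unfolding F' set_lebesgue_integral_def using nonneg u
        by (intro integral_nonneg_AE AE_I2) (auto simp: indicator_def)
      ultimately show ?thesis by simp
    qed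
    have "\<forall>\<^sub>F u in at_right (0::real). 0 < u \<and> u < 1/2"
      by (rule eventually_at_right_real[of 0 "1/2", simplified, THEN eventually_mono]) auto
    then show "\<forall>\<^sub>F u in at_right 0. 0 \<le> F u" "\<forall>\<^sub>F u in at_right 0. F u \<le> u * f (1/2)"
      using bd by (auto elim!: eventually_mono)
  qed simp
  show "(F has_real_derivative f u) (at u)" if u: "0 < u" "u < 1"
  proof -
    define a c where "a = u / 2" and "c = (u + 1) / 2"
    have ac: "0 < a" "a < u" "u < c" "c < 1" using u by (auto simp: a_def c_def)
    have cont': "continuous_on {a..c} f" by (rule continuous_on_subset[OF cont]) (use ac in auto)
    have F_split: "F x = F a + integral {a..x} f" if x: "x \<in> {a..c}" for x
    proof -
      have "F x = F a + (LINT v:{a<..x}|lborel. f v)"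
        unfolding F' using x ac int'[of x]
        by (subst set_integral_Un[symmetric]) (auto intro!: set_integrable_subset[OF int'[of x]] arg_cong[where f="\<lambda>S. set_lebesgue_integral lborel S f"])
      also have "(LINT v:{a<..x}|lborel. f v) = (LINT v:{a..x}|lborel. f v)"
        unfolding set_lebesgue_integral_def
        by (rule integral_discrete_difference[where X="{a}"]) (auto simp: indicator_def)
      also have "\<dots> = integral {a..x} f"
        by (intro set_borel_integral_eq_integral borel_integrable_atLeastAtMost' continuous_on_subset[OF cont']) (use x in auto)
      finally show ?thesis .
    qed
    have "((\<lambda>x. F a + integral {a..x} f) has_real_derivative f u) (at u within {a..c})"
      using integral_has_real_derivative[OF cont', of u] ac by (auto intro!: derivative_eq_intros)
    then have "(F has_real_derivative f u) (at u within {a..c})"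
    proof (rule has_field_derivative_transform_within[where d=1])
      show "F a + integral {a..x} f = F x" if "x \<in> {a..c}" for x using F_split[OF that] by simp
    qed (use ac in auto)
    then show ?thesis using ac at_within_interior[of u "{a..c}"] by auto
  qed
qed

section \<open>The quantile function and the limit law\<close>

context decreasing_drift
begin

text \<open>
  \<open>\<Phi> = left_part - right_part\<close>. The two integrals are also the limits of the two Riemann sums in the
  mean of an order statistic.
\<close>

definition left_part :: "real \<Rightarrow> real" where
  "left_part u = (LINT v:{0..u}|lborel. v * beta v)"

definition right_part :: "real \<Rightarrow> real" where
  "right_part u = (LINT v:{u..1}|lborel. (1 - v) * beta v)"

abbreviation \<Phi> :: "real \<Rightarrow> real" where "\<Phi> \<equiv> Phi b \<sigma>"
abbreviation F :: "real \<Rightarrow> real" where "F \<equiv> F_inf b \<sigma>"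
abbreviation P :: "real measure" where "P \<equiv> P_inf b \<sigma>"

lemma Phi_eq: "\<Phi> u = left_part u - right_part u"
  by (simp add: Phi_def left_part_def right_part_def beta_def)

lemma left_part_deriv:
  assumes "0 < u" "u < 1"
  shows "(left_part has_real_derivative u * beta u) (at u)"
  unfolding left_part_def
  by (rule primitive_from_zero(1)[of "\<lambda>v. v * beta v"])
     (use assms left_weight_mono beta_pos in \<open>auto intro!: continuous_intros beta_cont simp: less_imp_le\<close>)

lemma left_part_lim: "(left_part \<longlongrightarrow> 0) (at_right 0)"
  unfolding left_part_def
  by (rule primitive_from_zero(2)[of "\<lambda>v. v * beta v"])
     (use left_weight_mono beta_pos in \<open>auto intro!: continuous_intros beta_cont simp: less_imp_le\<close>)

text \<open>
  The reflection \<open>v \<mapsto> 1 - v\<close> carries the right integral to a left one, so that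
  \<open>primitive_from_zero\<close> applies to both.
\<close>

lemma right_part_reflect: "right_part u = (LINT w:{0..1 - u}|lborel. w * beta (1 - w))"
proof -
  have "right_part u = (LINT w|lborel. indicator {u..1} (1 + - 1 * w) *\<^sub>R ((1 - (1 + - 1 * w)) * beta (1 + - 1 * w)))"
    unfolding right_part_def set_lebesgue_integral_def
    by (subst lborel_integral_real_affine[of "-1" _ 1]) simp_all
  also have "\<dots> = (LINT w:{0..1 - u}|lborel. w * beta (1 - w))"
    unfolding set_lebesgue_integral_def
    by (intro Bochner_Integration.integral_cong refl) (auto simp: indicator_def)
  finally show ?thesis .
qed

lemma reflected_weight:
  shows "continuous_on {0<..<1} (\<lambda>w. w * beta (1 - w))"
    and "\<And>w. 0 < w \<Longrightarrow> w < 1 \<Longrightarrow> 0 \<le> w * beta (1 - w)"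
    and "\<And>v w. 0 < v \<Longrightarrow> v \<le> w \<Longrightarrow> w < 1 \<Longrightarrow> v * beta (1 - v) \<le> w * beta (1 - w)"
proof -
  show "continuous_on {0<..<1} (\<lambda>w. w * beta (1 - w))"
    by (intro continuous_intros continuous_on_compose2[OF beta_cont]) auto
  show "\<And>w. 0 < w \<Longrightarrow> w < 1 \<Longrightarrow> 0 \<le> w * beta (1 - w)"
    using beta_pos by (simp add: less_imp_le)
  show "v * beta (1 - v) \<le> w * beta (1 - w)" if "0 < v" "v \<le> w" "w < 1" for v w
    using right_weight_antimono[of "1 - w" "1 - v"] that by simp
qed

lemma right_part_deriv:
  assumes "0 < u" "u < 1"
  shows "(right_part has_real_derivative - ((1 - u) * beta u)) (at u)"
proof -
  define J where "J x = (LINT w:{0..x}|lborel. w * beta (1 - w))" for x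
  have "(J has_real_derivative ((1 - u) * beta (1 - (1 - u)))) (at (1 - u))"
    unfolding J_def
    by (rule primitive_from_zero(1)[of "\<lambda>w. w * beta (1 - w)"]) (use assms reflected_weight in auto)
  then have "((\<lambda>x. J (1 - x)) has_real_derivative ((1 - u) * beta (1 - (1 - u))) * (0 - 1)) (at u)"
    by (rule DERIV_chain2) (auto intro!: derivative_eq_intros)
  moreover have "right_part = (\<lambda>x. J (1 - x))" by (simp add: fun_eq_iff right_part_reflect J_def)
  ultimately show ?thesis by simp
qed

lemma right_part_lim: "(right_part \<longlongrightarrow> 0) (at_left 1)"
proof -
  define J where "J x = (LINT w:{0..x}|lborel. w * beta (1 - w))" for x
  have "(J \<longlongrightarrow> 0) (at_right 0)"
    unfolding J_def
    by (rule primitive_from_zero(2)[of "\<lambda>w. w * beta (1 - w)"]) (use reflected_weight in auto)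
  moreover have "filterlim (\<lambda>x::real. 1 - x) (at_right 0) (at_left 1)"
    unfolding filterlim_at by (auto intro!: tendsto_eq_intros simp: eventually_at_filter)
  ultimately have "((\<lambda>x. J (1 - x)) \<longlongrightarrow> 0) (at_left 1)" by (rule filterlim_compose)
  moreover have "right_part = (\<lambda>x. J (1 - x))" by (simp add: fun_eq_iff right_part_reflect J_def)
  ultimately show ?thesis by simp
qed

lemma Phi_deriv:
  assumes "0 < u" "u < 1"
  shows "(\<Phi> has_real_derivative beta u) (at u)"
proof -
  have "((\<lambda>u. left_part u - right_part u) has_real_derivative u * beta u - - ((1 - u) * beta u)) (at u)"
    by (intro DERIV_diff left_part_deriv right_part_deriv assms)
  moreover have "\<Phi> = (\<lambda>u. left_part u - right_part u)" by (simp add: fun_eq_iff Phi_eq)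
  ultimately show ?thesis by (simp add: algebra_simps)
qed

lemma Phi_less:
  assumes "0 < u" "u < v" "v < 1"
  shows "\<Phi> u < \<Phi> v"
proof (rule DERIV_pos_imp_increasing[OF assms(2)])
  fix x assume "u \<le> x" "x \<le> v"
  then show "\<exists>y. (\<Phi> has_real_derivative y) (at x) \<and> 0 < y"
    using Phi_deriv[of x] beta_pos[of x] assms by auto
qed

definition logistic :: "real \<Rightarrow> real" where "logistic t = 1 / (1 + exp (- t))"

lemma logistic_bounds: "0 < logistic t" "logistic t < 1"
  by (auto simp: logistic_def add_pos_pos)

lemma logistic_deriv: "(logistic has_real_derivative logistic t * (1 - logistic t)) (at t)"
proof -
  have p: "1 + exp (- t) > 0" by (simp add: add_pos_pos)
  have "(logistic has_real_derivative (exp (- t) / (1 + exp (- t))\<^sup>2)) (at t)"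
    unfolding logistic_def[abs_def] using p
    by (auto intro!: derivative_eq_intros simp: power2_eq_square)
  moreover have "exp (- t) / (1 + exp (- t))\<^sup>2 = logistic t * (1 - logistic t)"
    using p by (simp add: logistic_def field_simps power2_eq_square)
  ultimately show ?thesis by simp
qed

lemma logistic_surj:
  assumes "0 < u" "u < 1" shows "\<exists>t. u = logistic t"
proof
  show "u = logistic (- ln ((1 - u) / u))" using assms by (simp add: logistic_def field_simps)
qed

lemma Phi_logistic_deriv:
  "((\<lambda>t. \<Phi> (logistic t)) has_real_derivative beta (logistic t) * (logistic t * (1 - logistic t))) (at t)"
  by (rule DERIV_chain2[OF Phi_deriv[OF logistic_bounds] logistic_deriv])

text \<open>
  In the logistic coordinate \<open>t\<close>, with \<open>v = logistic t\<close>, one has \<open>dv = v * (1 - v) dt\<close>. The bounds on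
  \<open>beta\<close> thus say that \<open>\<Phi> \<circ> logistic\<close> has slope between two positive constants. The lower bound makes
  \<open>\<Phi>\<close> surjective, the upper bound gives exponential tails of its inverse.
\<close>

lemma Phi_logistic_upper:
  obtains C where "0 < C" "\<And>s t. s \<le> t \<Longrightarrow> \<Phi> (logistic t) - \<Phi> (logistic s) \<le> C * (t - s)"
    "\<And>v. 0 < v \<Longrightarrow> v < 1 \<Longrightarrow> beta v \<le> C / (v * (1 - v))"
proof -
  obtain C where C: "0 < C" "\<And>v. 0 < v \<Longrightarrow> v < 1 \<Longrightarrow> beta v \<le> C / (v * (1 - v))"
    using beta_upper by blast
  have "\<Phi> (logistic t) - \<Phi> (logistic s) \<le> C * (t - s)" if "s \<le> t" for s t
  proof -
    have "C * s - \<Phi> (logistic s) \<le> C * t - \<Phi> (logistic t)"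
    proof (rule DERIV_nonneg_imp_nondecreasing[OF that])
      fix x :: real
      have "((\<lambda>x. C * x - \<Phi> (logistic x)) has_real_derivative
          C - beta (logistic x) * (logistic x * (1 - logistic x))) (at x)"
        by (auto intro!: derivative_eq_intros Phi_logistic_deriv)
      moreover have "beta (logistic x) * (logistic x * (1 - logistic x)) \<le> C"
        using C(2)[OF logistic_bounds, of x] logistic_bounds[of x] by (simp add: field_simps)
      ultimately show "\<exists>y. ((\<lambda>x. C * x - \<Phi> (logistic x)) has_real_derivative y) (at x) \<and> 0 \<le> y" by force
    qed
    then show ?thesis by (simp add: algebra_simps)
  qed
  then show ?thesis using C that by blast
qed

lemma Phi_logistic_lower:
  obtains c where "0 < c" "\<And>s t. s \<le> t \<Longrightarrow> c * (t - s) \<le> \<Phi> (logistic t) - \<Phi> (logistic s)"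
proof -
  obtain c where c: "0 < c" "\<And>v. 0 < v \<Longrightarrow> v < 1 \<Longrightarrow> c / (v * (1 - v)) \<le> beta v"
    using beta_lower by blast
  have "c * (t - s) \<le> \<Phi> (logistic t) - \<Phi> (logistic s)" if "s \<le> t" for s t
  proof -
    have "\<Phi> (logistic s) - c * s \<le> \<Phi> (logistic t) - c * t"
    proof (rule DERIV_nonneg_imp_nondecreasing[OF that])
      fix x :: real
      have "((\<lambda>x. \<Phi> (logistic x) - c * x) has_real_derivative
          beta (logistic x) * (logistic x * (1 - logistic x)) - c) (at x)"
        by (auto intro!: derivative_eq_intros Phi_logistic_deriv)
      moreover have "c \<le> beta (logistic x) * (logistic x * (1 - logistic x))"
        using c(2)[OF logistic_bounds, of x] logistic_bounds[of x] by (simp add: field_simps)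
      ultimately show "\<exists>y. ((\<lambda>x. \<Phi> (logistic x) - c * x) has_real_derivative y) (at x) \<and> 0 \<le> y" by force
    qed
    then show ?thesis by (simp add: algebra_simps)
  qed
  then show ?thesis using c that by blast
qed

text \<open>
  Lower bound on the slope of \<open>\<Phi> \<circ> logistic\<close> and the intermediate value theorem.
\<close>

lemma Phi_surj: obtains u where "0 < u" "u < 1" "\<Phi> u = x"
proof -
  obtain c where c: "0 < c" "\<And>s t. s \<le> t \<Longrightarrow> c * (t - s) \<le> \<Phi> (logistic t) - \<Phi> (logistic s)"
    using Phi_logistic_lower by blast
  define T where "T = \<bar>x - \<Phi> (logistic 0)\<bar> / c"
  have T: "0 \<le> T" "c * T = \<bar>x - \<Phi> (logistic 0)\<bar>" using c(1) by (auto simp: T_def)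
  have 1: "\<Phi> (logistic (- T)) \<le> x" using c(2)[of "- T" 0] T by simp
  have 2: "x \<le> \<Phi> (logistic T)" using c(2)[of 0 T] T by simp
  have "continuous_on {- T..T} (\<lambda>t. \<Phi> (logistic t))"
    by (rule DERIV_continuous_on[OF has_field_derivative_at_within[OF Phi_logistic_deriv]])
  with IVT'[of "\<lambda>t. \<Phi> (logistic t)" "- T" x T] 1 2 T obtain t where "\<Phi> (logistic t) = x" by auto
  then show ?thesis using that[of "logistic t"] logistic_bounds by blast
qed

lemma Phi_inj: "inj_on \<Phi> {0<..<1}"
proof (rule inj_onI)
  fix u v assume "u \<in> {0<..<1}" "v \<in> {0<..<1}" "\<Phi> u = \<Phi> v"
  then show "u = v" using Phi_less[of u v] Phi_less[of v u] by (cases u v rule: linorder_cases) auto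
qed

lemma F_Phi: "0 < u \<Longrightarrow> u < 1 \<Longrightarrow> F (\<Phi> u) = u"
  unfolding F_inf_def by (rule the_inv_into_f_f[OF Phi_inj]) auto

lemma F_bounds: "0 < F x" "F x < 1" and Phi_F: "\<Phi> (F x) = x"
proof -
  obtain u where "0 < u" "u < 1" "\<Phi> u = x" using Phi_surj .
  then show "0 < F x" "F x < 1" "\<Phi> (F x) = x" using F_Phi[of u] by auto
qed

lemma F_mono: "x \<le> y \<Longrightarrow> F x \<le> F y"
  using Phi_less[of "F y" "F x"] F_bounds Phi_F by (metis linorder_not_le)

lemma F_cont: "isCont F x"
proof -
  define u where "u = F x"
  have u: "0 < u" "u < 1" "\<Phi> u = x" using F_bounds Phi_F by (auto simp: u_def)
  define d where "d = min u (1 - u) / 2"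
  have d: "0 < d" "0 < u - d" "u + d < 1" using u by (auto simp: d_def min_def field_simps)
  have "isCont F (\<Phi> u)"
  proof (rule isCont_inverse_function[where f="\<Phi>" and x=u and d=d])
    fix z assume z: "\<bar>z - u\<bar> \<le> d"
    show "F (\<Phi> z) = z" using z d by (intro F_Phi) auto
    show "isCont \<Phi> z" using z d by (intro DERIV_isCont[OF Phi_deriv]) auto
  qed (rule d)
  then show ?thesis using u by simp
qed

text \<open>
  The bound on \<open>beta\<close> is repeated in the conclusion because the moment estimate for the particles
  needs it with the same constant \<open>C\<close>.
\<close>

lemma F_tails:
  obtains C m where "0 < C" "\<forall>x. F x \<le> exp ((x - m) / C) \<and> 1 - F x \<le> exp (- (x - m) / C)"
    "\<forall>v. 0 < v \<longrightarrow> v < 1 \<longrightarrow> beta v \<le> C / (v * (1 - v))"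
proof -
  obtain C where C: "0 < C" "\<And>s t. s \<le> t \<Longrightarrow> \<Phi> (logistic t) - \<Phi> (logistic s) \<le> C * (t - s)"
    "\<And>v. 0 < v \<Longrightarrow> v < 1 \<Longrightarrow> beta v \<le> C / (v * (1 - v))"
    using Phi_logistic_upper by blast
  define m where "m = \<Phi> (logistic 0)"
  have "F x \<le> exp ((x - m) / C) \<and> 1 - F x \<le> exp (- (x - m) / C)" for x
  proof -
    obtain t where t: "F x = logistic t" using logistic_surj F_bounds by blast
    have x: "x = \<Phi> (logistic t)" using Phi_F[of x] t by simp
    have logistic_le: "logistic s \<le> exp s" for s
    proof -
      have "1 / (1 + exp (- s)) \<le> 1 / exp (- s)" by (intro divide_left_mono) (auto simp: add_pos_pos)
      also have "1 / exp (- s) = exp s" by (simp add: exp_minus field_simps)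
      finally show ?thesis unfolding logistic_def .
    qed
    have "1 + exp t \<noteq> 0" using exp_gt_zero[of t] by linarith
    then have "1 - logistic t = logistic (- t)" by (simp add: logistic_def exp_minus field_simps)
    then have le: "logistic t \<le> exp t" "1 - logistic t \<le> exp (- t)"
      using logistic_le[of t] logistic_le[of "- t"] by simp_all
    have "F x \<le> exp ((x - m) / C)"
    proof (cases "t \<le> 0")
      case True
      then have "t \<le> (x - m) / C" using C(2)[of t 0] C(1) by (simp add: x m_def field_simps)
      then show ?thesis using le(1) unfolding t by (meson exp_le_cancel_iff order_trans)
    next
      case False
      then have "m \<le> x" using Phi_less[of "logistic 0" "logistic t"] C(2)[of 0 t]
        logistic_bounds by (auto simp: x m_def logistic_def)
      then have "1 \<le> exp ((x - m) / C)" using C(1) by simp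
      then show ?thesis using F_bounds(2)[of x] by linarith
    qed
    moreover have "1 - F x \<le> exp (- (x - m) / C)"
    proof (cases "t \<ge> 0")
      case True
      then have "(x - m) / C \<le> t" using C(2)[of 0 t] C(1) by (simp add: x m_def field_simps)
      then have "- t \<le> - (x - m) / C" by (subst minus_divide_left[symmetric]) simp
      then show ?thesis using le(2) unfolding t by (meson exp_le_cancel_iff order_trans)
    next
      case False
      then have "x \<le> m" using Phi_less[of "logistic t" "logistic 0"]
        logistic_bounds by (auto simp: x m_def logistic_def)
      then have "1 \<le> exp (- (x - m) / C)" using C(1) by (simp add: field_simps)
      then show ?thesis using F_bounds(1)[of x] by linarith
    qed
    ultimately show ?thesis ..
  qed
  then show ?thesis using that[of C m] C by simp
qed

lemma F_lim_bot: "(F \<longlongrightarrow> 0) at_bot" and F_lim_top: "(F \<longlongrightarrow> 1) at_top"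
proof -
  obtain C m where C': "0 < C" "\<forall>x. F x \<le> exp ((x - m) / C) \<and> 1 - F x \<le> exp (- (x - m) / C)"
    "\<forall>v. 0 < v \<longrightarrow> v < 1 \<longrightarrow> beta v \<le> C / (v * (1 - v))"
    using F_tails .
  have C: "0 < C" "\<And>x. F x \<le> exp ((x - m) / C)" "\<And>x. 1 - F x \<le> exp (- (x - m) / C)"
    "\<And>v. 0 < v \<Longrightarrow> v < 1 \<Longrightarrow> beta v \<le> C / (v * (1 - v))"
    using C' by simp_all
  have nonneg: "0 \<le> F x" and le_1: "F x \<le> 1" and ge: "1 - exp (- (x - m) / C) \<le> F x" for x
    using F_bounds[of x] C(3)[of x] by linarith+
  show "(F \<longlongrightarrow> 0) at_bot"
  proof (rule tendsto_sandwich[where f="\<lambda>_. 0" and h="\<lambda>x. exp ((x - m) / C)"])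
    show "((\<lambda>x. exp ((x - m) / C)) \<longlongrightarrow> 0) at_bot" using C(1) by real_asymp
    show "\<forall>\<^sub>F x in at_bot. 0 \<le> F x" by (rule always_eventually) (rule allI nonneg)+
    show "\<forall>\<^sub>F x in at_bot. F x \<le> exp ((x - m) / C)" by (rule always_eventually) (rule allI C(2))+
  qed (rule tendsto_const)
  show "(F \<longlongrightarrow> 1) at_top"
  proof (rule tendsto_sandwich[where h="\<lambda>_. 1" and f="\<lambda>x. 1 - exp (- (x - m) / C)"])
    show "((\<lambda>x. 1 - exp (- (x - m) / C)) \<longlongrightarrow> 1) at_top" using C(1) by real_asymp
    show "\<forall>\<^sub>F x in at_top. F x \<le> 1" by (rule always_eventually) (rule allI le_1)+
    show "\<forall>\<^sub>F x in at_top. 1 - exp (- (x - m) / C) \<le> F x" by (rule always_eventually) (rule allI ge)+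
  qed (rule tendsto_const)
qed

lemma P_real_distribution: "real_distribution P"
  unfolding P_inf_def
  by (rule real_distribution_interval_measure)
     (use F_mono F_cont F_lim_bot F_lim_top continuous_at_imp_continuous_within in blast)+

sublocale P: real_distribution P by (rule P_real_distribution)

lemma measure_P_Iic: "measure P {..x} = F x"
  unfolding P_inf_def
  by (rule measure_interval_measure_Iic)
     (use F_mono F_cont F_lim_bot continuous_at_imp_continuous_within in blast)+

lemma measure_P_singleton: "measure P {x} = 0"
proof -
  have "cdf P = F" by (simp add: fun_eq_iff cdf_def measure_P_Iic)
  then show ?thesis using P.isCont_cdf[of x] F_cont by simp
qed

text \<open>
  The exponent \<open>\<theta> = 1 / (8 * C)\<close> is below \<open>1 / C\<close>, so the tail bounds make the sum over unit shells
  geometric. The factor 8 is the one that \<open>quantile_exp_moment\<close> needs.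
\<close>

lemma P_exp_moment:
  obtains \<theta> M where "0 < \<theta>" "(\<integral>\<^sup>+x. ennreal (exp (\<theta> * \<bar>x\<bar>)) \<partial>P) \<le> ennreal M"
    "\<forall>v. 0 < v \<longrightarrow> v < 1 \<longrightarrow> beta v \<le> 1 / (8 * \<theta>) / (v * (1 - v))"
proof -
  obtain C m where C': "0 < C" "\<forall>x. F x \<le> exp ((x - m) / C) \<and> 1 - F x \<le> exp (- (x - m) / C)"
    "\<forall>v. 0 < v \<longrightarrow> v < 1 \<longrightarrow> beta v \<le> C / (v * (1 - v))"
    using F_tails .
  have C: "0 < C" "\<And>x. F x \<le> exp ((x - m) / C)" "\<And>x. 1 - F x \<le> exp (- (x - m) / C)"
    "\<And>v. 0 < v \<Longrightarrow> v < 1 \<Longrightarrow> beta v \<le> C / (v * (1 - v))"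
    using C' by simp_all
  define \<theta> where "\<theta> = 1 / (8 * C)"
  have \<theta>: "0 < \<theta>" using C by (simp add: \<theta>_def)
  (* a superset of {x. j \<le> \<bar>x\<bar>} whose measure is read off from F *)
  define S where "S j = {..- real j} \<union> {real j - 1<..}" for j :: nat
  have S_meas [measurable]: "S j \<in> sets borel" for j by (simp add: S_def)
  define K where "K = exp (- m / C) + exp ((1 + m) / C)"
  have PS: "measure P (S j) \<le> K * exp (- real j / C)" for j
  proof -
    have "measure P (S j) \<le> measure P {..- real j} + measure P {real j - 1<..}"
      unfolding S_def by (rule measure_Un_le) auto
    also have "measure P {real j - 1<..} = 1 - F (real j - 1)"
    proof -
      have "{real j - 1<..} = space P - {..real j - 1}" by auto
      then show ?thesis using P.prob_compl[of "{..real j - 1}"] by (simp add: measure_P_Iic)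
    qed
    also have "measure P {..- real j} + (1 - F (real j - 1))
        \<le> exp ((- real j - m) / C) + exp (- ((real j - 1) - m) / C)"
      unfolding measure_P_Iic by (intro add_mono C)
    also have "\<dots> = K * exp (- real j / C)"
      by (simp add: K_def distrib_right exp_add[symmetric] add_divide_distrib[symmetric] diff_divide_distrib algebra_simps)
    finally show ?thesis .
  qed
  define r where "r = exp (\<theta> - 1 / C)"
  have r: "0 \<le> r" "r < 1" using C by (auto simp: r_def \<theta>_def field_simps)
  have bound: "ennreal (exp (\<theta> * (real j + 1)) * measure P (S j)) \<le> ennreal (exp \<theta> * K * r ^ j)" for j
  proof -
    have "exp (\<theta> * (real j + 1)) * measure P (S j) \<le> exp (\<theta> * (real j + 1)) * (K * exp (- real j / C))"
      by (intro mult_left_mono PS) simp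
    also have "\<dots> = exp \<theta> * K * r ^ j"
      by (simp add: r_def exp_of_nat_mult[symmetric] exp_add[symmetric] algebra_simps)
    finally show ?thesis by (rule ennreal_leI)
  qed
  have "(\<integral>\<^sup>+x. ennreal (exp (\<theta> * \<bar>x\<bar>)) \<partial>P)
      \<le> (\<integral>\<^sup>+x. (\<Sum>j. ennreal (exp (\<theta> * (real j + 1))) * indicator (S j) x) \<partial>P)"
  proof (rule nn_integral_mono)
    fix x :: real
    (* the shell that contains x *)
    define j where "j = nat \<lfloor>\<bar>x\<bar>\<rfloor>"
    have j: "real j \<le> \<bar>x\<bar>" "\<bar>x\<bar> < real j + 1"
      by (simp_all add: j_def)
    have "x \<in> S j" using j by (auto simp: S_def abs_if split: if_splits)
    moreover have "\<theta> * \<bar>x\<bar> \<le> \<theta> * (real j + 1)" using j \<theta> by (intro mult_left_mono) auto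
    ultimately have "ennreal (exp (\<theta> * \<bar>x\<bar>)) \<le> ennreal (exp (\<theta> * (real j + 1))) * indicator (S j) x"
      by (simp add: ennreal_leI)
    also have "\<dots> \<le> (\<Sum>j. ennreal (exp (\<theta> * (real j + 1))) * indicator (S j) x)"
    proof -
      define f where "f = (\<lambda>j. ennreal (exp (\<theta> * (real j + 1))) * indicator (S j) x)"
      have "f j \<le> suminf f" using sum_le_suminf[of f "{j}"] by simp
      then show ?thesis by (simp only: f_def)
    qed
    finally show "ennreal (exp (\<theta> * \<bar>x\<bar>)) \<le> \<dots>" .
  qed
  also have "\<dots> = (\<Sum>j. ennreal (exp (\<theta> * (real j + 1))) * emeasure P (S j))"
    by (subst nn_integral_suminf) (auto simp: nn_integral_cmult_indicator)
  also have "\<dots> = (\<Sum>j. ennreal (exp (\<theta> * (real j + 1)) * measure P (S j)))"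
    by (simp add: P.emeasure_eq_measure ennreal_mult)
  also have "\<dots> \<le> (\<Sum>j. ennreal (exp \<theta> * K * r ^ j))"
    by (intro suminf_le bound summableI)
  also have "\<dots> = ennreal (\<Sum>j. exp \<theta> * K * r ^ j)"
    using r by (intro suminf_ennreal2 summable_mult summable_geometric) (auto simp: K_def)
  finally have "(\<integral>\<^sup>+x. ennreal (exp (\<theta> * \<bar>x\<bar>)) \<partial>P) \<le> ennreal (\<Sum>j. exp \<theta> * K * r ^ j)" .
  moreover have "beta v \<le> 1 / (8 * \<theta>) / (v * (1 - v))" if "0 < v" "v < 1" for v
    using C(4)[OF that] C(1) by (simp add: \<theta>_def)
  ultimately show ?thesis using that[of \<theta>] \<theta> by blast
qed

end

section \<open>The zero-sum hyperplane in gap coordinates\<close>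

abbreviation Leb :: "nat set \<Rightarrow> (nat \<Rightarrow> real) measure" where
  "Leb I \<equiv> Pi\<^sub>M I (\<lambda>_. lborel)"

interpretation lborel_prod: product_sigma_finite "\<lambda>_::nat. lborel :: real measure"
  by standard

lemma measurable_replace_slot:
  assumes "i \<in> I" and h: "h \<in> borel_measurable (Leb I)"
  shows "(\<lambda>y. y(i := h y)) \<in> measurable (Leb I) (Leb I)"
proof (rule measurable_PiM_single')
  fix j assume j: "j \<in> I"
  show "(\<lambda>y. (y(i := h y)) j) \<in> measurable (Leb I) lborel"
    using h j by (cases "j = i") auto
qed (use assms in \<open>auto simp: space_PiM PiE_def extensional_def\<close>)

text \<open>
  Fubini and the one-dimensional affine substitution. All changes of coordinates below are
  compositions of such maps, so that no determinant has to be computed.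
\<close>

lemma nn_integral_affine_in_one_slot:
  fixes f :: "(nat \<Rightarrow> real) \<Rightarrow> ennreal" and \<phi> :: "(nat \<Rightarrow> real) \<Rightarrow> real"
  assumes I: "finite I" "i \<in> I" and a: "a \<noteq> 0"
    and \<phi>_indep: "\<And>y t. \<phi> (y(i := t)) = \<phi> y"
    and \<phi> [measurable]: "\<phi> \<in> borel_measurable (Leb I)"
    and f [measurable]: "f \<in> borel_measurable (Leb I)"
  shows "(\<integral>\<^sup>+y. f (y(i := \<phi> y + a * y i)) \<partial>Leb I)
    = ennreal (1 / \<bar>a\<bar>) * (\<integral>\<^sup>+y. f y \<partial>Leb I)"
proof -
  define J where "J = I - {i}"
  have J: "finite J" "i \<notin> J" "I = insert i J" using I by (auto simp: J_def)
  have T: "(\<lambda>y. y(i := \<phi> y + a * y i)) \<in> measurable (Leb I) (Leb I)"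
    using I by (intro measurable_replace_slot) auto
  have fT: "(\<lambda>y. f (y(i := \<phi> y + a * y i))) \<in> borel_measurable (Leb (insert i J))"
    using measurable_compose[OF T f] J(3) by simp
  have f': "f \<in> borel_measurable (Leb (insert i J))" using f J(3) by simp
  have upd: "(\<integral>\<^sup>+t. f (x(i := \<phi> (x(i := t)) + a * t)) \<partial>lborel) = ennreal (1 / \<bar>a\<bar>) * (\<integral>\<^sup>+t. f (x(i := t)) \<partial>lborel)"
    if x: "x \<in> space (Leb J)" for x
  proof -
    have m: "(\<lambda>t. f (x(i := t))) \<in> borel_measurable lborel"
      using measurable_comp[OF measurable_component_update[OF x J(2)] f'] by (simp add: comp_def)
    have "(\<integral>\<^sup>+t. f (x(i := t)) \<partial>lborel) = ennreal \<bar>a\<bar> * (\<integral>\<^sup>+t. f (x(i := \<phi> x + a * t)) \<partial>lborel)"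
      using m a by (intro nn_integral_real_affine) auto
    moreover have "ennreal (1 / \<bar>a\<bar>) * (ennreal \<bar>a\<bar> * z) = z" for z
      using a by (simp add: mult.assoc[symmetric] ennreal_mult[symmetric])
    ultimately show ?thesis using \<phi>_indep by simp
  qed
  have "(\<integral>\<^sup>+y. f (y(i := \<phi> y + a * y i)) \<partial>Leb I)
      = (\<integral>\<^sup>+x. (\<integral>\<^sup>+t. f (x(i := \<phi> (x(i := t)) + a * t)) \<partial>lborel) \<partial>Leb J)"
    unfolding J(3) by (subst lborel_prod.product_nn_integral_insert[OF J(1,2) fT]) simp
  also have "\<dots> = (\<integral>\<^sup>+x. ennreal (1 / \<bar>a\<bar>) * (\<integral>\<^sup>+t. f (x(i := t)) \<partial>lborel) \<partial>Leb J)"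
    by (intro nn_integral_cong upd)
  also have "\<dots> = ennreal (1 / \<bar>a\<bar>) * (\<integral>\<^sup>+x. (\<integral>\<^sup>+t. f (x(i := t)) \<partial>lborel) \<partial>Leb J)"
  proof (intro nn_integral_cmult)
    have "(\<lambda>(x, t). f (x(i := t))) \<in> borel_measurable (Leb J \<Otimes>\<^sub>M lborel)"
      using measurable_compose[OF measurable_add_dim f'] by (simp add: split_beta')
    then show "(\<lambda>x. \<integral>\<^sup>+t. f (x(i := t)) \<partial>lborel) \<in> borel_measurable (Leb J)"
      by (intro lborel.borel_measurable_nn_integral) (simp add: split_beta')
  qed
  also have "(\<integral>\<^sup>+x. (\<integral>\<^sup>+t. f (x(i := t)) \<partial>lborel) \<partial>Leb J) = (\<integral>\<^sup>+y. f y \<partial>Leb I)"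
    unfolding J(3) by (subst lborel_prod.product_nn_integral_insert[OF J(1,2) f']) simp
  finally show ?thesis .
qed

definition close_sum :: "nat \<Rightarrow> (nat \<Rightarrow> real) \<Rightarrow> nat \<Rightarrow> real" where
  "close_sum n y = y(n := - (\<Sum>i\<in>{1..<n}. y i))"

lemma close_sum_measurable [measurable]:
  assumes "1 \<le> n"
  shows "close_sum n \<in> measurable (Leb {1..<n}) (Rn n)"
proof -
  have eq: "{1..n} = insert n {1..<n}" using assms by auto
  show ?thesis unfolding close_sum_def[abs_def]
  proof (rule measurable_fun_upd[where J="{1..<n}"])
    show "(\<lambda>y. y) \<in> measurable (Leb {1..<n}) (Pi\<^sub>M {1..<n} (\<lambda>_. borel))"
      by (rule measurable_ident_sets) (intro sets_PiM_cong; simp)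
  qed (use eq in auto)
qed

lemma nn_integral_zero_sum:
  assumes "1 \<le> n" and [measurable]: "f \<in> borel_measurable (Rn n)"
  shows "(\<integral>\<^sup>+z. f z \<partial>zero_sum_measure n)
    = ennreal (sqrt n) * (\<integral>\<^sup>+y. f (close_sum n y) \<partial>Leb {1..<n})"
proof -
  note close_sum_measurable[OF assms(1), measurable]
  have "zero_sum_measure n = scale_measure (ennreal (sqrt n)) (distr (Leb {1..<n}) (Rn n) (close_sum n))"
    by (simp add: zero_sum_measure_def close_sum_def[abs_def])
  moreover have "f \<in> borel_measurable (distr (Leb {1..<n}) (Rn n) (close_sum n))"
    by measurable
  ultimately show ?thesis
    by (simp add: nn_integral_scale_measure nn_integral_distr del: One_nat_def)
qed

text \<open>
  The zero-sum point with consecutive differences \<open>g\<close>; see \<open>from_gaps_diff\<close> and \<open>from_gaps_sum\<close>.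
  At \<open>k = 0\<close>, the rank of a value below the whole sample, the formula gives the same as at \<open>k = 1\<close>.
\<close>

definition from_gaps :: "nat \<Rightarrow> (nat \<Rightarrow> real) \<Rightarrow> nat \<Rightarrow> real" where
  "from_gaps n g k = (\<Sum>j\<in>{1..<n}. (real j / real n - (if k \<le> j then 1 else 0)) * g j)"

lemma from_gaps_diff:
  assumes "1 \<le> k" "k < n"
  shows "from_gaps n g (Suc k) - from_gaps n g k = g k"
proof -
  have "from_gaps n g (Suc k) - from_gaps n g k
      = (\<Sum>j\<in>{1..<n}. (if j = k then g j else 0))"
    unfolding from_gaps_def sum_subtractf[symmetric] by (intro sum.cong) (auto simp: algebra_simps)
  also have "\<dots> = g k" using assms by simp
  finally show ?thesis .
qed

lemma from_gaps_sum:
  assumes "1 \<le> n"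
  shows "(\<Sum>k\<in>{1..n}. from_gaps n g k) = 0"
proof -
  have inner: "(\<Sum>k\<in>{1..n}. (real j / real n - (if k \<le> j then 1 else 0))) = 0" if "j \<in> {1..<n}" for j
  proof -
    have "(\<Sum>k\<in>{1..n}. (if k \<le> j then 1 else 0 :: real)) = (\<Sum>k\<in>{1..n} \<inter> {k. k \<le> j}. 1)"
      by (subst sum.inter_restrict) auto
    also have "{1..n} \<inter> {k. k \<le> j} = {1..j}" using that by auto
    finally show ?thesis using assms by (simp add: sum_subtractf)
  qed
  have "(\<Sum>k\<in>{1..n}. from_gaps n g k)
      = (\<Sum>j\<in>{1..<n}. (\<Sum>k\<in>{1..n}. (real j / real n - (if k \<le> j then 1 else 0))) * g j)"
    unfolding from_gaps_def by (subst sum.swap) (simp add: sum_distrib_right)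
  also have "\<dots> = 0" using inner by (intro sum.neutral) auto
  finally show ?thesis .
qed

lemma from_gaps_measurable [measurable]:
  "(\<lambda>g. from_gaps n g k) \<in> borel_measurable (Leb {1..<n})"
  unfolding from_gaps_def by measurable

text \<open>
  Gaps are replaced by positions one slot at a time, from the last slot downwards: slot \<open>n - 1\<close> is
  computed from all gaps, where its own gap has coefficient \<open>- 1 / n\<close>, and slot \<open>m\<close> is then the
  position in slot \<open>m + 1\<close> minus the gap in slot \<open>m\<close>.
\<close>

lemma nn_integral_from_gaps_partial:
  assumes "d < n"
  shows "\<exists>c>0. \<forall>f. f \<in> borel_measurable (Leb {1..<n}) \<longrightarrow>
    (\<integral>\<^sup>+g. f (\<lambda>k\<in>{1..<n}. if n - d \<le> k then from_gaps n g k else g k) \<partial>Leb {1..<n})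
     = ennreal c * (\<integral>\<^sup>+y. f y \<partial>Leb {1..<n})"
  using assms
proof (induction d)
  case 0
  have "(\<integral>\<^sup>+g. f (\<lambda>k\<in>{1..<n}. if n - 0 \<le> k then from_gaps n g k else g k) \<partial>Leb {1..<n})
      = (\<integral>\<^sup>+y. f y \<partial>Leb {1..<n})" for f
    by (intro nn_integral_cong arg_cong[where f=f]) (auto simp: space_PiM PiE_def extensional_def restrict_def)
  then show ?case by (intro exI[of _ 1] conjI allI impI) (simp_all only: ennreal_1 mult_1_left zero_less_one)
next
  case (Suc d)
  define m where "m = n - Suc d"
  have m: "1 \<le> m" "m < n" "n - d = Suc m" using Suc.prems by (auto simp: m_def)
  have "d < n" using Suc.prems by simp
  then obtain c where c0: "c > 0" "\<forall>f. f \<in> borel_measurable (Leb {1..<n}) \<longrightarrow>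
    (\<integral>\<^sup>+g. f (\<lambda>k\<in>{1..<n}. if n - d \<le> k then from_gaps n g k else g k) \<partial>Leb {1..<n})
     = ennreal c * (\<integral>\<^sup>+y. f y \<partial>Leb {1..<n})"
    using Suc.IH by blast
  note c = c0(1) c0(2)[unfolded m(3), rule_format]
  define H where "H p g = (\<lambda>k\<in>{1..<n}. if p \<le> k then from_gaps n g k else g k)" for p g
  (* coefficient of the gap in slot m, and the remaining part of the position, which does not involve it *)
  define a :: real where "a = (if Suc m = n then - 1 / real n else - 1)"
  define \<phi> :: "(nat \<Rightarrow> real) \<Rightarrow> real" where
    "\<phi> y = (if Suc m = n then (\<Sum>j\<in>{1..<m}. real j / real n * y j) else y (Suc m))" for y
  have a: "a \<noteq> 0" using m by (simp add: a_def)
  have \<phi>_meas: "\<phi> \<in> borel_measurable (Leb {1..<n})"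
  proof (cases "Suc m = n")
    case True
    then have "(\<lambda>y. \<Sum>j\<in>{1..<m}. real j / real n * y j) \<in> borel_measurable (Leb {1..<n})"
      by (intro borel_measurable_sum borel_measurable_times borel_measurable_const) auto
    then show ?thesis using True by (simp add: \<phi>_def[abs_def])
  next
    case False
    then have "Suc m \<in> {1..<n}" using m by auto
    then have "(\<lambda>y. y (Suc m)) \<in> borel_measurable (Leb {1..<n})" by measurable
    then show ?thesis using False by (simp add: \<phi>_def[abs_def])
  qed
  have step: "H m g = (H (Suc m) g)(m := \<phi> (H (Suc m) g) + a * H (Suc m) g m)" for g
  proof -
    have "from_gaps n g m = \<phi> (H (Suc m) g) + a * g m"
    proof (cases "Suc m = n")
      case True
      have "{1..<n} = insert m {1..<m}" using True m by auto
      then have "from_gaps n g m = (real m / real n - 1) * g m + (\<Sum>j\<in>{1..<m}. real j / real n * g j)"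
        by (simp add: from_gaps_def)
      moreover have "real m / real n - 1 = - 1 / real n" using True by (auto simp: field_simps)
      moreover have "\<phi> (H (Suc m) g) = (\<Sum>j\<in>{1..<m}. real j / real n * g j)"
        using True unfolding \<phi>_def H_def by (auto intro!: sum.cong)
      ultimately show ?thesis using True by (simp add: a_def)
    next
      case False
      then show ?thesis using from_gaps_diff[of m n g] m by (simp add: \<phi>_def a_def H_def)
    qed
    then show ?thesis using m by (auto simp: H_def fun_eq_iff)
  qed
  have "(\<integral>\<^sup>+g. f (H m g) \<partial>Leb {1..<n})
      = ennreal (c * (1 / \<bar>a\<bar>)) * (\<integral>\<^sup>+y. f y \<partial>Leb {1..<n})"
    if f [measurable]: "f \<in> borel_measurable (Leb {1..<n})" for f
  proof -
    note \<phi>_meas [measurable]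
    have T: "(\<lambda>y. y(m := \<phi> y + a * y m)) \<in> measurable (Leb {1..<n}) (Leb {1..<n})"
    proof (rule measurable_replace_slot)
      have "m \<in> {1..<n}" using m by simp
      then show "(\<lambda>y. \<phi> y + a * y m) \<in> borel_measurable (Leb {1..<n})" by measurable
    qed (use m in simp)
    have "(\<integral>\<^sup>+g. f (H m g) \<partial>Leb {1..<n})
        = ennreal c * (\<integral>\<^sup>+y. f (y(m := \<phi> y + a * y m)) \<partial>Leb {1..<n})"
      unfolding step using c(2)[OF measurable_compose[OF T f]] by (simp add: H_def)
    also have "(\<integral>\<^sup>+y. f (y(m := \<phi> y + a * y m)) \<partial>Leb {1..<n})
        = ennreal (1 / \<bar>a\<bar>) * (\<integral>\<^sup>+y. f y \<partial>Leb {1..<n})"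
      using m by (intro nn_integral_affine_in_one_slot a \<phi>_meas f) (auto simp: \<phi>_def intro!: sum.cong)
    also have "ennreal c * (ennreal (1 / \<bar>a\<bar>) * z) = ennreal (c * (1 / \<bar>a\<bar>)) * z" for z
      using c(1) by (subst ennreal_mult) (auto simp: mult.assoc)
    finally show ?thesis .
  qed
  moreover have "0 < c * (1 / \<bar>a\<bar>)" using c(1) a by simp
  ultimately show ?case unfolding m_def[symmetric] H_def by blast
qed

definition gap_point :: "nat \<Rightarrow> (nat \<Rightarrow> real) \<Rightarrow> nat \<Rightarrow> real" where
  "gap_point n g = (\<lambda>k\<in>{1..n}. from_gaps n g k)"

lemma nn_integral_zero_sum_gaps:
  assumes "1 \<le> n"
  shows "\<exists>c>0. \<forall>f. f \<in> borel_measurable (Rn n) \<longrightarrow>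
    (\<integral>\<^sup>+z. f z \<partial>zero_sum_measure n) = ennreal c * (\<integral>\<^sup>+g. f (gap_point n g) \<partial>Leb {1..<n})"
proof -
  obtain c where c: "c > 0" "\<And>f. f \<in> borel_measurable (Leb {1..<n}) \<Longrightarrow>
    (\<integral>\<^sup>+g. f (\<lambda>k\<in>{1..<n}. if n - (n - 1) \<le> k then from_gaps n g k else g k) \<partial>Leb {1..<n})
     = ennreal c * (\<integral>\<^sup>+y. f y \<partial>Leb {1..<n})"
    using nn_integral_from_gaps_partial[of "n - 1" n] assms by auto
  have close: "close_sum n (\<lambda>k\<in>{1..<n}. if n - (n - 1) \<le> k then from_gaps n g k else g k) = gap_point n g" for g
  proof
    fix k
    have "{1..n} = insert n {1..<n}" using assms by auto
    then have "from_gaps n g n = - (\<Sum>i\<in>{1..<n}. from_gaps n g i)"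
      using from_gaps_sum[OF assms, of g] by simp
    then show "close_sum n (\<lambda>k\<in>{1..<n}. if n - (n - 1) \<le> k then from_gaps n g k else g k) k = gap_point n g k"
      using assms by (auto simp: close_sum_def gap_point_def restrict_def intro!: sum.cong)
  qed
  have "(\<integral>\<^sup>+z. f z \<partial>zero_sum_measure n)
      = ennreal (sqrt n / c) * (\<integral>\<^sup>+g. f (gap_point n g) \<partial>Leb {1..<n})"
    if f [measurable]: "f \<in> borel_measurable (Rn n)" for f
  proof -
    note close_sum_measurable[OF assms(1), measurable]
    have "(\<integral>\<^sup>+g. f (gap_point n g) \<partial>Leb {1..<n})
        = ennreal c * (\<integral>\<^sup>+y. f (close_sum n y) \<partial>Leb {1..<n})"
      using c(2)[OF measurable_compose[OF close_sum_measurable[OF assms] f]] unfolding close .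
    moreover have "ennreal (sqrt n / c) * (ennreal c * z) = ennreal (sqrt n) * z" for z
      using c(1) by (simp add: mult.assoc[symmetric] ennreal_mult[symmetric])
    ultimately show ?thesis by (simp add: nn_integral_zero_sum[OF assms f])
  qed
  then show ?thesis using c(1) assms by (intro exI[of _ "sqrt n / c"]) auto
qed

section \<open>Permutations and orderings of the coordinates\<close>

definition permute_coords :: "nat \<Rightarrow> (nat \<Rightarrow> nat) \<Rightarrow> (nat \<Rightarrow> real) \<Rightarrow> nat \<Rightarrow> real" where
  "permute_coords n \<pi> x = (\<lambda>i\<in>{1..n}. x (\<pi> i))"

lemma permute_coords_measurable [measurable]:
  assumes "\<pi> permutes {1..n}"
  shows "permute_coords n \<pi> \<in> measurable (Rn n) (Rn n)"
  unfolding permute_coords_def[abs_def]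
proof (rule measurable_restrict)
  fix i assume "i \<in> {1..n}"
  then have "\<pi> i \<in> {1..n}" using permutes_in_image[OF assms] by blast
  then show "(\<lambda>x. x (\<pi> i)) \<in> borel_measurable (Rn n)" by measurable
qed

lemma permute_coords_comp:
  assumes "p permutes {1..n}"
  shows "permute_coords n (q \<circ> p) z = permute_coords n p (permute_coords n q z)"
proof -
  have "p i \<in> {1..n}" if "i \<in> {1..n}" for i using that permutes_in_image[OF assms] by blast
  then show ?thesis by (auto simp: permute_coords_def fun_eq_iff)
qed

lemma permute_coords_id: "z \<in> space (Rn n) \<Longrightarrow> permute_coords n id z = z"
  by (auto simp: permute_coords_def space_PiM PiE_def extensional_def fun_eq_iff)

text \<open>
  The parametrisation of the hyperplane singles out the last coordinate. Exchanging it with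
  coordinate \<open>i\<close> replaces slot \<open>i\<close> by minus the sum of all slots, which is an affine map in one slot with
  factor \<open>- 1\<close>.
\<close>

lemma zero_sum_swap_last:
  assumes i: "1 \<le> i" "i < n" and f [measurable]: "f \<in> borel_measurable (Rn n)"
  shows "(\<integral>\<^sup>+z. f (permute_coords n (Transposition.transpose i n) z) \<partial>zero_sum_measure n) = (\<integral>\<^sup>+z. f z \<partial>zero_sum_measure n)"
proof -
  have n: "1 \<le> n" using i by simp
  have perm: "Transposition.transpose i n permutes {1..n}" using i by (intro permutes_swap_id) auto
  note close_sum_measurable[OF n, measurable] permute_coords_measurable[OF perm, measurable]
  define \<phi> :: "(nat \<Rightarrow> real) \<Rightarrow> real" where "\<phi> y = - (\<Sum>j\<in>{1..<n} - {i}. y j)" for y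
  have sum: "(\<Sum>j\<in>{1..<n}. y j) = y i - \<phi> y" for y
    using i sum.remove[of "{1..<n}" i y] by (simp add: \<phi>_def)
  have \<phi>_upd: "\<phi> (y(i := t)) = \<phi> y" for y t by (auto simp: \<phi>_def intro!: sum.cong)
  have \<phi>_meas [measurable]: "\<phi> \<in> borel_measurable (Leb {1..<n})"
    unfolding \<phi>_def[abs_def] by measurable
  have swap: "permute_coords n (Transposition.transpose i n) (close_sum n y) = close_sum n (y(i := \<phi> y + - 1 * y i))"
    if y: "y \<in> space (Leb {1..<n})" for y
  proof
    fix k
    have out: "y k = undefined" if "k \<notin> {1..<n}" for k
      using y that by (auto simp: space_PiM PiE_def extensional_def)
    show "permute_coords n (Transposition.transpose i n) (close_sum n y) k = close_sum n (y(i := \<phi> y + - 1 * y i)) k"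
      using i out[of k] unfolding close_sum_def sum \<phi>_upd
      by (auto simp: permute_coords_def Transposition.transpose_def restrict_def)
  qed
  have "(\<integral>\<^sup>+z. f (permute_coords n (Transposition.transpose i n) z) \<partial>zero_sum_measure n)
      = ennreal (sqrt n) * (\<integral>\<^sup>+y. f (permute_coords n (Transposition.transpose i n) (close_sum n y)) \<partial>Leb {1..<n})"
    by (rule nn_integral_zero_sum[OF n]) measurable
  also have "(\<integral>\<^sup>+y. f (permute_coords n (Transposition.transpose i n) (close_sum n y)) \<partial>Leb {1..<n})
      = (\<integral>\<^sup>+y. f (close_sum n (y(i := \<phi> y + - 1 * y i))) \<partial>Leb {1..<n})"
    by (intro nn_integral_cong) (simp add: swap)
  also have "\<dots> = (\<integral>\<^sup>+y. f (close_sum n y) \<partial>Leb {1..<n})"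
  proof (subst nn_integral_affine_in_one_slot[of "{1..<n}" i "- 1" \<phi> "\<lambda>y. f (close_sum n y)"])
    show "(\<lambda>y. f (close_sum n y)) \<in> borel_measurable (Leb {1..<n})" by measurable
  qed (use i \<phi>_meas in \<open>auto simp: \<phi>_upd simp del: One_nat_def\<close>)
  also have "ennreal (sqrt n) * \<dots> = (\<integral>\<^sup>+z. f z \<partial>zero_sum_measure n)"
    by (rule nn_integral_zero_sum[OF n f, symmetric])
  finally show ?thesis .
qed

text \<open>
  Transpositions with the last coordinate generate all permutations.
\<close>

lemma zero_sum_permute:
  assumes \<pi>: "\<pi> permutes {1..n}" and n: "1 \<le> n" and f: "f \<in> borel_measurable (Rn n)"
  shows "(\<integral>\<^sup>+z. f (permute_coords n \<pi> z) \<partial>zero_sum_measure n) = (\<integral>\<^sup>+z. f z \<partial>zero_sum_measure n)"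
proof -
  define inv where "inv \<pi> \<longleftrightarrow> \<pi> permutes {1..n} \<and> (\<forall>f. f \<in> borel_measurable (Rn n) \<longrightarrow>
    (\<integral>\<^sup>+z. f (permute_coords n \<pi> z) \<partial>zero_sum_measure n) = (\<integral>\<^sup>+z. f z \<partial>zero_sum_measure n))" for \<pi>
  have inv_comp: "inv (q \<circ> p)" if q: "inv q" and p: "inv p" for p q
    unfolding inv_def
  proof (intro conjI allI impI)
    show "q \<circ> p permutes {1..n}" using p q by (auto simp: inv_def intro: permutes_compose)
    fix f :: "(nat \<Rightarrow> real) \<Rightarrow> ennreal" assume f: "f \<in> borel_measurable (Rn n)"
    have "(\<integral>\<^sup>+z. f (permute_coords n (q \<circ> p) z) \<partial>zero_sum_measure n)
        = (\<integral>\<^sup>+z. f (permute_coords n p (permute_coords n q z)) \<partial>zero_sum_measure n)"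
      using p by (simp add: inv_def permute_coords_comp)
    also have "\<dots> = (\<integral>\<^sup>+z. f (permute_coords n p z) \<partial>zero_sum_measure n)"
      using p q measurable_compose[OF permute_coords_measurable f] by (auto simp: inv_def)
    also have "\<dots> = (\<integral>\<^sup>+z. f z \<partial>zero_sum_measure n)" using p f by (simp add: inv_def)
    finally show "(\<integral>\<^sup>+z. f (permute_coords n (q \<circ> p) z) \<partial>zero_sum_measure n) = (\<integral>\<^sup>+z. f z \<partial>zero_sum_measure n)" .
  qed
  have inv_last: "inv (Transposition.transpose i n)" if "i \<in> {1..n}" "i \<noteq> n" for i
    unfolding inv_def using that n by (auto intro!: permutes_swap_id zero_sum_swap_last)
  have inv_transpose: "inv (Transposition.transpose a b)" if "a \<in> {1..n}" "b \<in> {1..n}" "a \<noteq> b" for a b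
  proof -
    consider "a = n" | "b = n" | "a \<noteq> n" "b \<noteq> n" by blast
    then show ?thesis
    proof cases
      case 1 then show ?thesis using inv_last[of b] that by (simp add: transpose_commute)
    next
      case 2 then show ?thesis using inv_last[of a] that by simp
    next
      case 3
      then have "Transposition.transpose a b = Transposition.transpose a n \<circ> (Transposition.transpose b n \<circ> Transposition.transpose a n)"
        using that by (auto simp: fun_eq_iff Transposition.transpose_def)
      then show ?thesis using inv_comp inv_last 3 that by simp
    qed
  qed
  have space: "space (zero_sum_measure n) = space (Rn n)" by (simp add: zero_sum_measure_def space_scale_measure)
  have "inv \<pi>"
    using \<pi> finite_atLeastAtMost
  proof (induction \<pi> rule: permutes_induct)
    case id
    have "(\<integral>\<^sup>+z. f (permute_coords n id z) \<partial>zero_sum_measure n) = (\<integral>\<^sup>+z. f z \<partial>zero_sum_measure n)" for f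
      by (intro nn_integral_cong) (simp add: space permute_coords_id)
    then show ?case unfolding inv_def by (intro conjI permutes_id allI impI)
  next
    case (swap a b p)
    then show ?case using inv_comp inv_transpose by blast
  qed
  then show ?thesis using f by (simp add: inv_def)
qed

lemma order_stat_permute:
  assumes "\<pi> permutes {1..n}"
  shows "order_stat n (permute_coords n \<pi> z) k = order_stat n z k"
proof -
  have upt: "mset [1..<Suc n] = mset_set {1..n}"
    by (simp only: mset_upt atLeastLessThanSuc_atLeastAtMost)
  have "mset (map (permute_coords n \<pi> z) [1..<Suc n]) = image_mset (\<lambda>i. z (\<pi> i)) (mset_set {1..n})"
    unfolding mset_map upt by (intro image_mset_cong) (auto simp: permute_coords_def)
  also have "\<dots> = image_mset z (image_mset \<pi> (mset_set {1..n}))"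
    by (simp add: multiset.map_comp comp_def)
  also have "image_mset \<pi> (mset_set {1..n}) = mset_set {1..n}"
    using assms by (simp add: image_mset_mset_set permutes_inj_on permutes_image)
  also have "image_mset z (mset_set {1..n}) = mset (map z [1..<Suc n])"
    unfolding mset_map upt ..
  finally show ?thesis unfolding order_stat_def by (metis mset_sort properties_for_sort sorted_sort)
qed

definition ordered_points :: "nat \<Rightarrow> (nat \<Rightarrow> real) set" where
  "ordered_points n = {z. \<forall>k\<in>{1..<n}. z k \<le> z (Suc k)}"

lemma ordered_points_le:
  assumes "z \<in> ordered_points n" "1 \<le> i" "i \<le> j" "j \<le> n"
  shows "z i \<le> z j"
  using assms(3,4)
proof (induction j rule: dec_induct)
  case (step j)
  have "z j \<le> z (Suc j)" using step assms by (auto simp: ordered_points_def)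
  then show ?case using step by simp
qed simp

lemma order_stat_ordered:
  assumes "z \<in> ordered_points n" "k \<in> {1..n}"
  shows "order_stat n z k = z k"
proof -
  have "sorted (map z [1..<Suc n])"
    unfolding sorted_iff_nth_mono using ordered_points_le[OF assms(1)] by (auto simp del: upt_Suc)
  then have "sort (map z [1..<Suc n]) = map z [1..<Suc n]" by (rule sorted_sort_id)
  moreover have "map z [1..<Suc n] ! (k - 1) = z k"
    using assms(2) by (subst nth_map) (auto simp: nth_upt simp del: upt_Suc)
  ultimately show ?thesis by (simp only: order_stat_def)
qed

lemma exists_ordering:
  obtains \<pi> where "\<pi> permutes {1..n}" "permute_coords n \<pi> z \<in> ordered_points n"
proof -
  define l where "l = sort_key z [1..<Suc n]"
  have l: "length l = n" "set l = {1..n}" "distinct l" "sorted (map z l)"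
    by (auto simp: l_def)
  define \<pi> where "\<pi> k = (if k \<in> {1..n} then l ! (k - 1) else k)" for k
  have "bij_betw (\<lambda>k. l ! (k - 1)) {1..n} {1..n}"
  proof -
    have "bij_betw (\<lambda>k. k - 1) {1..n} {..<n}"
      by (rule bij_betwI[where g=Suc]) auto
    moreover have "bij_betw ((!) l) {..<n} {1..n}" using l by (intro bij_betw_nth) auto
    ultimately show ?thesis using bij_betw_trans by (fastforce simp: comp_def)
  qed
  then have "bij_betw \<pi> {1..n} {1..n}"
    by (rule bij_betw_cong[THEN iffD1, rotated]) (simp add: \<pi>_def)
  then have "\<pi> permutes {1..n}" by (rule bij_imp_permutes) (auto simp: \<pi>_def)
  moreover have "permute_coords n \<pi> z \<in> ordered_points n"
  proof -
    have "z (l ! (k - 1)) \<le> z (l ! k)" if "k \<in> {1..<n}" for k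
      using sorted_nth_mono[OF l(4), of "k - 1" k] that l(1) by auto
    then show ?thesis by (auto simp: ordered_points_def permute_coords_def \<pi>_def)
  qed
  ultimately show ?thesis using that by blast
qed

text \<open>
  A permutation that keeps a strictly increasing point ordered is strictly increasing, hence
  satisfies \<open>k \<le> \<pi> k\<close>; summing over \<open>k\<close> forces equality.
\<close>

lemma ordering_unique:
  assumes z: "\<And>k. k \<in> {1..<n} \<Longrightarrow> z k < z (Suc k)" and \<pi>: "\<pi> permutes {1..n}"
    and ord: "permute_coords n \<pi> z \<in> ordered_points n"
  shows "\<pi> = id"
proof -
  have z_less: "z i < z j" if "1 \<le> i" "i < j" "j \<le> n" for i j
  proof -
    have "z i < z (Suc m)" if "i \<le> m" "m < n" for m
      using that
    proof (induction m rule: dec_induct)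
      case base then show ?case using z \<open>1 \<le> i\<close> by simp
    next
      case (step m)
      then have "z (Suc m) < z (Suc (Suc m))" using z \<open>1 \<le> i\<close> by simp
      then show ?case using step by simp
    qed
    from this[of "j - 1"] that show ?thesis by simp
  qed
  have \<pi>_in: "\<pi> k \<in> {1..n}" if "k \<in> {1..n}" for k using permutes_in_image[OF \<pi>] that by blast
  have \<pi>_less: "\<pi> i < \<pi> j" if "1 \<le> i" "i < j" "j \<le> n" for i j
  proof -
    have "z (\<pi> i) \<le> z (\<pi> j)"
      using ordered_points_le[OF ord, of i j] that by (simp add: permute_coords_def)
    then have "\<not> \<pi> j < \<pi> i" using z_less[of "\<pi> j" "\<pi> i"] \<pi>_in[of i] \<pi>_in[of j] that by auto
    moreover have "\<pi> i \<noteq> \<pi> j" using inj_onD[OF permutes_inj_on[OF \<pi>], of i j UNIV] that by auto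
    ultimately show ?thesis by simp
  qed
  have ge: "k \<le> \<pi> k" if "1 \<le> k" "k \<le> n" for k
    using that
  proof (induction k rule: dec_induct)
    case base then show ?case using \<pi>_in[of 1] by simp
  next
    case (step k) then show ?case using \<pi>_less[of k "Suc k"] by simp
  qed
  have "(\<Sum>k\<in>{1..n}. \<pi> k - k) = 0"
  proof -
    have "(\<Sum>k\<in>{1..n}. \<pi> k - k) = (\<Sum>k\<in>{1..n}. \<pi> k) - (\<Sum>k\<in>{1..n}. k)"
      using ge by (intro sum_subtractf_nat) auto
    moreover have "(\<Sum>k\<in>{1..n}. \<pi> k) = (\<Sum>k\<in>{1..n}. k)"
      using sum.permute[OF \<pi>, of "\<lambda>k. k"] by (simp add: comp_def)
    ultimately show ?thesis by simp
  qed
  then have "\<pi> k = k" if "k \<in> {1..n}" for k using ge[of k] that by (auto simp: le_antisym)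
  moreover have "\<pi> k = k" if "k \<notin> {1..n}" for k using permutes_not_in[OF \<pi> that] .
  ultimately show ?thesis by (auto simp: fun_eq_iff)
qed

text \<open>
  This is 1 for points with distinct coordinates. Dividing by it makes the decomposition into
  ordered chambers exact also at points with ties.
\<close>

definition num_orderings :: "nat \<Rightarrow> (nat \<Rightarrow> real) \<Rightarrow> nat" where
  "num_orderings n z = card {\<pi>. \<pi> permutes {1..n} \<and> permute_coords n \<pi> z \<in> ordered_points n}"

lemma num_orderings_eq_sum:
  "num_orderings n z = (\<Sum>\<pi> | \<pi> permutes {1..n}. of_bool (permute_coords n \<pi> z \<in> ordered_points n))"
proof -
  have "num_orderings n z = card ({\<pi>. \<pi> permutes {1..n}} \<inter> {\<pi>. permute_coords n \<pi> z \<in> ordered_points n})"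
    unfolding num_orderings_def by (rule arg_cong[where f=card]) auto
  then show ?thesis by (simp add: of_bool_def sum.If_cases finite_permutations)
qed

lemma num_orderings_permute:
  assumes \<tau>: "\<tau> permutes {1..n}"
  shows "num_orderings n (permute_coords n \<tau> z) = num_orderings n z"
proof -
  have "num_orderings n (permute_coords n \<tau> z)
      = (\<Sum>\<pi> | \<pi> permutes {1..n}. of_bool (permute_coords n (\<tau> \<circ> \<pi>) z \<in> ordered_points n))"
    unfolding num_orderings_eq_sum by (intro sum.cong refl) (simp add: permute_coords_comp)
  also have "\<dots> = num_orderings n z"
    unfolding num_orderings_eq_sum
    using setum_permutations_compose_left[OF \<tau>, of "\<lambda>\<pi>. of_bool (permute_coords n \<pi> z \<in> ordered_points n) :: nat"]
    by simp
  finally show ?thesis .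
qed

lemma num_orderings_pos: "num_orderings n z \<noteq> 0"
  using exists_ordering[of n z] finite_subset[OF _ finite_permutations[of "{1..n}"]]
  unfolding num_orderings_def by (subst card_0_eq) auto

lemma num_orderings_strict:
  assumes z: "z \<in> space (Rn n)" "\<And>k. k \<in> {1..<n} \<Longrightarrow> z k < z (Suc k)"
  shows "num_orderings n z = 1"
proof -
  have "z \<in> ordered_points n" using z(2) by (auto simp: ordered_points_def less_imp_le)
  then have "{\<pi>. \<pi> permutes {1..n} \<and> permute_coords n \<pi> z \<in> ordered_points n} = {id}"
    using ordering_unique[where z=z and n=n, OF z(2)] permute_coords_id[OF z(1)] permutes_id by auto
  then show ?thesis by (simp add: num_orderings_def)
qed

lemma ordered_points_measurable [measurable]: "Measurable.pred (Rn n) (\<lambda>z. z \<in> ordered_points n)"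
  unfolding ordered_points_def mem_Collect_eq
proof (intro pred_intros_finite)
  fix k assume "k \<in> {1..<n}"
  then have "k \<in> {1..n}" "Suc k \<in> {1..n}" by auto
  then have "(\<lambda>z. z k) \<in> borel_measurable (Rn n)" "(\<lambda>z. z (Suc k)) \<in> borel_measurable (Rn n)"
    by (blast intro: measurable_component_singleton)+
  then show "Measurable.pred (Rn n) (\<lambda>z. z k \<le> z (Suc k))"
    unfolding pred_def by (rule borel_measurable_le)
qed simp

lemma num_orderings_measurable [measurable]:
  "(\<lambda>z. real (num_orderings n z)) \<in> borel_measurable (Rn n)"
proof -
  have eq: "(\<lambda>z. real (num_orderings n z)) = (\<lambda>z. \<Sum>\<pi> | \<pi> permutes {1..n}. indicator {z. z \<in> ordered_points n} (permute_coords n \<pi> z))"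
    by (auto simp: num_orderings_eq_sum fun_eq_iff indicator_def of_bool_def intro!: sum.cong)
  show ?thesis unfolding eq
  proof (intro borel_measurable_sum)
    fix \<pi> assume "\<pi> \<in> {\<pi>. \<pi> permutes {1..n}}"
    then have [measurable]: "permute_coords n \<pi> \<in> measurable (Rn n) (Rn n)"
      by (intro permute_coords_measurable) simp
    show "(\<lambda>z. indicat_real {z. z \<in> ordered_points n} (permute_coords n \<pi> z)) \<in> borel_measurable (Rn n)"
      unfolding indicator_def by measurable
  qed
qed

text \<open>
  The hyperplane is covered by the images of the ordered points under permutations, each point
  \<open>num_orderings\<close> times, and all images contribute equally.
\<close>

lemma nn_integral_symmetric_zero_sum:
  assumes n: "1 \<le> n" and f [measurable]: "f \<in> borel_measurable (Rn n)"
    and sym: "\<And>\<pi> z. \<pi> permutes {1..n} \<Longrightarrow> z \<in> space (Rn n) \<Longrightarrow> f (permute_coords n \<pi> z) = f z"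
  shows "(\<integral>\<^sup>+z. f z \<partial>zero_sum_measure n)
    = of_nat (fact n) * (\<integral>\<^sup>+z. f z * ennreal (of_bool (z \<in> ordered_points n) / num_orderings n z) \<partial>zero_sum_measure n)"
proof -
  define h where "h z = f z * ennreal (of_bool (z \<in> ordered_points n) / num_orderings n z)" for z
  have space: "space (zero_sum_measure n) = space (Rn n)" by (simp add: zero_sum_measure_def space_scale_measure)
  have sets [measurable_cong]: "sets (zero_sum_measure n) = sets (Rn n)" by (simp add: zero_sum_measure_def space_scale_measure)
  have h [measurable]: "h \<in> borel_measurable (Rn n)" unfolding h_def[abs_def] of_bool_def by measurable
  have split: "f z = (\<Sum>\<pi> | \<pi> permutes {1..n}. h (permute_coords n \<pi> z))" if z: "z \<in> space (Rn n)" for z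
  proof -
    have "(\<Sum>\<pi> | \<pi> permutes {1..n}. h (permute_coords n \<pi> z))
        = (\<Sum>\<pi> | \<pi> permutes {1..n}. f z * ennreal (of_bool (permute_coords n \<pi> z \<in> ordered_points n) / num_orderings n z))"
      using sym z by (intro sum.cong refl) (simp add: h_def num_orderings_permute del: One_nat_def)
    also have "\<dots> = f z * ennreal (\<Sum>\<pi> | \<pi> permutes {1..n}. of_bool (permute_coords n \<pi> z \<in> ordered_points n) / num_orderings n z)"
      by (simp add: sum_distrib_left[symmetric] sum_ennreal)
    also have "(\<Sum>\<pi> | \<pi> permutes {1..n}. of_bool (permute_coords n \<pi> z \<in> ordered_points n) / real (num_orderings n z))
        = real (num_orderings n z) / real (num_orderings n z)"
      unfolding sum_divide_distrib[symmetric] by (subst (2) num_orderings_eq_sum) simp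
    finally show ?thesis using num_orderings_pos[of n z] by simp
  qed
  have "(\<integral>\<^sup>+z. f z \<partial>zero_sum_measure n) = (\<integral>\<^sup>+z. (\<Sum>\<pi> | \<pi> permutes {1..n}. h (permute_coords n \<pi> z)) \<partial>zero_sum_measure n)"
    by (intro nn_integral_cong split) (simp add: space)
  also have "\<dots> = (\<Sum>\<pi> | \<pi> permutes {1..n}. \<integral>\<^sup>+z. h (permute_coords n \<pi> z) \<partial>zero_sum_measure n)"
    by (rule nn_integral_sum) (use measurable_compose[OF permute_coords_measurable h] in \<open>auto simp: measurable_cong_sets[OF sets refl]\<close>)
  also have "\<dots> = (\<Sum>\<pi> | \<pi> permutes {1..n}. \<integral>\<^sup>+z. h z \<partial>zero_sum_measure n)"
    by (intro sum.cong refl zero_sum_permute n h) simp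
  also have "\<dots> = of_nat (fact n) * (\<integral>\<^sup>+z. h z \<partial>zero_sum_measure n)"
    by (simp add: card_permutations)
  finally show ?thesis by (simp add: h_def)
qed

section \<open>The Gibbs weight in gap coordinates\<close>

text \<open>
  Sorting is not visibly measurable, but this average over the permutations that order the point is.
\<close>

lemma order_stat_eq_average:
  "order_stat n z k = (\<Sum>\<pi> | \<pi> permutes {1..n}. of_bool (permute_coords n \<pi> z \<in> ordered_points n) * permute_coords n \<pi> z k)
     / real (num_orderings n z)" if k: "k \<in> {1..n}"
proof -
  have "(\<Sum>\<pi> | \<pi> permutes {1..n}. of_bool (permute_coords n \<pi> z \<in> ordered_points n) * permute_coords n \<pi> z k)
      = (\<Sum>\<pi> | \<pi> permutes {1..n}. of_bool (permute_coords n \<pi> z \<in> ordered_points n) * order_stat n z k)"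
  proof (intro sum.cong refl)
    fix \<pi> assume "\<pi> \<in> {\<pi>. \<pi> permutes {1..n}}"
    then show "of_bool (permute_coords n \<pi> z \<in> ordered_points n) * permute_coords n \<pi> z k
        = of_bool (permute_coords n \<pi> z \<in> ordered_points n) * order_stat n z k"
      using order_stat_ordered[OF _ k, of "permute_coords n \<pi> z"] order_stat_permute[of \<pi> n z k]
      by (auto simp del: One_nat_def)
  qed
  also have "\<dots> = real (num_orderings n z) * order_stat n z k"
    by (simp add: num_orderings_eq_sum sum_distrib_right del: One_nat_def)
  finally show ?thesis using num_orderings_pos[of n z] by (simp del: One_nat_def)
qed

lemma order_stat_measurable:
  assumes k: "k \<in> {1..n}"
  shows "(\<lambda>z. order_stat n z k) \<in> borel_measurable (Rn n)"
proof -
  have "(\<lambda>z. of_bool (permute_coords n \<pi> z \<in> ordered_points n) * permute_coords n \<pi> z k) \<in> borel_measurable (Rn n)"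
    if "\<pi> permutes {1..n}" for \<pi>
  proof (rule measurable_compose[OF permute_coords_measurable[OF that]])
    have "(\<lambda>z. z k) \<in> borel_measurable (Rn n)" by (rule measurable_component_singleton[OF k])
    note this[measurable]
    show "(\<lambda>z. of_bool (z \<in> ordered_points n) * z k) \<in> borel_measurable (Rn n)"
      unfolding of_bool_def by measurable
  qed
  then show ?thesis
    unfolding order_stat_eq_average[OF k]
    by (intro borel_measurable_divide num_orderings_measurable borel_measurable_sum) auto
qed

lemma AE_coords_nonzero:
  assumes "finite I"
  shows "AE g in Leb I. \<forall>j\<in>I. g j \<noteq> 0"
proof -
  have "AE g in Leb I. g j \<noteq> 0" if j: "j \<in> I" for j
  proof -
    have "(\<integral>\<^sup>+g. (\<Prod>i\<in>I. (if i = j then indicator {0} (g i) else 1)) \<partial>Leb I)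
        = (\<Prod>i\<in>I. \<integral>\<^sup>+t. (if i = j then indicator {0} (t :: real) else 1) \<partial>lborel)"
      using lborel_prod.product_nn_integral_prod[OF assms, where f="\<lambda>i t. if i = j then indicator {0} t else 1"] by simp
    also have "\<dots> = 0" using assms j by (intro prod_zero) (auto intro!: bexI[of _ j])
    also have "(\<lambda>g::nat\<Rightarrow>real. \<Prod>i\<in>I. (if i = j then indicator {0} (g i) else 1)) = (\<lambda>g. indicator {0} (g j) :: ennreal)"
      using assms j by (simp add: prod.delta fun_eq_iff)
    finally have "(\<integral>\<^sup>+g. indicator {0} (g j) \<partial>Leb I) = 0" .
    then have "AE g in Leb I. indicator {0} (g j) = (0::ennreal)"
      using j by (subst (asm) nn_integral_0_iff_AE) auto
    then show ?thesis by (rule AE_mp) (auto simp: indicator_def)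
  qed
  then show ?thesis using assms by (simp add: AE_finite_all)
qed

context decreasing_drift
begin

text \<open>
  The value 1 outside of \<open>{1..<n}\<close> only serves to make \<open>gap_law n j\<close> a probability measure for all \<open>j\<close>.
\<close>

definition rate :: "nat \<Rightarrow> nat \<Rightarrow> real" where
  "rate n j = (if 1 \<le> j \<and> j < n then real n / beta (real j / real n) else 1)"

lemma rate_pos: "0 < rate n j"
  using beta_pos[of "real j / real n"] by (auto simp: rate_def)

definition gap_law :: "nat \<Rightarrow> nat \<Rightarrow> real measure" where
  "gap_law n j = density lborel (exponential_density (rate n j))"

lemma prob_space_gap_law: "prob_space (gap_law n j)"
  unfolding gap_law_def by (rule prob_space_exponential_density[OF rate_pos])

lemma sets_gap_law [measurable_cong, simp]: "sets (gap_law n j) = sets borel"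
  by (simp add: gap_law_def)

lemma space_gap_law [simp]: "space (gap_law n j) = UNIV"
  by (simp add: gap_law_def)

sublocale gap_prod: product_prob_space "gap_law n" for n
  using prob_space_gap_law by (intro product_prob_spaceI)

definition gaps :: "nat \<Rightarrow> (nat \<Rightarrow> real) measure" where
  "gaps n = Pi\<^sub>M {1..<n} (gap_law n)"

lemma sets_gaps [measurable_cong]: "sets (gaps n) = sets (Leb {1..<n})"
  unfolding gaps_def by (intro sets_PiM_cong) auto

sublocale gaps: prob_space "gaps n" for n
  unfolding gaps_def by (rule prob_space_PiM) (rule prob_space_gap_law)

text \<open>
  A product of densities is a density of the product measure.
\<close>

abbreviation gap_density :: "nat \<Rightarrow> (nat \<Rightarrow> real) \<Rightarrow> ennreal" where
  "gap_density n g \<equiv> \<Prod>j\<in>{1..<n}. ennreal (exponential_density (rate n j) (g j))"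

lemma gaps_density:
  "gaps n = density (Leb {1..<n}) (\<lambda>g. \<Prod>j\<in>{1..<n}. ennreal (exponential_density (rate n j) (g j)))"
  unfolding gaps_def
proof (rule gap_prod.PiM_eqI[symmetric])
  fix A assume A: "\<And>j. j \<in> {1..<n} \<Longrightarrow> A j \<in> sets (gap_law n j)"
  have A': "Pi\<^sub>E {1..<n} A \<in> sets (Leb {1..<n})" using A by (intro sets_PiM_I_finite) auto
  have "emeasure (density (Leb {1..<n}) (\<lambda>g. \<Prod>j\<in>{1..<n}. ennreal (exponential_density (rate n j) (g j)))) (Pi\<^sub>E {1..<n} A)
      = (\<integral>\<^sup>+g. gap_density n g * indicator (Pi\<^sub>E {1..<n} A) g \<partial>Leb {1..<n})"
    by (rule emeasure_density[OF _ A']) measurable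
  also have "\<dots> = (\<integral>\<^sup>+g. (\<Prod>j\<in>{1..<n}. ennreal (exponential_density (rate n j) (g j)) * indicator (A j) (g j)) \<partial>Leb {1..<n})"
  proof (rule nn_integral_cong)
    fix g assume g: "g \<in> space (Leb {1..<n})"
    have "indicator (Pi\<^sub>E {1..<n} A) g = (\<Prod>j\<in>{1..<n}. indicator (A j) (g j) :: ennreal)"
    proof (cases "g \<in> Pi\<^sub>E {1..<n} A")
      case True
      then have "\<forall>j\<in>{1..<n}. indicator (A j) (g j) = (1 :: ennreal)" by (auto simp: PiE_def Pi_iff)
      then show ?thesis using True by (simp only: prod.neutral indicator_simps)
    next
      case False
      then obtain j where "j \<in> {1..<n}" "g j \<notin> A j" using g by (auto simp: space_PiM PiE_def Pi_iff)
      then have "(\<Prod>j\<in>{1..<n}. indicator (A j) (g j) :: ennreal) = 0" by (intro prod_zero bexI[of _ j]) auto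
      then show ?thesis using False by simp
    qed
    then show "gap_density n g * indicator (Pi\<^sub>E {1..<n} A) g
        = (\<Prod>j\<in>{1..<n}. ennreal (exponential_density (rate n j) (g j)) * indicator (A j) (g j))"
      by (simp only: prod.distrib)
  qed
  also have "\<dots> = (\<Prod>j\<in>{1..<n}. \<integral>\<^sup>+t. ennreal (exponential_density (rate n j) t) * indicator (A j) t \<partial>lborel)"
    using A by (intro lborel_prod.product_nn_integral_prod) auto
  also have "\<dots> = (\<Prod>j\<in>{1..<n}. emeasure (gap_law n j) (A j))"
    using A by (intro prod.cong refl) (simp add: gap_law_def emeasure_density)
  finally show "emeasure (density (Leb {1..<n}) (\<lambda>g. \<Prod>j\<in>{1..<n}. ennreal (exponential_density (rate n j) (g j)))) (Pi\<^sub>E {1..<n} A)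
      = (\<Prod>j\<in>{1..<n}. emeasure (gap_law n j) (A j))" .
qed (use sets_gaps[of n] in \<open>simp_all add: gaps_def\<close>)

lemma gap_point_measurable [measurable]: "gap_point n \<in> measurable (gaps n) (Rn n)"
  unfolding gap_point_def[abs_def] by measurable

abbreviation weight :: "nat \<Rightarrow> (nat \<Rightarrow> real) \<Rightarrow> real" where "weight \<equiv> gibbs_weight b \<sigma>"
abbreviation Pn :: "nat \<Rightarrow> (nat \<Rightarrow> real) measure" where "Pn \<equiv> Pn_inf b \<sigma>"

lemma weight_permute: "\<pi> permutes {1..n} \<Longrightarrow> weight n (permute_coords n \<pi> z) = weight n z"
  by (simp add: gibbs_weight_def order_stat_permute del: One_nat_def)

lemma weight_measurable [measurable]: "weight n \<in> borel_measurable (Rn n)"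
  unfolding gibbs_weight_def[abs_def]
  by (intro borel_measurable_exp[THEN measurable_compose_rev] borel_measurable_times borel_measurable_sum
      order_stat_measurable borel_measurable_const)

lemma b_coeff_sum: "(\<Sum>k\<in>{1..j}. b_coeff b n k) = real n * B (real j / real n)"
proof -
  have "(\<Sum>k\<in>{1..j}. b_coeff b n k) = real n * (\<Sum>k\<in>{1..j}. B (real k / real n) - B (real (k - 1) / real n))"
    unfolding b_coeff_def sum_distrib_left by (intro sum.cong refl) (auto simp: of_nat_diff)
  also have "(\<Sum>k\<in>{1..j}. B (real k / real n) - B (real (k - 1) / real n)) = B (real j / real n)"
    by (induction j) auto
  finally show ?thesis .
qed

text \<open>
  Summation by parts: the partial sums of \<open>b_coeff\<close> telescope to \<open>n * B (j / n)\<close>, and the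
  full sum vanishes because \<open>B 1 = 0\<close>.
\<close>

lemma weight_gap_point:
  assumes n: "1 \<le> n" and g: "\<And>j. j \<in> {1..<n} \<Longrightarrow> 0 \<le> g j"
  shows "weight n (gap_point n g) = (\<Prod>j\<in>{1..<n}. exp (- (rate n j * g j)))"
proof -
  have "gap_point n g \<in> ordered_points n"
    using g from_gaps_diff[of _ n g] by (force simp: ordered_points_def gap_point_def)
  then have os: "order_stat n (gap_point n g) k = from_gaps n g k" if "k \<in> {1..n}" for k
    using that by (simp add: order_stat_ordered gap_point_def del: One_nat_def)
  have "(\<Sum>k\<in>{1..n}. b_coeff b n k * order_stat n (gap_point n g) k)
      = (\<Sum>k\<in>{1..n}. \<Sum>j\<in>{1..<n}. b_coeff b n k * ((real j / real n - (if k \<le> j then 1 else 0)) * g j))"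
    using os by (intro sum.cong refl) (simp add: from_gaps_def sum_distrib_left del: One_nat_def)
  also have "\<dots> = (\<Sum>j\<in>{1..<n}. (\<Sum>k\<in>{1..n}. b_coeff b n k * (real j / real n - (if k \<le> j then 1 else 0))) * g j)"
    by (subst sum.swap) (simp add: sum_distrib_right mult.assoc)
  also have "\<dots> = (\<Sum>j\<in>{1..<n}. - (real n * B (real j / real n)) * g j)"
  proof (intro sum.cong refl)
    fix j assume j: "j \<in> {1..<n}"
    have "(\<Sum>k\<in>{1..n}. b_coeff b n k * (real j / real n - (if k \<le> j then 1 else 0)))
        = (\<Sum>k\<in>{1..n}. b_coeff b n k * (real j / real n)) - (\<Sum>k\<in>{1..n}. if k \<in> {1..j} then b_coeff b n k else 0)"
      unfolding sum_subtractf[symmetric] by (intro sum.cong refl) (auto simp: algebra_simps)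
    also have "(\<Sum>k\<in>{1..n}. if k \<in> {1..j} then b_coeff b n k else 0) = (\<Sum>k\<in>{1..n} \<inter> {1..j}. b_coeff b n k)"
      by (rule sum.inter_restrict[symmetric]) simp
    also have "{1..n} \<inter> {1..j} = {1..j}" using j by auto
    also have "(\<Sum>k\<in>{1..n}. b_coeff b n k * (real j / real n)) = 0"
      using n unfolding sum_distrib_right[symmetric] b_coeff_sum by (simp add: B_one)
    finally show "(\<Sum>k\<in>{1..n}. b_coeff b n k * (real j / real n - (if k \<le> j then 1 else 0))) * g j
        = - (real n * B (real j / real n)) * g j" by (simp add: b_coeff_sum del: One_nat_def)
  qed
  finally have sum: "(\<Sum>k\<in>{1..n}. b_coeff b n k * order_stat n (gap_point n g) k)
      = (\<Sum>j\<in>{1..<n}. - (real n * B (real j / real n)) * g j)" .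
  have "2 / \<sigma>\<^sup>2 * (\<Sum>j\<in>{1..<n}. - (real n * B (real j / real n)) * g j) = (\<Sum>j\<in>{1..<n}. - (rate n j * g j))"
    unfolding sum_distrib_left by (intro sum.cong refl) (simp add: rate_def beta_def)
  then show ?thesis unfolding gibbs_weight_def sum by (simp add: exp_sum del: One_nat_def)
qed

text \<open>
  On the ordered chamber, in gap coordinates, the Gibbs weight is a constant times the density of
  independent exponential variables. The other points contribute copies of this chamber, and the
  gaps that vanish form a null set.
\<close>

lemma nn_integral_symmetric_weight:
  assumes n: "1 \<le> n"
  shows "\<exists>K>0. \<forall>f. f \<in> borel_measurable (Rn n) \<longrightarrow>
    (\<forall>\<pi> z. \<pi> permutes {1..n} \<longrightarrow> z \<in> space (Rn n) \<longrightarrow> f (permute_coords n \<pi> z) = f z) \<longrightarrow>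
    (\<integral>\<^sup>+z. f z * ennreal (weight n z) \<partial>zero_sum_measure n) = ennreal K * (\<integral>\<^sup>+g. f (gap_point n g) \<partial>gaps n)"
proof -
  obtain c where c: "c > 0" "\<And>f. f \<in> borel_measurable (Rn n) \<Longrightarrow>
    (\<integral>\<^sup>+z. f z \<partial>zero_sum_measure n) = ennreal c * (\<integral>\<^sup>+g. f (gap_point n g) \<partial>Leb {1..<n})"
    using nn_integral_zero_sum_gaps[OF n] by blast
  define r where "r = (\<Prod>j\<in>{1..<n}. 1 / rate n j)"
  have r: "0 < r" unfolding r_def using rate_pos by (intro prod_pos) simp
  have gp [measurable]: "gap_point n \<in> measurable (Leb {1..<n}) (Rn n)"
    using gap_point_measurable[of n] by (simp cong: measurable_cong_sets add: measurable_cong_sets[OF sets_gaps refl])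
  have "(\<integral>\<^sup>+z. f z * ennreal (weight n z) \<partial>zero_sum_measure n) = ennreal (fact n * c * r) * (\<integral>\<^sup>+g. f (gap_point n g) \<partial>gaps n)"
    if f [measurable]: "f \<in> borel_measurable (Rn n)"
      and sym: "\<And>\<pi> z. \<pi> permutes {1..n} \<Longrightarrow> z \<in> space (Rn n) \<Longrightarrow> f (permute_coords n \<pi> z) = f z" for f
  proof -
    define h where "h z = f z * ennreal (weight n z) * ennreal (of_bool (z \<in> ordered_points n) / num_orderings n z)" for z
    have h [measurable]: "h \<in> borel_measurable (Rn n)" unfolding h_def[abs_def] of_bool_def by measurable
    have h_gap: "h (gap_point n g) = ennreal r * (gap_density n g * f (gap_point n g))"
      if g: "\<forall>j\<in>{1..<n}. g j \<noteq> 0" for g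
    proof (cases "\<forall>j\<in>{1..<n}. 0 < g j")
      case True
      have less: "gap_point n g k < gap_point n g (Suc k)" if "k \<in> {1..<n}" for k
        using from_gaps_diff[of k n g] True that by (force simp: gap_point_def)
      have "gap_point n g \<in> space (Rn n)" by (auto simp: gap_point_def space_PiM)
      then have "num_orderings n (gap_point n g) = 1" using less by (rule num_orderings_strict)
      moreover have "gap_point n g \<in> ordered_points n" using less by (auto simp: ordered_points_def less_imp_le)
      moreover have "weight n (gap_point n g) = r * (\<Prod>j\<in>{1..<n}. exponential_density (rate n j) (g j))"
      proof -
        have "weight n (gap_point n g) = (\<Prod>j\<in>{1..<n}. exp (- (rate n j * g j)))"
          using True by (intro weight_gap_point n) (auto simp: less_imp_le)
        also have "\<dots> = (\<Prod>j\<in>{1..<n}. 1 / rate n j * exponential_density (rate n j) (g j))"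
        proof (intro prod.cong refl)
          fix j assume "j \<in> {1..<n}"
          then have "0 < g j" using True by blast
          then show "exp (- (rate n j * g j)) = 1 / rate n j * exponential_density (rate n j) (g j)"
            using rate_pos[of n j] by (simp add: exponential_density_def mult.commute)
        qed
        finally show ?thesis unfolding r_def prod.distrib .
      qed
      moreover have "ennreal (r * (\<Prod>j\<in>{1..<n}. exponential_density (rate n j) (g j)))
          = ennreal r * gap_density n g"
        using r rate_pos by (subst ennreal_mult) (auto simp: prod_ennreal less_imp_le intro!: prod_nonneg)
      ultimately show ?thesis by (simp add: h_def mult_ac del: One_nat_def)
    next
      case False
      then obtain j where j: "j \<in> {1..<n}" "g j < 0" using g by force
      then have "gap_point n g (Suc j) < gap_point n g j"
        using from_gaps_diff[of j n g] by (auto simp: gap_point_def)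
      then have "gap_point n g \<notin> ordered_points n" using j by (force simp: ordered_points_def)
      moreover have "gap_density n g = 0"
        using j by (intro prod_zero bexI[of _ j]) (auto simp: exponential_density_def)
      ultimately show ?thesis by (simp add: h_def del: One_nat_def)
    qed
    have "(\<integral>\<^sup>+z. f z * ennreal (weight n z) \<partial>zero_sum_measure n) = of_nat (fact n) * (\<integral>\<^sup>+z. h z \<partial>zero_sum_measure n)"
      unfolding h_def
      by (rule nn_integral_symmetric_zero_sum[OF n]) (measurable, simp add: sym weight_permute del: One_nat_def)
    also have "(\<integral>\<^sup>+z. h z \<partial>zero_sum_measure n) = ennreal c * (\<integral>\<^sup>+g. h (gap_point n g) \<partial>Leb {1..<n})"
      by (rule c(2)[OF h])
    also have "(\<integral>\<^sup>+g. h (gap_point n g) \<partial>Leb {1..<n})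
        = (\<integral>\<^sup>+g. ennreal r * (gap_density n g * f (gap_point n g)) \<partial>Leb {1..<n})"
      using AE_coords_nonzero[of "{1..<n}"] by (intro nn_integral_cong_AE) (auto elim!: AE_mp simp: h_gap simp del: One_nat_def)
    also have "\<dots> = ennreal r * (\<integral>\<^sup>+g. gap_density n g * f (gap_point n g) \<partial>Leb {1..<n})"
      by (rule nn_integral_cmult) measurable
    also have "(\<integral>\<^sup>+g. gap_density n g * f (gap_point n g) \<partial>Leb {1..<n})
        = (\<integral>\<^sup>+g. f (gap_point n g) \<partial>gaps n)"
      unfolding gaps_density by (rule nn_integral_density[symmetric]) measurable
    also have "of_nat (fact n) * (ennreal c * (ennreal r * z)) = ennreal (fact n * c * r) * z" for z
      using c(1) r by (simp add: ennreal_mult mult.assoc ennreal_of_nat_eq_real_of_nat)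
    finally show ?thesis .
  qed
  then show ?thesis using c(1) r by (intro exI[of _ "fact n * c * r"]) (auto simp del: One_nat_def)
qed

end

(* keeps the simplifier from rewriting the index sets {1..n} and {1..<n} to start at Suc 0 *)
declare One_nat_def [simp del]

context decreasing_drift
begin

lemma space_zero_sum [simp]: "space (zero_sum_measure n) = space (Rn n)"
  by (simp add: zero_sum_measure_def space_scale_measure)

lemma sets_zero_sum [simp, measurable_cong]: "sets (zero_sum_measure n) = sets (Rn n)"
  by (simp add: zero_sum_measure_def)

lemma sets_Pn [simp, measurable_cong]: "sets (Pn n) = sets (Rn n)"
  by (simp add: Pn_inf_def)

lemma space_Pn [simp]: "space (Pn n) = space (Rn n)"
  by (simp add: Pn_inf_def)

lemma nn_integral_Pn:
  assumes [measurable]: "f \<in> borel_measurable (Rn n)"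
  shows "(\<integral>\<^sup>+z. f z \<partial>Pn n) = 1 / partition_fun b \<sigma> n * (\<integral>\<^sup>+z. f z * ennreal (weight n z) \<partial>zero_sum_measure n)"
proof -
  have "(\<integral>\<^sup>+z. f z \<partial>Pn n)
      = (\<integral>\<^sup>+z. 1 / partition_fun b \<sigma> n * ennreal (weight n z) * f z \<partial>zero_sum_measure n)"
    unfolding Pn_inf_def by (rule nn_integral_density) measurable
  also have "\<dots> = (\<integral>\<^sup>+z. 1 / partition_fun b \<sigma> n * (f z * ennreal (weight n z)) \<partial>zero_sum_measure n)"
    by (simp only: mult_ac)
  also have "\<dots> = 1 / partition_fun b \<sigma> n * (\<integral>\<^sup>+z. f z * ennreal (weight n z) \<partial>zero_sum_measure n)"
    by (rule nn_integral_cmult) measurable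
  finally show ?thesis .
qed

text \<open>
  Taking the constant function 1 identifies the unknown constant of \<open>nn_integral_symmetric_weight\<close>
  with the partition function, which is therefore positive and finite.
\<close>

lemma nn_integral_Pn_symmetric:
  assumes n: "1 \<le> n" and f: "f \<in> borel_measurable (Rn n)"
    and sym: "\<And>\<pi> z. \<pi> permutes {1..n} \<Longrightarrow> z \<in> space (Rn n) \<Longrightarrow> f (permute_coords n \<pi> z) = f z"
  shows "(\<integral>\<^sup>+z. f z \<partial>Pn n) = (\<integral>\<^sup>+g. f (gap_point n g) \<partial>gaps n)"
proof -
  obtain K where K: "K > 0" "\<forall>f. f \<in> borel_measurable (Rn n) \<longrightarrow>
    (\<forall>\<pi> z. \<pi> permutes {1..n} \<longrightarrow> z \<in> space (Rn n) \<longrightarrow> f (permute_coords n \<pi> z) = f z) \<longrightarrow>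
    (\<integral>\<^sup>+z. f z * ennreal (weight n z) \<partial>zero_sum_measure n) = ennreal K * (\<integral>\<^sup>+g. f (gap_point n g) \<partial>gaps n)"
    using nn_integral_symmetric_weight[OF n] by blast
  have "(\<integral>\<^sup>+z. 1 * ennreal (weight n z) \<partial>zero_sum_measure n) = ennreal K * (\<integral>\<^sup>+g. 1 \<partial>gaps n)"
    using K(2)[rule_format, of "\<lambda>_. 1"] by (simp del: One_nat_def)
  then have "partition_fun b \<sigma> n = ennreal K"
    by (simp add: partition_fun_def gaps.emeasure_space_1)
  moreover have "1 / ennreal K * (ennreal K * x) = x" for x
  proof -
    have "1 / ennreal K * ennreal K = 1"
      using K(1) divide_ennreal[of 1 K] ennreal_mult[of "1 / K" K] by simp
    then show ?thesis by (simp only: mult.assoc[symmetric] mult_1_left)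
  qed
  ultimately show ?thesis
    using K(2)[rule_format, of f] f sym by (simp add: nn_integral_Pn[OF f] del: One_nat_def)
qed

lemma prob_space_Pn: assumes n: "1 \<le> n" shows "prob_space (Pn n)"
proof
  show "emeasure (Pn n) (space (Pn n)) = 1"
    using nn_integral_Pn_symmetric[OF n, of "\<lambda>_. 1"] by (simp add: gaps.emeasure_space_1)
qed

lemma nn_integral_Pn_permute:
  assumes n: "1 \<le> n" and f [measurable]: "f \<in> borel_measurable (Rn n)" and \<pi>: "\<pi> permutes {1..n}"
  shows "(\<integral>\<^sup>+z. f (permute_coords n \<pi> z) \<partial>Pn n) = (\<integral>\<^sup>+z. f z \<partial>Pn n)"
proof -
  note permute_coords_measurable[OF \<pi>, measurable]
  have "(\<integral>\<^sup>+z. f (permute_coords n \<pi> z) * ennreal (weight n z) \<partial>zero_sum_measure n)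
      = (\<integral>\<^sup>+z. f (permute_coords n \<pi> z) * ennreal (weight n (permute_coords n \<pi> z)) \<partial>zero_sum_measure n)"
    using \<pi> by (simp add: weight_permute del: One_nat_def)
  also have "\<dots> = (\<integral>\<^sup>+z. f z * ennreal (weight n z) \<partial>zero_sum_measure n)"
    by (rule zero_sum_permute[OF \<pi> n]) measurable
  finally have "1 / partition_fun b \<sigma> n * (\<integral>\<^sup>+z. f (permute_coords n \<pi> z) * ennreal (weight n z) \<partial>zero_sum_measure n)
      = 1 / partition_fun b \<sigma> n * (\<integral>\<^sup>+z. f z * ennreal (weight n z) \<partial>zero_sum_measure n)"
    by simp
  then show ?thesis
    using nn_integral_Pn[OF f] nn_integral_Pn[of "\<lambda>z. f (permute_coords n \<pi> z)"] by simp
qed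

lemma symmetric_distribution_Pn:
  assumes n: "1 \<le> n"
  shows "symmetric_distribution n (Pn n)"
  unfolding symmetric_distribution_def distribution_on_def
proof (intro conjI allI impI)
  show "prob_space (Pn n)" by (rule prob_space_Pn[OF n])
  show "sets (Pn n) = sets (Rn n)" by simp
  fix \<pi> assume \<pi>: "\<pi> permutes {1..n}"
  note permute_coords_measurable[OF \<pi>, measurable]
  have "distr (Pn n) (Rn n) (permute_coords n \<pi>) = Pn n"
  proof (rule measure_eqI)
    fix A assume "A \<in> sets (distr (Pn n) (Rn n) (permute_coords n \<pi>))"
    then have A [measurable]: "A \<in> sets (Rn n)" by simp
    have "emeasure (distr (Pn n) (Rn n) (permute_coords n \<pi>)) A = (\<integral>\<^sup>+z. indicator A z \<partial>distr (Pn n) (Rn n) (permute_coords n \<pi>))"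
      by simp
    also have "\<dots> = (\<integral>\<^sup>+z. indicator A (permute_coords n \<pi> z) \<partial>Pn n)"
      by (rule nn_integral_distr) measurable
    also have "\<dots> = (\<integral>\<^sup>+z. indicator A z \<partial>Pn n)"
      by (rule nn_integral_Pn_permute[OF n _ \<pi>]) measurable
    finally show "emeasure (distr (Pn n) (Rn n) (permute_coords n \<pi>)) A = emeasure (Pn n) A" by simp
  qed simp
  then show "distr (Pn n) (Rn n) (\<lambda>x. \<lambda>i\<in>{1..n}. x (\<pi> i)) = Pn n"
    by (simp only: permute_coords_def[abs_def])
qed

section \<open>Coupling the particles with an independent sample through ranks\<close>

definition sample_rank :: "nat \<Rightarrow> (nat \<Rightarrow> real) \<Rightarrow> nat \<Rightarrow> nat" where
  "sample_rank n x i = card {j \<in> {1..n}. x j \<le> x i}"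

definition samples :: "nat \<Rightarrow> (nat \<Rightarrow> real) measure" where
  "samples n = Pi\<^sub>M {1..n} (\<lambda>_. P)"

sublocale sample_prod: product_prob_space "\<lambda>_::nat. P"
  using P.prob_space_axioms by (intro product_prob_spaceI)

sublocale samples: prob_space "samples n" for n
  unfolding samples_def by (rule prob_space_PiM) (rule P.prob_space_axioms)

lemma sets_samples [measurable_cong, simp]: "sets (samples n) = sets (Rn n)"
  unfolding samples_def by (intro sets_PiM_cong) auto

lemma space_samples [simp]: "space (samples n) = space (Rn n)"
  by (rule sets_eq_imp_space_eq) simp

lemma samples_component [measurable]: "i \<in> {1..n} \<Longrightarrow> (\<lambda>x. x i) \<in> borel_measurable (samples n)"
  using measurable_component_singleton[of i "{1..n}" "\<lambda>_. borel :: real measure"] by (simp cong: measurable_cong_sets add: measurable_cong_sets[OF sets_samples refl] del: One_nat_def)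

definition joint :: "nat \<Rightarrow> ((nat \<Rightarrow> real) \<times> (nat \<Rightarrow> real)) measure" where
  "joint n = gaps n \<Otimes>\<^sub>M samples n"

sublocale joint: prob_space "joint n" for n
  unfolding joint_def by (rule prob_space_pair) (rule gaps.prob_space_axioms samples.prob_space_axioms)+

lemma distr_joint_fst: "distr (joint n) (gaps n) fst = gaps n"
  unfolding joint_def by (rule samples.distr_pair_fst)

lemma distr_joint_snd: "distr (joint n) (samples n) snd = samples n"
proof (rule measure_eqI)
  fix A assume "A \<in> sets (distr (joint n) (samples n) snd)"
  then have A: "A \<in> sets (samples n)" by simp
  then have "snd -` A \<inter> space (joint n) = space (gaps n) \<times> A"
    using sets.sets_into_space[OF A] by (auto simp: joint_def space_pair_measure)
  then show "emeasure (distr (joint n) (samples n) snd) A = emeasure (samples n) A"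
    using A by (simp add: emeasure_distr joint_def samples.emeasure_pair_measure_Times gaps.emeasure_space_1)
qed simp

definition particles :: "nat \<Rightarrow> (nat \<Rightarrow> real) \<times> (nat \<Rightarrow> real) \<Rightarrow> nat \<Rightarrow> real" where
  "particles n = (\<lambda>(g, x). \<lambda>i\<in>{1..n}. from_gaps n g (sample_rank n x i))"

lemma sample_rank_le: "sample_rank n x i \<le> n"
proof -
  have "sample_rank n x i \<le> card {1..n}" unfolding sample_rank_def by (rule card_mono) auto
  then show ?thesis by simp
qed

lemma sample_rank_permute:
  assumes \<pi>: "\<pi> permutes {1..n}" and i: "i \<in> {1..n}"
  shows "sample_rank n (permute_coords n \<pi> x) i = sample_rank n x (\<pi> i)"
proof -
  have \<pi>i: "\<pi> j \<in> {1..n}" if "j \<in> {1..n}" for j using permutes_in_image[OF \<pi>] that by blast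
  have "{j \<in> {1..n}. x j \<le> x (\<pi> i)} = \<pi> ` {j \<in> {1..n}. permute_coords n \<pi> x j \<le> permute_coords n \<pi> x i}"
  proof (intro equalityI subsetI)
    fix j assume j: "j \<in> {j \<in> {1..n}. x j \<le> x (\<pi> i)}"
    then have "j \<in> \<pi> ` {1..n}" using permutes_image[OF \<pi>] by blast
    then obtain k where "k \<in> {1..n}" "j = \<pi> k" by blast
    then show "j \<in> \<pi> ` {j \<in> {1..n}. permute_coords n \<pi> x j \<le> permute_coords n \<pi> x i}"
      using j i by (intro image_eqI[of _ _ k]) (simp_all add: permute_coords_def)
  next
    fix j assume "j \<in> \<pi> ` {j \<in> {1..n}. permute_coords n \<pi> x j \<le> permute_coords n \<pi> x i}"
    then obtain k where "k \<in> {1..n}" "j = \<pi> k" "permute_coords n \<pi> x k \<le> permute_coords n \<pi> x i" by blast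
    then show "j \<in> {j \<in> {1..n}. x j \<le> x (\<pi> i)}" using i \<pi>i[of k] by (simp add: permute_coords_def)
  qed
  then show ?thesis unfolding sample_rank_def
    by (simp add: card_image permutes_inj_on[OF \<pi>])
qed

lemma particles_permute:
  assumes \<pi>: "\<pi> permutes {1..n}"
  shows "permute_coords n \<pi> (particles n (g, x)) = particles n (g, permute_coords n \<pi> x)"
proof
  fix i
  have \<pi>i: "\<pi> i \<in> {1..n}" if "i \<in> {1..n}" using permutes_in_image[OF \<pi>] that by blast
  show "permute_coords n \<pi> (particles n (g, x)) i = particles n (g, permute_coords n \<pi> x) i"
    using \<pi>i sample_rank_permute[OF \<pi>, of i x] by (simp add: particles_def permute_coords_def[of n \<pi> "restrict _ _"])
qed

lemma sample_rank_bij: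
  assumes inj: "inj_on x {1..n}"
  shows "bij_betw (sample_rank n x) {1..n} {1..n}"
proof -
  have "sample_rank n x i < sample_rank n x j" if "i \<in> {1..n}" "j \<in> {1..n}" "x i < x j" for i j
    unfolding sample_rank_def
  proof (rule psubset_card_mono)
    have "j \<in> {k \<in> {1..n}. x k \<le> x j}" "j \<notin> {k \<in> {1..n}. x k \<le> x i}" using that by auto
    moreover have "{k \<in> {1..n}. x k \<le> x i} \<subseteq> {k \<in> {1..n}. x k \<le> x j}" using that by auto
    ultimately show "{k \<in> {1..n}. x k \<le> x i} \<subset> {k \<in> {1..n}. x k \<le> x j}" by blast
  qed simp
  then have "inj_on (sample_rank n x) {1..n}"
    using inj by (intro inj_onI) (metis inj_onD linorder_cases less_irrefl)
  moreover have "sample_rank n x ` {1..n} \<subseteq> {1..n}"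
  proof
    fix r assume "r \<in> sample_rank n x ` {1..n}"
    then obtain i where i: "i \<in> {1..n}" "r = sample_rank n x i" by blast
    then have "sample_rank n x i \<noteq> 0" unfolding sample_rank_def by (subst card_0_eq) auto
    then show "r \<in> {1..n}" using i sample_rank_le[of n x i] by simp
  qed
  ultimately show ?thesis
    by (simp add: bij_betw_def endo_inj_surj)
qed

text \<open>
  The limit law has no atoms because its distribution function is continuous.
\<close>

lemma samples_distinct: "AE x in samples n. inj_on x {1..n}"
proof -
  have ne: "AE x in samples n. x i \<noteq> x j" if ij: "i \<in> {1..n}" "j \<in> {1..n}" "i \<noteq> j" for i j
  proof -
    (* Fubini with coordinate j innermost: given x i, the event has probability P {x i} = 0 *)
    define J where "J = {1..n} - {j}"
    have J: "finite J" "j \<notin> J" "i \<in> J" "insert j J = {1..n}" using ij by (auto simp: J_def)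
    have meas: "(\<lambda>x. indicator {0} (x i - x j) :: ennreal) \<in> borel_measurable (samples n)"
      using ij by measurable
    have meas': "(\<lambda>x. indicator {0} (x i - x j) :: ennreal) \<in> borel_measurable (Pi\<^sub>M (insert j J) (\<lambda>_. P))"
      using meas unfolding J(4) samples_def .
    have "(\<integral>\<^sup>+x. indicator {0} (x i - x j) \<partial>samples n)
        = (\<integral>\<^sup>+x. \<integral>\<^sup>+t. indicator {0} ((x(j := t)) i - (x(j := t)) j) \<partial>P \<partial>Pi\<^sub>M J (\<lambda>_. P))"
      using sample_prod.product_nn_integral_insert[OF J(1,2) meas'] unfolding J(4) samples_def .
    also have "\<dots> = (\<integral>\<^sup>+x. 0 \<partial>Pi\<^sub>M J (\<lambda>_. P))"
    proof (rule nn_integral_cong)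
      fix x :: "nat \<Rightarrow> real"
      have "(\<integral>\<^sup>+t. indicator {0} ((x(j := t)) i - (x(j := t)) j) \<partial>P) = (\<integral>\<^sup>+t. indicator {x i} t \<partial>P)"
        using ij by (intro nn_integral_cong) (auto simp: indicator_def)
      also have "\<dots> = 0" by (simp add: P.emeasure_eq_measure measure_P_singleton)
      finally show "(\<integral>\<^sup>+t. indicator {0} ((x(j := t)) i - (x(j := t)) j) \<partial>P) = (0::ennreal)" .
    qed
    finally have "(\<integral>\<^sup>+x. indicator {0} (x i - x j) \<partial>samples n) = 0" by simp
    then have "AE x in samples n. indicator {0} (x i - x j) = (0::ennreal)"
      by (rule nn_integral_0_iff_AE[OF meas, THEN iffD1])
    then show ?thesis by (rule AE_mp) (auto simp: indicator_def)
  qed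
  have "AE x in samples n. \<forall>i\<in>{1..n}. \<forall>j\<in>{1..n}. i \<noteq> j \<longrightarrow> x i \<noteq> x j"
    using ne by (intro AE_finite_allI AE_impI) auto
  then show ?thesis by (rule AE_mp) (auto simp: inj_on_def)
qed

lemma sample_rank_eq_sum: "real (sample_rank n x i) = (\<Sum>j\<in>{1..n}. of_bool (x j \<le> x i))"
proof -
  have "sample_rank n x i = card ({1..n} \<inter> {j. x j \<le> x i})" unfolding sample_rank_def by (rule arg_cong[where f=card]) auto
  then show ?thesis by (simp add: of_bool_def sum.If_cases)
qed

lemma from_gaps_random_rank_measurable:
  assumes [measurable]: "(\<lambda>\<omega>. real (N \<omega>)) \<in> borel_measurable (joint n)"
  shows "(\<lambda>\<omega>. from_gaps n (fst \<omega>) (N \<omega>)) \<in> borel_measurable (joint n)"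
proof -
  have eq: "(\<lambda>\<omega>. from_gaps n (fst \<omega>) (N \<omega>))
      = (\<lambda>\<omega>. \<Sum>j\<in>{1..<n}. (real j / real n - (if real (N \<omega>) \<le> real j then 1 else 0)) * fst \<omega> j)"
    by (auto simp: from_gaps_def fun_eq_iff)
  have [measurable]: "(\<lambda>\<omega>. fst \<omega> j) \<in> borel_measurable (joint n)" if "j \<in> {1..<n}" for j
  proof -
    have "(\<lambda>g. g j) \<in> borel_measurable (gaps n)"
      using measurable_component_singleton[OF that, of "gap_law n"] by (simp add: gaps_def cong: measurable_cong_sets)
    then show ?thesis unfolding joint_def by (rule measurable_compose[OF measurable_fst])
  qed
  show ?thesis unfolding eq by measurable
qed

lemma particles_measurable [measurable]: "particles n \<in> measurable (joint n) (Rn n)"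
proof -
  have "(\<lambda>\<omega>. from_gaps n (fst \<omega>) (sample_rank n (snd \<omega>) i)) \<in> borel_measurable (joint n)" if i: "i \<in> {1..n}" for i
  proof (rule from_gaps_random_rank_measurable)
    have "(\<lambda>x. real (sample_rank n x i)) \<in> borel_measurable (samples n)"
      unfolding sample_rank_eq_sum of_bool_def using i by measurable
    then show "(\<lambda>\<omega>. real (sample_rank n (snd \<omega>) i)) \<in> borel_measurable (joint n)"
      unfolding joint_def by (rule measurable_compose[OF measurable_snd])
  qed
  then have "(\<lambda>\<omega>. \<lambda>i\<in>{1..n}. from_gaps n (fst \<omega>) (sample_rank n (snd \<omega>) i)) \<in> measurable (joint n) (Rn n)"
    by (intro measurable_restrict)
  then show ?thesis by (simp add: particles_def split_beta')
qed

lemma samples_permute: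
  assumes \<pi>: "\<pi> permutes {1..n}"
  shows "distr (samples n) (samples n) (permute_coords n \<pi>) = samples n"
  using distr_PiM_reindex[of "{1..n}" "\<lambda>_. P" \<pi> "{1..n}"] P.prob_space_axioms permutes_inj_on[OF \<pi>] permutes_in_image[OF \<pi>]
  by (auto simp: samples_def permute_coords_def[abs_def] simp del: One_nat_def)

text \<open>
  Summing a test function over all permutations of the coordinates gives a symmetric function \<open>S\<close>, and
  since both laws are permutation invariant it suffices to integrate \<open>S\<close>. Almost surely the ranks form
  a permutation, so \<open>S\<close> takes the same value at the particles and at the ordered point built from the
  gaps, whose law is known from \<open>nn_integral_Pn_symmetric\<close>.
\<close>

theorem law_of_particles:
  assumes n: "1 \<le> n"
  shows "distr (joint n) (Rn n) (particles n) = Pn n"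
proof (rule measure_eqI)
  fix A assume "A \<in> sets (distr (joint n) (Rn n) (particles n))"
  then have A [measurable]: "A \<in> sets (Rn n)" by simp
  define f :: "(nat \<Rightarrow> real) \<Rightarrow> ennreal" where "f = indicator A"
  have f [measurable]: "f \<in> borel_measurable (Rn n)" by (simp add: f_def)
  define Perms where "Perms = {\<pi>. \<pi> permutes {1..n}}"
  have fin: "finite Perms" "card Perms = fact n" by (simp_all add: Perms_def card_permutations finite_permutations del: One_nat_def)
  define S where "S z = (\<Sum>\<pi>\<in>Perms. f (permute_coords n \<pi> z))" for z
  have f_perm [measurable]: "(\<lambda>z. f (permute_coords n \<pi> z)) \<in> borel_measurable (Rn n)" if "\<pi> \<in> Perms" for \<pi>
    using that measurable_compose[OF permute_coords_measurable f] by (simp add: Perms_def del: One_nat_def)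
  have S [measurable]: "S \<in> borel_measurable (Rn n)"
    unfolding S_def[abs_def] by (intro borel_measurable_sum f_perm)
  have S_sym: "S (permute_coords n \<tau> z) = S z" if \<tau>: "\<tau> permutes {1..n}" for \<tau> z
  proof -
    have "S (permute_coords n \<tau> z) = (\<Sum>\<pi>\<in>Perms. f (permute_coords n (\<tau> \<circ> \<pi>) z))"
      unfolding S_def by (intro sum.cong refl) (simp add: permute_coords_comp Perms_def del: One_nat_def)
    also have "\<dots> = S z"
      unfolding S_def Perms_def
      using setum_permutations_compose_left[OF \<tau>, of "\<lambda>\<pi>. f (permute_coords n \<pi> z)"] by simp
    finally show ?thesis .
  qed
  have "of_nat (fact n) * (\<integral>\<^sup>+z. f z \<partial>Pn n) = (\<Sum>\<pi>\<in>Perms. \<integral>\<^sup>+z. f (permute_coords n \<pi> z) \<partial>Pn n)"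
    using nn_integral_Pn_permute[OF n f] fin by (simp add: Perms_def del: One_nat_def)
  also have "\<dots> = (\<integral>\<^sup>+z. S z \<partial>Pn n)"
    unfolding S_def by (rule nn_integral_sum[symmetric]) (use f_perm in \<open>simp cong: measurable_cong_sets add: measurable_cong_sets[OF sets_Pn refl] del: One_nat_def\<close>)
  also have "\<dots> = (\<integral>\<^sup>+g. S (gap_point n g) \<partial>gaps n)"
    by (rule nn_integral_Pn_symmetric[OF n S]) (simp add: S_sym del: One_nat_def)
  also have "\<dots> = (\<integral>\<^sup>+\<omega>. S (gap_point n (fst \<omega>)) \<partial>joint n)"
  proof -
    have "(\<integral>\<^sup>+g. S (gap_point n g) \<partial>gaps n) = (\<integral>\<^sup>+g. S (gap_point n g) \<partial>distr (joint n) (gaps n) fst)"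
      by (simp only: distr_joint_fst)
    also have "\<dots> = (\<integral>\<^sup>+\<omega>. S (gap_point n (fst \<omega>)) \<partial>joint n)"
      by (rule nn_integral_distr) (simp_all add: joint_def)
    finally show ?thesis .
  qed
  also have "\<dots> = (\<integral>\<^sup>+\<omega>. S (particles n \<omega>) \<partial>joint n)"
  proof (rule nn_integral_cong_AE)
    have "AE \<omega> in joint n. inj_on (snd \<omega>) {1..n}"
    proof (rule AE_distrD[where f=snd and M'="samples n" and P="\<lambda>x. inj_on x {1..n}"])
      show "AE x in distr (joint n) (samples n) snd. inj_on x {1..n}"
        unfolding distr_joint_snd by (rule samples_distinct)
    qed (simp add: joint_def)
    then show "AE \<omega> in joint n. S (gap_point n (fst \<omega>)) = S (particles n \<omega>)"
    proof (rule AE_mp, intro AE_I2 impI)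
      fix \<omega> :: "(nat \<Rightarrow> real) \<times> (nat \<Rightarrow> real)"
      assume inj: "inj_on (snd \<omega>) {1..n}"
      define \<rho> where "\<rho> i = (if i \<in> {1..n} then sample_rank n (snd \<omega>) i else i)" for i
      have "bij_betw \<rho> {1..n} {1..n}"
        by (rule bij_betw_cong[THEN iffD1, OF _ sample_rank_bij[OF inj]]) (simp add: \<rho>_def)
      then have \<rho>: "\<rho> permutes {1..n}" by (rule bij_imp_permutes) (auto simp: \<rho>_def)
      have "particles n \<omega> = permute_coords n \<rho> (gap_point n (fst \<omega>))"
        using permutes_in_image[OF \<rho>] by (auto simp: particles_def permute_coords_def gap_point_def \<rho>_def fun_eq_iff split_beta)
      then show "S (gap_point n (fst \<omega>)) = S (particles n \<omega>)" by (simp add: S_sym[OF \<rho>] del: One_nat_def)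
    qed
  qed
  also have "\<dots> = (\<Sum>\<pi>\<in>Perms. \<integral>\<^sup>+\<omega>. f (permute_coords n \<pi> (particles n \<omega>)) \<partial>joint n)"
    unfolding S_def by (rule nn_integral_sum) (rule measurable_compose[OF particles_measurable f_perm])
  also have "\<dots> = (\<Sum>\<pi>\<in>Perms. \<integral>\<^sup>+\<omega>. f (particles n \<omega>) \<partial>joint n)"
  proof (rule sum.cong[OF refl])
    fix \<pi> assume "\<pi> \<in> Perms"
    then have \<pi>: "\<pi> permutes {1..n}" by (simp add: Perms_def)
    have fp: "(\<lambda>\<omega>. f (particles n \<omega>)) \<in> borel_measurable (joint n)" by measurable
    have pm: "permute_coords n \<pi> \<in> measurable (samples n) (samples n)"
      using permute_coords_measurable[OF \<pi>] by (simp cong: measurable_cong_sets add: measurable_cong_sets[OF sets_samples sets_samples] del: One_nat_def)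
    have "(\<integral>\<^sup>+\<omega>. f (permute_coords n \<pi> (particles n \<omega>)) \<partial>joint n)
        = (\<integral>\<^sup>+g. \<integral>\<^sup>+x. f (particles n (g, permute_coords n \<pi> x)) \<partial>samples n \<partial>gaps n)"
      unfolding joint_def
      by (subst samples.nn_integral_fst[symmetric])
         (use measurable_compose[OF particles_measurable f_perm[OF \<open>\<pi> \<in> Perms\<close>]] in \<open>simp_all add: joint_def particles_permute[OF \<pi>] del: One_nat_def\<close>)
    also have "\<dots> = (\<integral>\<^sup>+g. \<integral>\<^sup>+x. f (particles n (g, x)) \<partial>samples n \<partial>gaps n)"
    proof (rule nn_integral_cong)
      fix g assume g: "g \<in> space (gaps n)"
      have m: "(\<lambda>x. f (particles n (g, x))) \<in> borel_measurable (samples n)"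
        using measurable_compose[OF measurable_Pair1'[OF g] fp[unfolded joint_def]] .
      have "(\<integral>\<^sup>+x. f (particles n (g, x)) \<partial>samples n) = (\<integral>\<^sup>+x. f (particles n (g, x)) \<partial>distr (samples n) (samples n) (permute_coords n \<pi>))"
        by (simp only: samples_permute[OF \<pi>])
      also have "\<dots> = (\<integral>\<^sup>+x. f (particles n (g, permute_coords n \<pi> x)) \<partial>samples n)"
        using m by (subst nn_integral_distr[OF pm]) (simp_all cong: measurable_cong_sets)
      finally show "(\<integral>\<^sup>+x. f (particles n (g, permute_coords n \<pi> x)) \<partial>samples n) = (\<integral>\<^sup>+x. f (particles n (g, x)) \<partial>samples n)" ..
    qed
    also have "\<dots> = (\<integral>\<^sup>+\<omega>. f (particles n \<omega>) \<partial>joint n)"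
      unfolding joint_def by (rule samples.nn_integral_fst) (rule fp[unfolded joint_def])
    finally show "(\<integral>\<^sup>+\<omega>. f (permute_coords n \<pi> (particles n \<omega>)) \<partial>joint n) = (\<integral>\<^sup>+\<omega>. f (particles n \<omega>) \<partial>joint n)" .
  qed
  also have "\<dots> = of_nat (fact n) * (\<integral>\<^sup>+\<omega>. f (particles n \<omega>) \<partial>joint n)" by (simp add: fin del: of_nat_fact)
  finally have "(\<integral>\<^sup>+z. f z \<partial>Pn n) = (\<integral>\<^sup>+\<omega>. f (particles n \<omega>) \<partial>joint n)"
    by (subst (asm) ennreal_mult_cancel_left) auto
  moreover have "(\<integral>\<^sup>+\<omega>. f (particles n \<omega>) \<partial>joint n) = emeasure (distr (joint n) (Rn n) (particles n)) A"
    unfolding f_def by (subst nn_integral_distr[symmetric, of "particles n" "joint n" "Rn n"]) auto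
  ultimately show "emeasure (distr (joint n) (Rn n) (particles n)) A = emeasure (Pn n) A"
    by (simp add: f_def)
qed simp

end

section \<open>Quantiles of the gap representation\<close>

text \<open>
  Used twice: for the order statistics, which are sums of independent exponential gaps, and for the
  empirical distribution function of the sample.
\<close>

lemma Chebyshev_independent_sum:
  fixes X :: "'i \<Rightarrow> 'a \<Rightarrow> real"
  assumes M: "\<And>i. prob_space (M i)"
    and I: "finite I" and \<epsilon>: "0 < \<epsilon>"
    and meas [measurable]: "\<And>i. i \<in> I \<Longrightarrow> X i \<in> borel_measurable (M i)"
    and int1: "\<And>i. i \<in> I \<Longrightarrow> integrable (M i) (X i)"
    and int2: "\<And>i. i \<in> I \<Longrightarrow> integrable (M i) (\<lambda>x. (X i x)\<^sup>2)"
  shows "measure (Pi\<^sub>M I M) {x \<in> space (Pi\<^sub>M I M). \<epsilon> \<le> \<bar>(\<Sum>i\<in>I. X i (x i)) - (\<Sum>i\<in>I. integral\<^sup>L (M i) (X i))\<bar>}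
    \<le> (\<Sum>i\<in>I. (\<integral>x. (X i x - integral\<^sup>L (M i) (X i))\<^sup>2 \<partial>M i)) / \<epsilon>\<^sup>2"
proof -
  interpret product_prob_space M using M by (rule product_prob_spaceI)
  define \<mu> where "\<mu> i = integral\<^sup>L (M i) (X i)" for i
  define Z where "Z i x = X i x - \<mu> i" for i x
  have Z_meas [measurable]: "Z i \<in> borel_measurable (M i)" if "i \<in> I" for i
    using meas[OF that] unfolding Z_def[abs_def] by measurable
  have Z_int: "integrable (M i) (Z i)" "integral\<^sup>L (M i) (Z i) = 0" if "i \<in> I" for i
    using int1[OF that] by (simp_all add: Z_def[abs_def] \<mu>_def M.prob_space)
  have Z2_int: "integrable (M i) (\<lambda>x. (Z i x)\<^sup>2)" if "i \<in> I" for i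
    using int1[OF that] int2[OF that] by (simp add: Z_def power2_diff)
  have comp_meas [measurable]: "(\<lambda>x. x i) \<in> measurable (Pi\<^sub>M I M) (M i)" if "i \<in> I" for i
    using that by measurable
  have comp: "distr (Pi\<^sub>M I M) (M i) (\<lambda>x. x i) = M i" if "i \<in> I" for i
    using that by (intro distr_PiM_component M.prob_space_axioms)
  have marg: "integrable (Pi\<^sub>M I M) (\<lambda>x. h (x i))" "(\<integral>x. h (x i) \<partial>Pi\<^sub>M I M) = integral\<^sup>L (M i) h"
    if i: "i \<in> I" and h: "integrable (M i) h" for i and h :: "'a \<Rightarrow> real"
    using integrable_distr_eq[OF comp_meas[OF i], of h] integral_distr[OF comp_meas[OF i], of h] h
    by (simp_all add: comp[OF i] borel_measurable_integrable)
  have cross: "integrable (Pi\<^sub>M I M) (\<lambda>x. Z i (x i) * Z j (x j)) \<and> (\<integral>x. Z i (x i) * Z j (x j) \<partial>Pi\<^sub>M I M) = 0"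
    if ij: "i \<in> I" "j \<in> I" "i \<noteq> j" for i j
  proof -
    define h where "h l = (if l = i then Z i else if l = j then Z j else (\<lambda>_. 1))" for l
    have h_int: "integrable (M l) (h l)" if "l \<in> I" for l using Z_int ij by (auto simp: h_def)
    have prod: "(\<Prod>l\<in>I. h l (x l)) = Z i (x i) * Z j (x j)" for x
    proof -
      have "(\<Prod>l\<in>I. h l (x l)) = h i (x i) * (h j (x j) * (\<Prod>l\<in>I - {i} - {j}. h l (x l)))"
        using I ij by (simp add: prod.remove[of I i] prod.remove[of "I - {i}" j])
      also have "(\<Prod>l\<in>I - {i} - {j}. h l (x l)) = 1" by (intro prod.neutral) (auto simp: h_def)
      finally show ?thesis using ij by (simp add: h_def)
    qed
    have "(\<Prod>l\<in>I. integral\<^sup>L (M l) (h l)) = 0"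
      using I ij Z_int(2)[OF ij(1)] by (intro prod_zero bexI[of _ i]) (auto simp: h_def)
    then show ?thesis
      using product_integrable_prod[OF I h_int] product_integral_prod[OF I h_int] by (simp add: prod)
  qed
  have pair: "integrable (Pi\<^sub>M I M) (\<lambda>x. Z i (x i) * Z j (x j))"
    "(\<integral>x. Z i (x i) * Z j (x j) \<partial>Pi\<^sub>M I M) = (if i = j then \<integral>x. (Z i x)\<^sup>2 \<partial>M i else 0)"
    if "i \<in> I" "j \<in> I" for i j
    using cross[OF that] marg[OF that(1) Z2_int[OF that(1)]] by (auto simp: power2_eq_square)
  have sq: "(\<Sum>i\<in>I. Z i (x i))\<^sup>2 = (\<Sum>i\<in>I. \<Sum>j\<in>I. Z i (x i) * Z j (x j))" for x
    by (simp add: power2_eq_square sum_product)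
  have int_sq: "integrable (Pi\<^sub>M I M) (\<lambda>x. (\<Sum>i\<in>I. Z i (x i))\<^sup>2)"
    unfolding sq using pair by (intro Bochner_Integration.integrable_sum) auto
  have "(\<integral>x. (\<Sum>i\<in>I. Z i (x i))\<^sup>2 \<partial>Pi\<^sub>M I M) = (\<Sum>i\<in>I. \<Sum>j\<in>I. if i = j then \<integral>x. (Z i x)\<^sup>2 \<partial>M i else 0)"
    unfolding sq using pair by (simp add: Bochner_Integration.integral_sum)
  also have "\<dots> = (\<Sum>i\<in>I. \<integral>x. (Z i x)\<^sup>2 \<partial>M i)" using I by simp
  finally have var: "(\<integral>x. (\<Sum>i\<in>I. Z i (x i))\<^sup>2 \<partial>Pi\<^sub>M I M) = (\<Sum>i\<in>I. \<integral>x. (Z i x)\<^sup>2 \<partial>M i)" .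
  have mean: "(\<integral>x. (\<Sum>i\<in>I. Z i (x i)) \<partial>Pi\<^sub>M I M) = 0"
    using marg Z_int by (simp add: Bochner_Integration.integral_sum)
  have "(\<lambda>x. \<Sum>i\<in>I. Z i (x i)) \<in> borel_measurable (Pi\<^sub>M I M)" by measurable
  from prob_space.Chebyshev_inequality[OF prob_space_PiM[OF M.prob_space_axioms] this int_sq \<epsilon>]
  have "measure (Pi\<^sub>M I M) {x \<in> space (Pi\<^sub>M I M). \<epsilon> \<le> \<bar>\<Sum>i\<in>I. Z i (x i)\<bar>} \<le> (\<Sum>i\<in>I. \<integral>x. (Z i x)\<^sup>2 \<partial>M i) / \<epsilon>\<^sup>2"
    unfolding mean var[symmetric] by simp
  then show ?thesis by (simp add: Z_def \<mu>_def sum_subtractf)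
qed

context decreasing_drift
begin

lemma gap_law_distributed: "distributed (gap_law n j) lborel (\<lambda>x. x) (exponential_density (rate n j))"
proof -
  have "distr (gap_law n j) lborel (\<lambda>x. x) = gap_law n j" by (rule distr_id2) simp
  then show ?thesis using rate_pos[of n j]
    by (simp add: distributed_def) (simp add: gap_law_def)
qed

lemma gap_law_moments:
  shows "integral\<^sup>L (gap_law n j) (\<lambda>x. x) = 1 / rate n j"
    and "(\<integral>x. (x - 1 / rate n j)\<^sup>2 \<partial>gap_law n j) = 1 / (rate n j)\<^sup>2"
    and "integrable (gap_law n j) (\<lambda>x. x)" and "integrable (gap_law n j) (\<lambda>x. x\<^sup>2)"
proof -
  show mean: "integral\<^sup>L (gap_law n j) (\<lambda>x. x) = 1 / rate n j"
    by (rule gap_prod.M.exponential_distributed_expectation[OF rate_pos gap_law_distributed])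
  show "(\<integral>x. (x - 1 / rate n j)\<^sup>2 \<partial>gap_law n j) = 1 / (rate n j)\<^sup>2"
    using gap_prod.M.exponential_distributed_variance[OF rate_pos[of n j] gap_law_distributed[of n j]] unfolding mean .
  show "integrable (gap_law n j) (\<lambda>x. x)"
    using gap_prod.M.erlang_ith_moment_integrable[OF rate_pos gap_law_distributed, where i=1] by simp
  show "integrable (gap_law n j) (\<lambda>x. x\<^sup>2)"
    using gap_prod.M.erlang_ith_moment_integrable[OF rate_pos gap_law_distributed, where i=2] by simp
qed

text \<open>
  Tilting an exponential density by \<open>exp (t * x)\<close> gives a multiple of the one with rate lowered by \<open>t\<close>.
\<close>

lemma gap_law_exp_moment:
  assumes "t < rate n j"
  shows "(\<integral>\<^sup>+x. ennreal (exp (t * x)) \<partial>gap_law n j) = ennreal (1 / (1 - t / rate n j))"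
proof -
  define l where "l = rate n j"
  have l: "0 < l" "t < l" using rate_pos assms by (simp_all add: l_def)
  have "(\<integral>\<^sup>+x. ennreal (exp (t * x)) \<partial>gap_law n j)
      = (\<integral>\<^sup>+x. ennreal (exponential_density l x) * ennreal (exp (t * x)) \<partial>lborel)"
    unfolding gap_law_def l_def[symmetric] by (rule nn_integral_density) auto
  also have "\<dots> = (\<integral>\<^sup>+x. ennreal (l / (l - t)) * ennreal (exponential_density (l - t) x) \<partial>lborel)"
  proof (rule nn_integral_cong)
    fix x :: real
    have "exponential_density l x * exp (t * x) = l / (l - t) * exponential_density (l - t) x"
    proof -
      have "exp (- x * l) * exp (t * x) = exp (- x * (l - t))" by (simp add: exp_add[symmetric] algebra_simps)
      then show ?thesis using l by (simp add: exponential_density_def mult.assoc)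
    qed
    then show "ennreal (exponential_density l x) * ennreal (exp (t * x)) = ennreal (l / (l - t)) * ennreal (exponential_density (l - t) x)"
      using l by (simp add: ennreal_mult[symmetric])
  qed
  also have "\<dots> = ennreal (l / (l - t)) * emeasure (density lborel (exponential_density (l - t))) UNIV"
    by (simp add: nn_integral_cmult emeasure_density)
  also have "emeasure (density lborel (exponential_density (l - t))) UNIV = 1"
    using prob_space.emeasure_space_1[OF prob_space_exponential_density[of "l - t"]] l by simp
  also have "l / (l - t) = 1 / (1 - t / l)" using l by (simp add: field_simps)
  finally show ?thesis by (simp add: l_def)
qed

abbreviation gap_coeff :: "nat \<Rightarrow> nat \<Rightarrow> nat \<Rightarrow> real" where
  "gap_coeff n k j \<equiv> real j / real n - (if k \<le> j then 1 else 0)"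

text \<open>
  The mean of \<open>from_gaps n g k\<close> under \<open>gaps n\<close>.
\<close>

definition quantile_mean :: "nat \<Rightarrow> nat \<Rightarrow> real" where
  "quantile_mean n k = (\<Sum>j\<in>{1..<n}. gap_coeff n k j / rate n j)"

lemma from_gaps_Chebyshev:
  assumes "0 < \<epsilon>"
  shows "\<P>(g in gaps n. \<epsilon> \<le> \<bar>from_gaps n g k - quantile_mean n k\<bar>)
    \<le> (\<Sum>j\<in>{1..<n}. (gap_coeff n k j / rate n j)\<^sup>2) / \<epsilon>\<^sup>2"
proof -
  have var: "(\<integral>x. (gap_coeff n k j * x - gap_coeff n k j / rate n j)\<^sup>2 \<partial>gap_law n j) = (gap_coeff n k j / rate n j)\<^sup>2" for j
  proof -
    have "(gap_coeff n k j * x - gap_coeff n k j / rate n j)\<^sup>2 = (gap_coeff n k j)\<^sup>2 * (x - 1 / rate n j)\<^sup>2" for x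
      by (simp only: power_mult_distrib[symmetric] right_diff_distrib) simp
    then have "(\<integral>x. (gap_coeff n k j * x - gap_coeff n k j / rate n j)\<^sup>2 \<partial>gap_law n j)
        = (\<integral>x. (gap_coeff n k j)\<^sup>2 * (x - 1 / rate n j)\<^sup>2 \<partial>gap_law n j)" by presburger
    also have "\<dots> = (gap_coeff n k j)\<^sup>2 * (1 / (rate n j)\<^sup>2)"
      unfolding integral_mult_right_zero gap_law_moments(2) ..
    finally show ?thesis by (simp only: power_divide) simp
  qed
  have "measure (Pi\<^sub>M {1..<n} (gap_law n)) {g \<in> space (Pi\<^sub>M {1..<n} (gap_law n)).
        \<epsilon> \<le> \<bar>(\<Sum>j\<in>{1..<n}. gap_coeff n k j * g j) - (\<Sum>j\<in>{1..<n}. integral\<^sup>L (gap_law n j) (\<lambda>x. gap_coeff n k j * x))\<bar>}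
      \<le> (\<Sum>j\<in>{1..<n}. (\<integral>x. (gap_coeff n k j * x - integral\<^sup>L (gap_law n j) (\<lambda>x. gap_coeff n k j * x))\<^sup>2 \<partial>gap_law n j)) / \<epsilon>\<^sup>2"
    using Chebyshev_independent_sum[of "gap_law n" "{1..<n}" \<epsilon> "\<lambda>j x. gap_coeff n k j * x", OF prob_space_gap_law] assms gap_law_moments
    by (simp add: power_mult_distrib)
  then show ?thesis
    by (simp only: integral_mult_right_zero gap_law_moments(1) times_divide_eq_right mult_1_right var
        gaps_def[symmetric] from_gaps_def[symmetric] quantile_mean_def[symmetric])
qed

text \<open>
  Since the integrands are monotone, each term of the Riemann sums lies between two increments of the
  integral. Telescoping then compares the sums with \<open>left_part\<close> and \<open>right_part\<close> themselves.
\<close>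

lemma left_part_increment:
  assumes "0 < x" "x \<le> y" "y < 1"
  shows "(y - x) * (x * beta x) \<le> left_part y - left_part x"
    and "left_part y - left_part x \<le> (y - x) * (y * beta y)"
proof -
  have "(y - x) * (x * beta x) \<le> left_part y - left_part x \<and> left_part y - left_part x \<le> (y - x) * (y * beta y)"
  proof (cases "x = y")
    case False
    then have "x < y" using assms by simp
    moreover have "(left_part has_real_derivative (\<lambda>u. u * beta u) u) (at u)" if "x \<le> u" "u \<le> y" for u
      using left_part_deriv[of u] that assms by simp
    ultimately obtain z where z: "x < z" "z < y" "left_part y - left_part x = (y - x) * (z * beta z)"
      using MVT2[of x y left_part "\<lambda>u. u * beta u"] by blast
    then show ?thesis using left_weight_mono[of x z] left_weight_mono[of z y] assms
      by (auto intro!: mult_left_mono)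
  qed simp
  then show "(y - x) * (x * beta x) \<le> left_part y - left_part x" "left_part y - left_part x \<le> (y - x) * (y * beta y)"
    by auto
qed

lemma right_part_increment:
  assumes "0 < x" "x \<le> y" "y < 1"
  shows "right_part x - right_part y \<le> (y - x) * ((1 - x) * beta x)"
    and "(y - x) * ((1 - y) * beta y) \<le> right_part x - right_part y"
proof -
  have "(y - x) * ((1 - y) * beta y) \<le> right_part x - right_part y \<and> right_part x - right_part y \<le> (y - x) * ((1 - x) * beta x)"
  proof (cases "x = y")
    case False
    then have "x < y" using assms by simp
    moreover have "(right_part has_real_derivative (\<lambda>u. - ((1 - u) * beta u)) u) (at u)" if "x \<le> u" "u \<le> y" for u
      using right_part_deriv[of u] that assms by simp
    ultimately obtain z where z: "x < z" "z < y" "right_part y - right_part x = (y - x) * - ((1 - z) * beta z)"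
      using MVT2[of x y right_part "\<lambda>u. - ((1 - u) * beta u)"] by blast
    then have eq: "right_part x - right_part y = (y - x) * ((1 - z) * beta z)" by (simp add: algebra_simps)
    show ?thesis unfolding eq using right_weight_antimono[of x z] right_weight_antimono[of z y] assms z(1,2)
      by (auto intro!: mult_left_mono)
  qed simp
  then show "right_part x - right_part y \<le> (y - x) * ((1 - x) * beta x)"
    "(y - x) * ((1 - y) * beta y) \<le> right_part x - right_part y" by auto
qed

abbreviation left_term :: "nat \<Rightarrow> nat \<Rightarrow> real" where
  "left_term n j \<equiv> 1 / real n * (real j / real n * beta (real j / real n))"

abbreviation right_term :: "nat \<Rightarrow> nat \<Rightarrow> real" where
  "right_term n j \<equiv> 1 / real n * ((1 - real j / real n) * beta (real j / real n))"

lemma quantile_mean_split: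
  assumes "1 \<le> k" "k \<le> n"
  shows "quantile_mean n k = (\<Sum>j\<in>{1..<k}. left_term n j)
    - (\<Sum>j\<in>{k..<n}. right_term n j)"
proof -
  have "{1..<n} = {1..<k} \<union> {k..<n}" "{1..<k} \<inter> {k..<n} = {}" using assms by auto
  then have "quantile_mean n k = (\<Sum>j\<in>{1..<k}. gap_coeff n k j / rate n j) + (\<Sum>j\<in>{k..<n}. gap_coeff n k j / rate n j)"
    unfolding quantile_mean_def by (simp add: sum.union_disjoint)
  moreover have "(\<Sum>j\<in>{1..<k}. gap_coeff n k j / rate n j) = (\<Sum>j\<in>{1..<k}. left_term n j)"
    using assms by (intro sum.cong refl) (simp add: rate_def)
  moreover have "(\<Sum>j\<in>{k..<n}. gap_coeff n k j / rate n j) = - (\<Sum>j\<in>{k..<n}. right_term n j)"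
    unfolding sum_negf[symmetric]
  proof (intro sum.cong refl)
    fix j assume "j \<in> {k..<n}"
    then have "gap_coeff n k j / rate n j = - (1 - real j / real n) / (real n / beta (real j / real n))"
      using assms by (simp add: rate_def)
    moreover have "- (1 - c) / (m / d) = - (1 / m * ((1 - c) * d))" for c d m :: real
      by (cases "m = 0") (simp_all add: field_simps)
    ultimately show "gap_coeff n k j / rate n j = - (right_term n j)"
      by (simp only:)
  qed
  ultimately show ?thesis by simp
qed

text \<open>
  The ends at \<open>1 / n\<close> and \<open>(n - 1) / n\<close> are kept, because the weights are not controlled at 0 and 1; they
  disappear in the limit since \<open>left_part\<close> tends to 0 at 0 and \<open>right_part\<close> tends to 0 at 1.
\<close>

lemma quantile_mean_bounds:
  assumes k: "2 \<le> k" "k < n"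
  shows "quantile_mean n k \<le> left_part (real k / real n) - left_part (1 / real n)
      - (right_part (real k / real n) - right_part (real (n - 1) / real n))"
    and "left_part (real (k - 1) / real n) - left_part (1 / real n)
      - (right_part (real (k - 1) / real n) - right_part (real (n - 1) / real n)) \<le> quantile_mean n k"
proof -
  obtain m where m: "n = Suc m" using k by (cases n) auto
  obtain l where l: "k = Suc l" "1 \<le> l" using k by (cases k) auto
  have step: "real (Suc j) / real n - real j / real n = 1 / real n" for j
    by (simp add: add_divide_distrib)
  have pos: "0 < real j / real n" if "1 \<le> j" for j using that k by simp
  have lt: "real j / real n < 1" if "j < n" for j using that by simp
  have le: "real j / real n \<le> real (Suc j) / real n" for j by (simp add: divide_right_mono)
  have incL: "left_term n j \<le> left_part (real (Suc j) / real n) - left_part (real j / real n)"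
    "left_part (real (Suc j) / real n) - left_part (real j / real n) \<le> left_term n (Suc j)"
    "right_part (real j / real n) - right_part (real (Suc j) / real n) \<le> right_term n j"
    "right_term n (Suc j) \<le> right_part (real j / real n) - right_part (real (Suc j) / real n)"
    if "1 \<le> j" "Suc j < n" for j
    using left_part_increment[OF pos le lt, of j] right_part_increment[OF pos le lt, of j] that unfolding step by blast+
  have "(\<Sum>j\<in>{1..<k}. left_term n j)
      \<le> (\<Sum>j\<in>{1..<k}. left_part (real (Suc j) / real n) - left_part (real j / real n))"
    using k by (intro sum_mono incL(1)) auto
  also have "\<dots> = left_part (real k / real n) - left_part (real 1 / real n)"
    using k by (intro sum_Suc_diff') simp
  finally have L_upper: "(\<Sum>j\<in>{1..<k}. left_term n j)
      \<le> left_part (real k / real n) - left_part (1 / real n)" by simp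
  have "left_part (real l / real n) - left_part (real 1 / real n)
      = (\<Sum>j\<in>{1..<l}. left_part (real (Suc j) / real n) - left_part (real j / real n))"
    using l by (intro sum_Suc_diff'[symmetric]) simp
  also have "\<dots> \<le> (\<Sum>j\<in>{1..<l}. left_term n (Suc j))"
    using k l by (intro sum_mono incL(2)) auto
  also have "\<dots> = (\<Sum>j\<in>{Suc 1..<Suc l}. left_term n j)"
    by (rule sum.shift_bounds_Suc_ivl[symmetric])
  also have "\<dots> \<le> (\<Sum>j\<in>{1..<k}. left_term n j)"
    using k l beta_pos[OF pos lt] by (intro sum_mono2) (auto simp: less_imp_le)
  finally have L_lower: "left_part (real (k - 1) / real n) - left_part (1 / real n)
      \<le> (\<Sum>j\<in>{1..<k}. left_term n j)" using l by simp
  have "(\<Sum>j\<in>{k..<n}. right_term n j)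
      = (\<Sum>j\<in>{l..<m}. right_term n (Suc j))"
    unfolding l m by (rule sum.shift_bounds_Suc_ivl)
  also have "\<dots> \<le> (\<Sum>j\<in>{l..<m}. - right_part (real (Suc j) / real n) - - right_part (real j / real n))"
    using k l m unfolding minus_diff_minus by (intro sum_mono ord_le_eq_trans[OF incL(4)]) auto
  also have "\<dots> = - right_part (real m / real n) - - right_part (real l / real n)"
    using k l m by (intro sum_Suc_diff') simp
  finally have R_upper: "(\<Sum>j\<in>{k..<n}. right_term n j)
      \<le> right_part (real (k - 1) / real n) - right_part (real (n - 1) / real n)" using l m by simp
  have "- right_part (real m / real n) - - right_part (real k / real n)
      = (\<Sum>j\<in>{k..<m}. - right_part (real (Suc j) / real n) - - right_part (real j / real n))"
    using k m by (intro sum_Suc_diff'[symmetric]) simp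
  also have "\<dots> \<le> (\<Sum>j\<in>{k..<m}. right_term n j)"
    using k m unfolding minus_diff_minus by (intro sum_mono ord_eq_le_trans[OF _ incL(3)]) auto
  also have "\<dots> \<le> (\<Sum>j\<in>{k..<n}. right_term n j)"
    using k m beta_pos[OF pos lt] by (intro sum_mono2) (auto simp: less_imp_le)
  finally have R_lower: "right_part (real k / real n) - right_part (real (n - 1) / real n)
      \<le> (\<Sum>j\<in>{k..<n}. right_term n j)" using m by simp
  have split: "quantile_mean n k = (\<Sum>j\<in>{1..<k}. left_term n j)
    - (\<Sum>j\<in>{k..<n}. right_term n j)"
    using k by (intro quantile_mean_split) auto
  show "quantile_mean n k \<le> left_part (real k / real n) - left_part (1 / real n)
      - (right_part (real k / real n) - right_part (real (n - 1) / real n))"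
    unfolding split using L_upper R_lower by linarith
  show "left_part (real (k - 1) / real n) - left_part (1 / real n)
      - (right_part (real (k - 1) / real n) - right_part (real (n - 1) / real n)) \<le> quantile_mean n k"
    unfolding split using L_lower R_upper by linarith
qed

lemma eventually_interior_rank:
  fixes k :: "nat \<Rightarrow> nat"
  assumes k: "(\<lambda>n. real (k n) / real n) \<longlonglongrightarrow> u" and u: "0 < u" "u < 1"
  shows "\<forall>\<^sub>F n in sequentially. 2 \<le> k n \<and> k n < n"
proof -
  have "\<forall>\<^sub>F n in sequentially. real (k n) / real n < 1" using order_tendstoD(2)[OF k u(2)] .
  moreover have "\<forall>\<^sub>F n in sequentially. u / 2 < real (k n) / real n" using order_tendstoD(1)[OF k, of "u / 2"] u by simp
  moreover have "\<forall>\<^sub>F n in sequentially. 4 / u < real n"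
    using filterlim_real_sequentially by (auto simp: filterlim_at_top_dense)
  ultimately show ?thesis
  proof eventually_elim
    case (elim n)
    have n: "0 < real n" using elim(3) u by (meson less_trans zero_less_divide_iff zero_less_numeral)
    have "k n < n" using elim(1) n by simp
    moreover have "2 < real (k n)"
    proof -
      have "4 < u * real n" using elim(3) u by (simp add: field_simps)
      moreover have "u * real n < 2 * real (k n)" using elim(2) n by (simp add: field_simps)
      ultimately show ?thesis by linarith
    qed
    ultimately show ?case by simp
  qed
qed

lemma quantile_mean_tendsto:
  fixes k :: "nat \<Rightarrow> nat"
  assumes k: "(\<lambda>n. real (k n) / real n) \<longlonglongrightarrow> u" and u: "0 < u" "u < 1"
  shows "(\<lambda>n. quantile_mean n (k n)) \<longlonglongrightarrow> \<Phi> u"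
proof -
  have inner: "\<forall>\<^sub>F n in sequentially. 2 \<le> k n \<and> k n < n" by (rule eventually_interior_rank[OF k u])
  have "(\<lambda>n. real (k n) / real n - 1 / real n) \<longlonglongrightarrow> u - 0"
    by (intro tendsto_diff k lim_1_over_n)
  moreover have "\<forall>\<^sub>F n in sequentially. real (k n) / real n - 1 / real n = real (k n - 1) / real n"
    using inner by eventually_elim (simp add: of_nat_diff diff_divide_distrib)
  ultimately have k': "(\<lambda>n. real (k n - 1) / real n) \<longlonglongrightarrow> u"
    using Lim_transform_eventually by fastforce
  have contL: "isCont left_part u" and contR: "isCont right_part u"
    using left_part_deriv[OF u] right_part_deriv[OF u] by (auto intro: DERIV_isCont)
  have L0: "(\<lambda>n. left_part (1 / real n)) \<longlonglongrightarrow> 0"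
  proof (rule filterlim_compose[OF left_part_lim])
    show "filterlim (\<lambda>n. 1 / real n) (at_right 0) sequentially" by real_asymp
  qed
  have R0: "(\<lambda>n. right_part (real (n - 1) / real n)) \<longlonglongrightarrow> 0"
  proof (rule filterlim_compose[OF right_part_lim])
    have "filterlim (\<lambda>n. (real n - 1) / real n) (at_left 1) sequentially" by real_asymp
    moreover have "\<forall>\<^sub>F n in sequentially. (real n - 1) / real n = real (n - 1) / real n"
      using eventually_ge_at_top[of 1] by eventually_elim (simp add: of_nat_diff)
    ultimately show "filterlim (\<lambda>n. real (n - 1) / real n) (at_left 1) sequentially"
      by (rule filterlim_cong[OF refl refl, THEN iffD1, rotated])
  qed
  have up: "(\<lambda>n. left_part (real (k n) / real n) - left_part (1 / real n)
      - (right_part (real (k n) / real n) - right_part (real (n - 1) / real n))) \<longlonglongrightarrow> left_part u - 0 - (right_part u - 0)"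
    by (intro tendsto_diff isCont_tendsto_compose[OF contL k] isCont_tendsto_compose[OF contR k] L0 R0)
  have low: "(\<lambda>n. left_part (real (k n - 1) / real n) - left_part (1 / real n)
      - (right_part (real (k n - 1) / real n) - right_part (real (n - 1) / real n))) \<longlonglongrightarrow> left_part u - 0 - (right_part u - 0)"
    by (intro tendsto_diff isCont_tendsto_compose[OF contL k'] isCont_tendsto_compose[OF contR k'] L0 R0)
  have "(\<lambda>n. quantile_mean n (k n)) \<longlonglongrightarrow> left_part u - 0 - (right_part u - 0)"
  proof (rule tendsto_sandwich[OF _ _ low up])
    show "\<forall>\<^sub>F n in sequentially. left_part (real (k n - 1) / real n) - left_part (1 / real n)
      - (right_part (real (k n - 1) / real n) - right_part (real (n - 1) / real n)) \<le> quantile_mean n (k n)"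
      using inner by eventually_elim (intro quantile_mean_bounds; simp)
    show "\<forall>\<^sub>F n in sequentially. quantile_mean n (k n) \<le> left_part (real (k n) / real n) - left_part (1 / real n)
      - (right_part (real (k n) / real n) - right_part (real (n - 1) / real n))"
      using inner by eventually_elim (intro quantile_mean_bounds; simp)
  qed
  then show ?thesis by (simp add: Phi_eq)
qed

end

section \<open>Convergence in probability\<close>

context decreasing_drift
begin

text \<open>
  \<open>rate n j\<close> is at least a multiple of \<open>j * (n - j) / n\<close>, and the coefficient of gap \<open>j\<close> cancels the small
  factor at one of the two ends.
\<close>

lemma gap_coeff_rate_bound:
  assumes C: "\<forall>v. 0 < v \<longrightarrow> v < 1 \<longrightarrow> beta v \<le> C / (v * (1 - v))" and j: "1 \<le> j" "j < n"
  shows "k \<le> j \<Longrightarrow> \<bar>gap_coeff n k j\<bar> / rate n j \<le> C / real j"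
    and "j < k \<Longrightarrow> \<bar>gap_coeff n k j\<bar> / rate n j \<le> C / real (n - j)"
proof -
  define v where "v = real j / real n"
  have v: "0 < v" "v < 1" using j by (auto simp: v_def)
  have n: "0 < real n" using j by simp
  have rate: "x / rate n j = x * beta v / real n" for x using j by (simp add: rate_def v_def)
  have \<beta>: "beta v \<le> C / (v * (1 - v))" using C v by blast
  show "\<bar>gap_coeff n k j\<bar> / rate n j \<le> C / real j" if "k \<le> j"
  proof -
    have "\<bar>gap_coeff n k j\<bar> / rate n j = (1 - v) * beta v / real n" using that v by (simp add: rate v_def[symmetric])
    also have "\<dots> \<le> (1 - v) * (C / (v * (1 - v))) / real n"
      using v n \<beta> by (intro divide_right_mono mult_left_mono) auto
    also have "\<dots> = C / (v * real n)" using v by simp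
    also have "v * real n = real j" using n by (simp add: v_def)
    finally show ?thesis .
  qed
  show "\<bar>gap_coeff n k j\<bar> / rate n j \<le> C / real (n - j)" if "j < k"
  proof -
    have "\<bar>gap_coeff n k j\<bar> / rate n j = v * beta v / real n" using that v by (simp add: rate v_def[symmetric])
    also have "\<dots> \<le> v * (C / (v * (1 - v))) / real n"
      using v n \<beta> by (intro divide_right_mono mult_left_mono) auto
    also have "\<dots> = C / ((1 - v) * real n)" using v by simp
    also have "(1 - v) * real n = real (n - j)" using n j by (simp add: v_def algebra_simps of_nat_diff)
    finally show ?thesis .
  qed
qed

lemma quantile_variance_bound:
  assumes C: "\<forall>v. 0 < v \<longrightarrow> v < 1 \<longrightarrow> beta v \<le> C / (v * (1 - v))" "0 < C" and k: "1 \<le> k" "k < n"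
  shows "(\<Sum>j\<in>{1..<n}. (gap_coeff n k j / rate n j)\<^sup>2) \<le> real n * ((C / real k)\<^sup>2 + (C / real (n - k))\<^sup>2)"
proof -
  have "(gap_coeff n k j / rate n j)\<^sup>2 \<le> (C / real k)\<^sup>2 + (C / real (n - k))\<^sup>2" if j: "j \<in> {1..<n}" for j
  proof -
    have eq: "(gap_coeff n k j / rate n j)\<^sup>2 = (\<bar>gap_coeff n k j\<bar> / rate n j)\<^sup>2"
      by (simp add: power_divide)
    have nonneg: "0 \<le> \<bar>gap_coeff n k j\<bar> / rate n j" using rate_pos[of n j] by simp
    show ?thesis
    proof (cases "k \<le> j")
      case True
      have "\<bar>gap_coeff n k j\<bar> / rate n j \<le> C / real j" using gap_coeff_rate_bound(1)[OF C(1) _ _ True] j by simp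
      also have "\<dots> \<le> C / real k" using True C k by (intro divide_left_mono) auto
      finally have "(\<bar>gap_coeff n k j\<bar> / rate n j)\<^sup>2 \<le> (C / real k)\<^sup>2" using nonneg by (intro power_mono)
      then show ?thesis unfolding eq by (simp add: add_increasing2)
    next
      case False
      have "\<bar>gap_coeff n k j\<bar> / rate n j \<le> C / real (n - j)" using gap_coeff_rate_bound(2)[OF C(1), of j n k] False j by simp
      also have "\<dots> \<le> C / real (n - k)" using False C k by (intro divide_left_mono) auto
      finally have "(\<bar>gap_coeff n k j\<bar> / rate n j)\<^sup>2 \<le> (C / real (n - k))\<^sup>2" using nonneg by (intro power_mono)
      then show ?thesis unfolding eq by (simp add: add_increasing)
    qed
  qed
  then have "(\<Sum>j\<in>{1..<n}. (gap_coeff n k j / rate n j)\<^sup>2) \<le> (\<Sum>j\<in>{1..<n}. (C / real k)\<^sup>2 + (C / real (n - k))\<^sup>2)"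
    by (rule sum_mono)
  also have "\<dots> = real (n - 1) * ((C / real k)\<^sup>2 + (C / real (n - k))\<^sup>2)" by simp
  also have "\<dots> \<le> real n * ((C / real k)\<^sup>2 + (C / real (n - k))\<^sup>2)" by (intro mult_right_mono) auto
  finally show ?thesis .
qed

lemma from_gaps_borel [measurable]: "(\<lambda>g. from_gaps n g k) \<in> borel_measurable (gaps n)"
  using from_gaps_measurable[of n k] by (simp add: measurable_cong_sets[OF sets_gaps refl])

lemma quantile_in_probability:
  fixes k :: "nat \<Rightarrow> nat"
  assumes k: "(\<lambda>n. real (k n) / real n) \<longlonglongrightarrow> u" and u: "0 < u" "u < 1" and \<epsilon>: "0 < \<epsilon>"
  shows "(\<lambda>n. \<P>(g in gaps n. \<epsilon> \<le> \<bar>from_gaps n g (k n) - \<Phi> u\<bar>)) \<longlonglongrightarrow> 0"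
proof -
  obtain C where C: "0 < C" "\<And>v. 0 < v \<Longrightarrow> v < 1 \<Longrightarrow> beta v \<le> C / (v * (1 - v))"
    using beta_upper by blast
  then have C': "\<forall>v. 0 < v \<longrightarrow> v < 1 \<longrightarrow> beta v \<le> C / (v * (1 - v))" by blast
  define V where "V n = (1 / real n) * ((C / (real (k n) / real n))\<^sup>2 + (C / (1 - real (k n) / real n))\<^sup>2) / (\<epsilon> / 2)\<^sup>2" for n
  have "V \<longlonglongrightarrow> 0 * ((C / u)\<^sup>2 + (C / (1 - u))\<^sup>2) / (\<epsilon> / 2)\<^sup>2"
    unfolding V_def using u \<epsilon> by (intro tendsto_intros lim_1_over_n k) auto
  then have V: "V \<longlonglongrightarrow> 0" by simp
  have "\<forall>\<^sub>F n in sequentially. \<bar>quantile_mean n (k n) - \<Phi> u\<bar> < \<epsilon> / 2"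
    using tendstoD[OF quantile_mean_tendsto[OF k u] half_gt_zero[OF \<epsilon>]] unfolding dist_real_def .
  then have "\<forall>\<^sub>F n in sequentially. \<P>(g in gaps n. \<epsilon> \<le> \<bar>from_gaps n g (k n) - \<Phi> u\<bar>) \<le> V n"
    using eventually_interior_rank[OF k u]
  proof eventually_elim
    case (elim n)
    then have kn: "1 \<le> k n" "k n < n" by auto
    have "\<P>(g in gaps n. \<epsilon> \<le> \<bar>from_gaps n g (k n) - \<Phi> u\<bar>)
        \<le> \<P>(g in gaps n. \<epsilon> / 2 \<le> \<bar>from_gaps n g (k n) - quantile_mean n (k n)\<bar>)"
    proof (rule gaps.finite_measure_mono)
      show "{g \<in> space (gaps n). \<epsilon> \<le> \<bar>from_gaps n g (k n) - \<Phi> u\<bar>}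
          \<subseteq> {g \<in> space (gaps n). \<epsilon> / 2 \<le> \<bar>from_gaps n g (k n) - quantile_mean n (k n)\<bar>}"
      proof (intro subsetI CollectI, elim CollectE conjE, intro conjI)
        fix g assume "\<epsilon> \<le> \<bar>from_gaps n g (k n) - \<Phi> u\<bar>"
        then show "\<epsilon> / 2 \<le> \<bar>from_gaps n g (k n) - quantile_mean n (k n)\<bar>" using elim(1) by linarith
      qed
    qed measurable
    also have "\<dots> \<le> (\<Sum>j\<in>{1..<n}. (gap_coeff n (k n) j / rate n j)\<^sup>2) / (\<epsilon> / 2)\<^sup>2"
      using \<epsilon> by (intro from_gaps_Chebyshev) simp
    also have "\<dots> \<le> (real n * ((C / real (k n))\<^sup>2 + (C / real (n - k n))\<^sup>2)) / (\<epsilon> / 2)\<^sup>2"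
      by (intro divide_right_mono quantile_variance_bound[OF C' C(1) kn]) simp
    also have "\<dots> = V n"
    proof -
      have "1 - real (k n) / real n = real (n - k n) / real n" using kn by (simp add: field_simps of_nat_diff)
      moreover have "C / (a / real n) = C / a * real n" for a by simp
      moreover have "1 / N * ((x * N)\<^sup>2 + (y * N)\<^sup>2) = N * (x\<^sup>2 + y\<^sup>2)" if "N \<noteq> 0" for x y N :: real
        using that by (simp add: field_simps power2_eq_square)
      ultimately show ?thesis using kn by (simp only: V_def)
    qed
    finally show ?case .
  qed
  then show ?thesis
    by (intro tendsto_sandwich[OF _ _ tendsto_const V]) auto
qed

lemma gaps_nonneg: "AE g in gaps n. \<forall>j\<in>{1..<n}. 0 \<le> g j"
proof -
  have "AE g in gaps n. 0 \<le> g j" if "j \<in> {1..<n}" for j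
    unfolding gaps_def
  proof (rule AE_PiM_component[OF prob_space_gap_law that])
    show "AE t in gap_law n j. 0 \<le> t"
      unfolding gap_law_def by (subst AE_density) (auto simp: exponential_density_def intro!: AE_I2)
  qed
  then show ?thesis by (simp add: AE_finite_all)
qed

lemma from_gaps_mono:
  assumes "\<forall>j\<in>{1..<n}. 0 \<le> g j" "k \<le> l"
  shows "from_gaps n g k \<le> from_gaps n g l"
  unfolding from_gaps_def using assms by (intro sum_mono mult_right_mono) auto

definition count_below :: "nat \<Rightarrow> (nat \<Rightarrow> real) \<Rightarrow> real \<Rightarrow> nat" where
  "count_below n x t = card {j \<in> {1..n}. x j \<le> t}"

lemma sample_rank_eq_count: "sample_rank n x i = count_below n x (x i)"
  by (simp add: sample_rank_def count_below_def)

lemma count_below_mono: "s \<le> t \<Longrightarrow> count_below n x s \<le> count_below n x t"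
  unfolding count_below_def by (rule card_mono) auto

lemma count_below_eq_sum: "real (count_below n x t) = (\<Sum>j\<in>{1..n}. indicator {..t} (x j))"
proof -
  have "count_below n x t = card ({1..n} \<inter> {j. x j \<le> t})" unfolding count_below_def by (rule arg_cong[where f=card]) auto
  then show ?thesis by (simp add: indicator_def sum.If_cases)
qed

lemma count_below_measurable [measurable]: "(\<lambda>x. real (count_below n x t)) \<in> borel_measurable (samples n)"
  unfolding count_below_eq_sum by measurable

lemma count_below_Chebyshev:
  assumes n: "1 \<le> n" and \<delta>: "0 < \<delta>"
  shows "\<P>(x in samples n. \<delta> \<le> \<bar>real (count_below n x t) / real n - F t\<bar>) \<le> 1 / (real n * \<delta>\<^sup>2)"
proof -
  have mean: "integral\<^sup>L P (\<lambda>x. indicator {..t} x) = F t" by (simp add: measure_P_Iic)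
  have var: "(\<integral>x. (indicator {..t} x - F t)\<^sup>2 \<partial>P) \<le> 1"
  proof -
    have "(\<integral>x. (indicator {..t} x - F t)\<^sup>2 \<partial>P) \<le> (\<integral>x. 1 \<partial>P)"
    proof (rule integral_mono)
      show "(indicator {..t} x - F t)\<^sup>2 \<le> 1" for x
        using F_bounds[of t] by (auto simp: indicator_def power_le_one)
      show "integrable P (\<lambda>x. (indicator {..t} x - F t)\<^sup>2)"
        by (rule P.integrable_const_bound[where B=1])
          (use F_bounds[of t] in \<open>auto simp: indicator_def power_le_one intro!: AE_I2\<close>)
    qed simp
    then show ?thesis using P.prob_space by simp
  qed
  have "\<P>(x in samples n. real n * \<delta> \<le> \<bar>(\<Sum>j\<in>{1..n}. indicator {..t} (x j)) - (\<Sum>j\<in>{1..n}. integral\<^sup>L P (\<lambda>x. indicator {..t} x))\<bar>)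
      \<le> (\<Sum>j\<in>{1..n}. (\<integral>x. (indicator {..t} x - integral\<^sup>L P (\<lambda>x. indicator {..t} x))\<^sup>2 \<partial>P)) / (real n * \<delta>)\<^sup>2"
    unfolding samples_def
    by (rule Chebyshev_independent_sum[of "\<lambda>_. P" "{1..n}" "real n * \<delta>" "\<lambda>_ x. indicator {..t} x"])
       (use n \<delta> in \<open>auto simp: P.prob_space_axioms indicator_def power2_eq_square if_distrib[of "\<lambda>x. x * x"] intro!: P.integrable_const_bound[where B=1]\<close>)
  also have "(\<Sum>j\<in>{1..n}. (\<integral>x. (indicator {..t} x - integral\<^sup>L P (\<lambda>x. indicator {..t} x))\<^sup>2 \<partial>P)) / (real n * \<delta>)\<^sup>2
      \<le> real n / (real n * \<delta>)\<^sup>2"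
    unfolding mean using var by (intro divide_right_mono) (simp_all add: mult_left_le)
  also have "real n / (real n * \<delta>)\<^sup>2 = 1 / (real n * \<delta>\<^sup>2)" using n by (simp add: power2_eq_square field_simps)
  also have "{x \<in> space (samples n). real n * \<delta> \<le> \<bar>(\<Sum>j\<in>{1..n}. indicator {..t} (x j)) - (\<Sum>j\<in>{1..n}. integral\<^sup>L P (\<lambda>x. indicator {..t} x))\<bar>}
      = {x \<in> space (samples n). \<delta> \<le> \<bar>real (count_below n x t) / real n - F t\<bar>}"
  proof -
    have "real n * \<delta> \<le> \<bar>a - real n * F t\<bar> \<longleftrightarrow> \<delta> \<le> \<bar>a / real n - F t\<bar>" for a
    proof -
      have "a - real n * F t = real n * (a / real n - F t)" using n by (simp add: algebra_simps)
      then have "\<bar>a - real n * F t\<bar> = real n * \<bar>a / real n - F t\<bar>" by (simp add: abs_mult)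
      then show ?thesis using n by simp
    qed
    then show ?thesis unfolding mean count_below_eq_sum[symmetric] by simp
  qed
  finally show ?thesis .
qed

lemma measure_joint_fst:
  assumes "{g \<in> space (gaps n). Q g} \<in> sets (gaps n)"
  shows "\<P>(\<omega> in joint n. Q (fst \<omega>)) = \<P>(g in gaps n. Q g)"
proof -
  have m: "fst \<in> measurable (joint n) (gaps n)" by (simp add: joint_def)
  have "\<P>(g in gaps n. Q g) = measure (distr (joint n) (gaps n) fst) {g \<in> space (gaps n). Q g}"
    by (simp only: distr_joint_fst)
  also have "\<dots> = measure (joint n) (fst -` {g \<in> space (gaps n). Q g} \<inter> space (joint n))"
    by (rule measure_distr[OF m assms])
  also have "fst -` {g \<in> space (gaps n). Q g} \<inter> space (joint n) = {\<omega> \<in> space (joint n). Q (fst \<omega>)}"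
    using measurable_space[OF m] by auto
  finally show ?thesis ..
qed

lemma measure_joint_snd:
  assumes "{x \<in> space (samples n). Q x} \<in> sets (samples n)"
  shows "\<P>(\<omega> in joint n. Q (snd \<omega>)) = \<P>(x in samples n. Q x)"
proof -
  have m: "snd \<in> measurable (joint n) (samples n)" by (simp add: joint_def)
  have "\<P>(x in samples n. Q x) = measure (distr (joint n) (samples n) snd) {x \<in> space (samples n). Q x}"
    by (simp only: distr_joint_snd)
  also have "\<dots> = measure (joint n) (snd -` {x \<in> space (samples n). Q x} \<inter> space (joint n))"
    by (rule measure_distr[OF m assms])
  also have "snd -` {x \<in> space (samples n). Q x} \<inter> space (joint n) = {\<omega> \<in> space (joint n). Q (snd \<omega>)}"
    using measurable_space[OF m] by auto
  finally show ?thesis ..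
qed

lemma joint_measurable [measurable]:
  "fst \<in> measurable (joint n) (gaps n)" "snd \<in> measurable (joint n) (samples n)"
  by (simp_all add: joint_def)

text \<open>
  The nondecreasing random function that carries the sample to the particles; see
  \<open>particles_eq_transport\<close>.
\<close>

definition transport :: "nat \<Rightarrow> real \<Rightarrow> (nat \<Rightarrow> real) \<times> (nat \<Rightarrow> real) \<Rightarrow> real" where
  "transport n t \<omega> = from_gaps n (fst \<omega>) (count_below n (snd \<omega>) t)"

lemma transport_measurable [measurable]: "transport n t \<in> borel_measurable (joint n)"
  unfolding transport_def[abs_def] by (rule from_gaps_random_rank_measurable) measurable

lemma ratio_tendsto:
  fixes k :: "nat \<Rightarrow> nat"
  assumes k: "\<And>n. \<bar>real (k n) - real n * u\<bar> \<le> 1"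
  shows "(\<lambda>n. real (k n) / real n) \<longlonglongrightarrow> u"
proof (rule LIM_zero_cancel, rule tendsto_rabs_zero_cancel,
    rule tendsto_sandwich[where f="\<lambda>_. 0" and h="\<lambda>n. 1 / real n"])
  show "(\<lambda>n. 1 / real n) \<longlonglongrightarrow> 0" by (rule lim_1_over_n)
  show "\<forall>\<^sub>F n in sequentially. \<bar>real (k n) / real n - u\<bar> \<le> 1 / real n"
    using eventually_gt_at_top[of 0]
  proof eventually_elim
    case (elim n)
    have "real (k n) / real n - u = (real (k n) - real n * u) / real n" using elim by (simp add: field_simps)
    then have "\<bar>real (k n) / real n - u\<bar> = \<bar>real (k n) - real n * u\<bar> / real n" by simp
    also have "\<dots> \<le> 1 / real n" using k by (rule divide_right_mono) simp
    finally show ?case .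
  qed
qed simp_all

lemma joint_gaps_nonneg: "AE \<omega> in joint n. \<forall>j\<in>{1..<n}. 0 \<le> fst \<omega> j"
proof (rule AE_distrD[where f=fst and M'="gaps n" and P="\<lambda>g. \<forall>j\<in>{1..<n}. 0 \<le> g j"])
  show "AE g in distr (joint n) (gaps n) fst. \<forall>j\<in>{1..<n}. 0 \<le> g j"
    unfolding distr_joint_fst by (rule gaps_nonneg)
qed measurable

text \<open>
  The points \<open>u1 < F t < u2\<close> are the levels whose quantiles are \<open>t - \<epsilon> / 2\<close> and \<open>t + \<epsilon> / 2\<close>. Up to events of
  small probability, the empirical distribution function at \<open>t\<close> lies between \<open>u1\<close> and \<open>u2\<close>, and the two
  order statistics at these levels are within \<open>\<epsilon> / 2\<close> of their limits. Monotonicity in the rank does the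
  rest.
\<close>

lemma transport_in_probability:
  assumes \<epsilon>: "0 < \<epsilon>"
  shows "(\<lambda>n. \<P>(\<omega> in joint n. \<epsilon> \<le> \<bar>transport n t \<omega> - t\<bar>)) \<longlonglongrightarrow> 0"
proof -
  define u1 u2 where "u1 = F (t - \<epsilon> / 2)" and "u2 = F (t + \<epsilon> / 2)"
  have u12: "0 < u1" "u1 < 1" "0 < u2" "u2 < 1" "\<Phi> u1 = t - \<epsilon> / 2" "\<Phi> u2 = t + \<epsilon> / 2"
    using F_bounds Phi_F by (auto simp: u1_def u2_def)
  have less: "u1 < F t" "F t < u2"
  proof -
    have "u1 \<le> F t" "F t \<le> u2" using \<epsilon> by (auto simp: u1_def u2_def intro!: F_mono)
    moreover have "u1 \<noteq> F t" "F t \<noteq> u2" using u12(5,6) Phi_F[of t] \<epsilon> by auto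
    ultimately show "u1 < F t" "F t < u2" by auto
  qed
  define \<delta> where "\<delta> = min (F t - u1) (u2 - F t)"
  have \<delta>: "0 < \<delta>" using less by (simp add: \<delta>_def)
  define k1 k2 where "k1 n = nat \<lfloor>real n * u1\<rfloor>" and "k2 n = nat \<lceil>real n * u2\<rceil>" for n :: nat
  define p1 p2 where "p1 n = \<P>(g in gaps n. \<epsilon> / 2 \<le> \<bar>from_gaps n g (k1 n) - \<Phi> u1\<bar>)"
    and "p2 n = \<P>(g in gaps n. \<epsilon> / 2 \<le> \<bar>from_gaps n g (k2 n) - \<Phi> u2\<bar>)" for n
  have p1: "p1 \<longlonglongrightarrow> 0" unfolding p1_def k1_def
  proof (intro quantile_in_probability ratio_tendsto)
    fix n :: nat
    have "0 \<le> real n * u1" using u12 by simp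
    then show "\<bar>real (nat \<lfloor>real n * u1\<rfloor>) - real n * u1\<bar> \<le> 1" by linarith
  qed (use \<epsilon> u12 in auto)
  have p2: "p2 \<longlonglongrightarrow> 0" unfolding p2_def k2_def
  proof (intro quantile_in_probability ratio_tendsto)
    fix n :: nat
    have "0 \<le> real n * u2" using u12 by simp
    then show "\<bar>real (nat \<lceil>real n * u2\<rceil>) - real n * u2\<bar> \<le> 1" by linarith
  qed (use \<epsilon> u12 in auto)
  have p3: "(\<lambda>n. (1 / real n) * (1 / \<delta>\<^sup>2)) \<longlonglongrightarrow> 0"
    using tendsto_mult[OF lim_1_over_n tendsto_const, of "1 / \<delta>\<^sup>2"] by simp
  have "\<P>(\<omega> in joint n. \<epsilon> \<le> \<bar>transport n t \<omega> - t\<bar>) \<le> p1 n + p2 n + (1 / real n) * (1 / \<delta>\<^sup>2)"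
    if n: "1 \<le> n" for n
  proof -
    define E1 where "E1 = {\<omega> \<in> space (joint n). \<epsilon> / 2 \<le> \<bar>from_gaps n (fst \<omega>) (k1 n) - \<Phi> u1\<bar>}"
    define E2 where "E2 = {\<omega> \<in> space (joint n). \<epsilon> / 2 \<le> \<bar>from_gaps n (fst \<omega>) (k2 n) - \<Phi> u2\<bar>}"
    define E3 where "E3 = {\<omega> \<in> space (joint n). \<delta> \<le> \<bar>real (count_below n (snd \<omega>) t) / real n - F t\<bar>}"
    have [measurable]: "E1 \<in> sets (joint n)" "E2 \<in> sets (joint n)" "E3 \<in> sets (joint n)"
      unfolding E1_def E2_def E3_def by measurable
    have "AE \<omega> in joint n. \<omega> \<in> {\<omega> \<in> space (joint n). \<epsilon> \<le> \<bar>transport n t \<omega> - t\<bar>} \<longrightarrow> \<omega> \<in> E1 \<union> E2 \<union> E3"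
      using joint_gaps_nonneg
    proof (rule AE_mp, intro AE_I2 impI)
      fix \<omega> assume \<omega>: "\<omega> \<in> space (joint n)" "\<forall>j\<in>{1..<n}. 0 \<le> fst \<omega> j" "\<omega> \<in> {\<omega> \<in> space (joint n). \<epsilon> \<le> \<bar>transport n t \<omega> - t\<bar>}"
      show "\<omega> \<in> E1 \<union> E2 \<union> E3"
      proof (rule ccontr)
        assume "\<omega> \<notin> E1 \<union> E2 \<union> E3"
        then have not: "\<bar>from_gaps n (fst \<omega>) (k1 n) - \<Phi> u1\<bar> < \<epsilon> / 2" "\<bar>from_gaps n (fst \<omega>) (k2 n) - \<Phi> u2\<bar> < \<epsilon> / 2"
          "\<bar>real (count_below n (snd \<omega>) t) / real n - F t\<bar> < \<delta>"
          using \<omega>(1) by (auto simp: E1_def E2_def E3_def)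
        have "u1 < real (count_below n (snd \<omega>) t) / real n" "real (count_below n (snd \<omega>) t) / real n < u2"
          using not(3) unfolding \<delta>_def by linarith+
        then have c: "real n * u1 < real (count_below n (snd \<omega>) t)" "real (count_below n (snd \<omega>) t) < real n * u2"
          using n by (simp_all add: field_simps)
        have "k1 n \<le> count_below n (snd \<omega>) t" using c(1) unfolding k1_def by linarith
        moreover have "count_below n (snd \<omega>) t \<le> k2 n" using c(2) unfolding k2_def by linarith
        ultimately have "from_gaps n (fst \<omega>) (k1 n) \<le> transport n t \<omega>" "transport n t \<omega> \<le> from_gaps n (fst \<omega>) (k2 n)"
          unfolding transport_def by (intro from_gaps_mono \<omega>(2); simp)+
        then have "\<bar>transport n t \<omega> - t\<bar> < \<epsilon>" using not(1,2) u12(5,6) by linarith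
        then show False using \<omega>(3) by simp
      qed
    qed
    then have "\<P>(\<omega> in joint n. \<epsilon> \<le> \<bar>transport n t \<omega> - t\<bar>) \<le> measure (joint n) (E1 \<union> E2 \<union> E3)"
      by (rule joint.finite_measure_mono_AE) measurable
    also have "\<dots> \<le> measure (joint n) (E1 \<union> E2) + measure (joint n) E3" by (rule measure_Un_le) auto
    also have "measure (joint n) (E1 \<union> E2) \<le> measure (joint n) E1 + measure (joint n) E2" by (rule measure_Un_le) auto
    also have "measure (joint n) E1 = p1 n" unfolding E1_def p1_def
      by (rule measure_joint_fst[where Q="\<lambda>g. \<epsilon> / 2 \<le> \<bar>from_gaps n g (k1 n) - \<Phi> u1\<bar>"]) measurable
    also have "measure (joint n) E2 = p2 n" unfolding E2_def p2_def
      by (rule measure_joint_fst[where Q="\<lambda>g. \<epsilon> / 2 \<le> \<bar>from_gaps n g (k2 n) - \<Phi> u2\<bar>"]) measurable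
    also have "measure (joint n) E3 = \<P>(x in samples n. \<delta> \<le> \<bar>real (count_below n x t) / real n - F t\<bar>)"
      unfolding E3_def
      by (rule measure_joint_snd[where Q="\<lambda>x. \<delta> \<le> \<bar>real (count_below n x t) / real n - F t\<bar>"]) measurable
    also have "\<dots> \<le> 1 / (real n * \<delta>\<^sup>2)" by (rule count_below_Chebyshev[OF n \<delta>])
    finally show ?thesis by simp
  qed
  then have "\<forall>\<^sub>F n in sequentially. \<P>(\<omega> in joint n. \<epsilon> \<le> \<bar>transport n t \<omega> - t\<bar>) \<le> p1 n + p2 n + (1 / real n) * (1 / \<delta>\<^sup>2)"
    by (rule eventually_mono[OF eventually_ge_at_top[of 1]])
  moreover have "(\<lambda>n. p1 n + p2 n + (1 / real n) * (1 / \<delta>\<^sup>2)) \<longlonglongrightarrow> 0"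
    using tendsto_add[OF tendsto_add[OF p1 p2] p3] by simp
  ultimately show ?thesis
    by (rule tendsto_sandwich[OF always_eventually[OF allI[OF measure_nonneg]] _ tendsto_const])
qed

text \<open>
  Tightness of the limit law.
\<close>

lemma P_tail_small:
  assumes "0 < \<eta>"
  obtains L where "0 < L" "measure P {x. L \<le> \<bar>x\<bar>} < \<eta>"
proof -
  have "\<forall>\<^sub>F L in at_top. F (- L) < \<eta> / 2"
    using filterlim_compose[OF F_lim_bot filterlim_uminus_at_bot_at_top] assms
    by (intro order_tendstoD(2)) auto
  moreover have "\<forall>\<^sub>F L in at_top. 1 - \<eta> / 2 < F (L - 1)"
  proof (rule order_tendstoD(1))
    have "filterlim (\<lambda>L::real. L - 1) at_top at_top" by real_asymp
    then show "((\<lambda>L. F (L - 1)) \<longlongrightarrow> 1) at_top" by (rule filterlim_compose[OF F_lim_top])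
  qed (use assms in simp)
  ultimately have "\<forall>\<^sub>F L in at_top. 0 < L \<and> F (- L) < \<eta> / 2 \<and> 1 - \<eta> / 2 < F (L - 1)"
    using eventually_gt_at_top[of 0] by eventually_elim simp
  from eventually_happens'[OF trivial_limit_at_top_linorder this]
  obtain L where L: "0 < L" "F (- L) < \<eta> / 2" "1 - \<eta> / 2 < F (L - 1)" by blast
  have "measure P {x. L \<le> \<bar>x\<bar>} \<le> measure P ({..- L} \<union> (space P - {..L - 1}))"
    by (rule P.finite_measure_mono) auto
  also have "\<dots> \<le> measure P {..- L} + measure P (space P - {..L - 1})" by (rule measure_Un_le) auto
  also have "\<dots> = F (- L) + (1 - F (L - 1))" by (subst P.prob_compl) (auto simp: measure_P_Iic)
  also have "\<dots> < \<eta>" using L by simp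
  finally show ?thesis using that L by blast
qed

lemma sample_marginal:
  assumes i: "i \<in> {1..n}" and A: "A \<in> sets borel"
  shows "\<P>(\<omega> in joint n. snd \<omega> i \<in> A) = measure P A"
proof -
  have comp: "(\<lambda>x. x i) \<in> measurable (samples n) P"
    using samples_component[OF i] by (simp cong: measurable_cong_sets)
  have "\<P>(\<omega> in joint n. snd \<omega> i \<in> A) = \<P>(x in samples n. x i \<in> A)"
  proof (rule measure_joint_snd[where Q="\<lambda>x. x i \<in> A"])
    have "(\<lambda>x. x i) -` A \<inter> space (samples n) \<in> sets (samples n)" by (rule measurable_sets[OF comp]) (use A in simp)
    moreover have "(\<lambda>x. x i) -` A \<inter> space (samples n) = {x \<in> space (samples n). x i \<in> A}" by auto
    ultimately show "{x \<in> space (samples n). x i \<in> A} \<in> sets (samples n)" by simp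
  qed
  also have "\<dots> = measure (samples n) ((\<lambda>x. x i) -` A \<inter> space (samples n))"
    by (rule arg_cong[where f="measure (samples n)"]) auto
  also have "\<dots> = measure (distr (samples n) P (\<lambda>x. x i)) A"
    using A by (intro measure_distr[symmetric] comp) simp
  also have "distr (samples n) P (\<lambda>x. x i) = P"
    unfolding samples_def by (rule distr_PiM_component[OF P.prob_space_axioms i])
  finally show ?thesis .
qed

lemma particles_eq_transport:
  "i \<in> {1..n} \<Longrightarrow> particles n \<omega> i = transport n (snd \<omega> i) \<omega>"
  by (simp add: particles_def transport_def sample_rank_eq_count split_beta)

lemma transport_mono:
  assumes "\<forall>j\<in>{1..<n}. 0 \<le> fst \<omega> j" "s \<le> t"
  shows "transport n s \<omega> \<le> transport n t \<omega>"
  unfolding transport_def using assms by (intro from_gaps_mono count_below_mono)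

lemma particle_measurable:
  assumes i: "i \<in> {1..n}"
  shows "(\<lambda>\<omega>. particles n \<omega> i) \<in> borel_measurable (joint n)" "(\<lambda>\<omega>. snd \<omega> i) \<in> borel_measurable (joint n)"
proof -
  show "(\<lambda>\<omega>. particles n \<omega> i) \<in> borel_measurable (joint n)"
    by (rule measurable_compose[OF particles_measurable measurable_component_singleton[OF i]])
  show "(\<lambda>\<omega>. snd \<omega> i) \<in> borel_measurable (joint n)"
    by (rule measurable_compose[OF joint_measurable(2) samples_component[OF i]])
qed

text \<open>
  A monotone function that is close to the identity on a grid is close to it everywhere between the
  grid points. So the grid of mesh \<open>\<epsilon> / 2\<close> in a large interval \<open>[- L, L]\<close> reduces the random
  argument \<open>snd \<omega> i\<close> to finitely many fixed arguments.
\<close>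

theorem particles_in_probability:
  assumes i: "1 \<le> i" and \<epsilon>: "0 < \<epsilon>"
  shows "(\<lambda>n. \<P>(\<omega> in joint n. \<epsilon> \<le> \<bar>particles n \<omega> i - snd \<omega> i\<bar>)) \<longlonglongrightarrow> 0"
proof (rule tendstoI)
  fix \<eta> :: real assume \<eta>: "0 < \<eta>"
  define h where "h = \<epsilon> / 2"
  have h: "0 < h" "\<epsilon> = 2 * h" using \<epsilon> by (simp_all add: h_def)
  obtain L where L: "0 < L" "measure P {x. L \<le> \<bar>x\<bar>} < \<eta> / 2"
    using P_tail_small[of "\<eta> / 2"] \<eta> by auto
  (* grid points l * h with - m \<le> l \<le> m cover [- L, L] *)
  define m where "m = \<lceil>L / h\<rceil>"
  have m: "L \<le> real_of_int m * h" using h(1) by (simp add: m_def pos_divide_le_eq[symmetric])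
  define D where "D n l = {\<omega> \<in> space (joint n). h \<le> \<bar>transport n (real_of_int l * h) \<omega> - real_of_int l * h\<bar>}" for n and l :: int
  have D_sets: "D n l \<in> sets (joint n)" for n l unfolding D_def by measurable
  have D_lim: "(\<lambda>n. \<Sum>l\<in>{- m..m}. measure (joint n) (D n l)) \<longlonglongrightarrow> (\<Sum>l\<in>{- m..m}. 0)"
    unfolding D_def by (intro tendsto_sum transport_in_probability h(1))
  have bound: "\<P>(\<omega> in joint n. \<epsilon> \<le> \<bar>particles n \<omega> i - snd \<omega> i\<bar>)
      \<le> (\<Sum>l\<in>{- m..m}. measure (joint n) (D n l)) + measure P {x. L \<le> \<bar>x\<bar>}" if n: "i \<le> n" for n
  proof -
    have in_n: "i \<in> {1..n}" using i n by simp
    note particle_measurable[OF in_n, measurable]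
    define T where "T = {\<omega> \<in> space (joint n). snd \<omega> i \<in> {x. L \<le> \<bar>x\<bar>}}"
    have T [measurable]: "T \<in> sets (joint n)" unfolding T_def by measurable
    have U [measurable]: "(\<Union>l\<in>{- m..m}. D n l) \<in> sets (joint n)" using D_sets by (intro sets.finite_UN) auto
    have "AE \<omega> in joint n. \<omega> \<in> {\<omega> \<in> space (joint n). \<epsilon> \<le> \<bar>particles n \<omega> i - snd \<omega> i\<bar>} \<longrightarrow> \<omega> \<in> (\<Union>l\<in>{- m..m}. D n l) \<union> T"
      using joint_gaps_nonneg
    proof (rule AE_mp, intro AE_I2 impI)
      fix \<omega> assume \<omega>: "\<omega> \<in> space (joint n)" "\<forall>j\<in>{1..<n}. 0 \<le> fst \<omega> j"
        "\<omega> \<in> {\<omega> \<in> space (joint n). \<epsilon> \<le> \<bar>particles n \<omega> i - snd \<omega> i\<bar>}"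
      define x where "x = snd \<omega> i"
      define l where "l = \<lfloor>x / h\<rfloor>"
      show "\<omega> \<in> (\<Union>l\<in>{- m..m}. D n l) \<union> T"
      proof (rule ccontr)
        assume not: "\<omega> \<notin> (\<Union>l\<in>{- m..m}. D n l) \<union> T"
        then have "\<bar>x\<bar> < L" using \<omega>(1) by (auto simp: T_def x_def)
        then have x: "\<bar>x\<bar> < real_of_int m * h" using m by linarith
        have l_le: "real_of_int l * h \<le> x" "x < real_of_int (l + 1) * h"
          using h(1) unfolding l_def by (simp_all add: pos_le_divide_eq[symmetric] pos_divide_less_eq[symmetric])
        have "real_of_int l < real_of_int m"
        proof -
          have "real_of_int l * h < real_of_int m * h" using l_le(1) x by linarith
          then show ?thesis using h(1) by (simp only: mult_less_cancel_right_pos)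
        qed
        moreover have "real_of_int (- m) < real_of_int (l + 1)"
        proof -
          have "real_of_int (- m) * h < real_of_int (l + 1) * h" using l_le(2) x by (simp only: of_int_minus mult_minus_left)
          then show ?thesis using h(1) by (simp only: mult_less_cancel_right_pos)
        qed
        ultimately have in_grid: "l \<in> {- m..m}" "l + 1 \<in> {- m..m}" by auto
        have "\<bar>transport n (real_of_int l' * h) \<omega> - real_of_int l' * h\<bar> < h" if "l' \<in> {- m..m}" for l'
          using not \<omega>(1) that by (auto simp: D_def not_le)
        note near = this[OF in_grid(1)] this[OF in_grid(2)]
        have "transport n (real_of_int l * h) \<omega> \<le> transport n x \<omega>" "transport n x \<omega> \<le> transport n (real_of_int (l + 1) * h) \<omega>"
          using l_le by (auto intro!: transport_mono \<omega>(2))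
        moreover have "real_of_int (l + 1) * h = real_of_int l * h + h" by (simp add: algebra_simps)
        ultimately have "\<bar>transport n x \<omega> - x\<bar> < \<epsilon>" using near l_le h(2) by linarith
        then show False using \<omega>(3) by (simp add: particles_eq_transport[OF in_n] x_def)
      qed
    qed
    then have "\<P>(\<omega> in joint n. \<epsilon> \<le> \<bar>particles n \<omega> i - snd \<omega> i\<bar>) \<le> measure (joint n) ((\<Union>l\<in>{- m..m}. D n l) \<union> T)"
      by (rule joint.finite_measure_mono_AE) measurable
    also have "\<dots> \<le> measure (joint n) (\<Union>l\<in>{- m..m}. D n l) + measure (joint n) T" by (rule measure_Un_le) measurable
    also have "measure (joint n) (\<Union>l\<in>{- m..m}. D n l) \<le> (\<Sum>l\<in>{- m..m}. measure (joint n) (D n l))"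
      by (rule measure_UNION_le) (auto intro: D_sets)
    also have "measure (joint n) T = measure P {x. L \<le> \<bar>x\<bar>}"
      unfolding T_def by (rule sample_marginal[OF in_n]) measurable
    finally show ?thesis by simp
  qed
  have "\<forall>\<^sub>F n in sequentially. (\<Sum>l\<in>{- m..m}. measure (joint n) (D n l)) < \<eta> / 2"
    using order_tendstoD(2)[OF D_lim, of "\<eta> / 2"] \<eta> by simp
  then show "\<forall>\<^sub>F n in sequentially. dist (\<P>(\<omega> in joint n. \<epsilon> \<le> \<bar>particles n \<omega> i - snd \<omega> i\<bar>)) 0 < \<eta>"
    using eventually_ge_at_top[of i]
  proof eventually_elim
    case (elim n)
    then show ?case using bound[of n] L(2) by simp
  qed
qed

end

section \<open>Exponential moments and convergence in mean\<close>

lemma sum_sqrt_ratio: "(\<Sum>k\<in>{1..n}. sqrt (real n / real k)) \<le> 2 * real n"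
proof -
  have "(\<Sum>k\<in>{1..m}. 1 / sqrt (real k)) \<le> 2 * sqrt (real m)" for m
  proof (induction m)
    case (Suc m)
    define a c where "a = sqrt (real m)" and "c = sqrt (real (Suc m))"
    have ac: "0 \<le> a" "0 < c" "c\<^sup>2 = a\<^sup>2 + 1" by (simp_all add: a_def c_def)
    have "2 * a * c \<le> a\<^sup>2 + c\<^sup>2" using sum_squares_bound[of a c] by simp
    then have "2 * a + 1 / c \<le> 2 * c" using ac by (simp add: field_simps power2_eq_square)
    then show ?case using Suc.IH by (simp add: a_def c_def)
  qed simp
  from mult_left_mono[OF this[of n], of "sqrt (real n)"]
  have "(\<Sum>k\<in>{1..n}. sqrt (real n / real k)) \<le> sqrt (real n) * (2 * sqrt (real n))"
    by (simp add: sum_distrib_left real_sqrt_divide)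
  also have "sqrt (real n) * (2 * sqrt (real n)) = 2 * real n" by (simp add: mult.left_commute)
  finally show ?thesis .
qed

text \<open>
  The left side is an exponential moment of a gap. The square root is what makes the product over gaps
  telescope to \<open>sqrt (n / k)\<close>, which remains bounded after averaging over \<open>k\<close>.
\<close>

lemma inverse_one_minus_quarter_le:
  assumes "1 \<le> i" "0 \<le> s" "s \<le> 1 / (4 * real i)"
  shows "1 / (1 - s) \<le> sqrt (real (Suc i) / real i)"
proof (rule real_le_rsqrt)
  define x where "x = 1 / real i"
  have x: "0 < x" "x \<le> 1" using assms by (auto simp: x_def)
  have "s \<le> x / 4" using assms by (simp add: x_def)
  then have s: "s \<le> x / 4" "s < 1" using x by linarith+
  have "1 \<le> (1 + x) * (1 - x / 4)\<^sup>2"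
  proof -
    have "(1 + x) * (1 - x / 4)\<^sup>2 - 1 = x * ((1 - x) * (8 - x) + x * 2) / 16"
      by (simp add: power2_eq_square field_simps)
    moreover have "0 \<le> x * ((1 - x) * (8 - x) + x * 2) / 16" using x by (intro divide_nonneg_pos mult_nonneg_nonneg add_nonneg_nonneg) auto
    ultimately show ?thesis by linarith
  qed
  also have "\<dots> \<le> (1 + x) * (1 - s)\<^sup>2" using s x by (intro mult_left_mono power_mono) auto
  finally have "1 / (1 - s)\<^sup>2 \<le> 1 + x" using s by (simp add: field_simps)
  moreover have "1 + x = real (Suc i) / real i" using assms by (simp add: x_def field_simps)
  ultimately show "(1 / (1 - s))\<^sup>2 \<le> real (Suc i) / real i" by (simp add: power_divide)
qed

lemma exp_sum_le: "exp (x + y) \<le> (exp (2 * x) + exp (2 * y)) / (2 :: real)"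
proof -
  have "2 * exp x * exp y \<le> (exp x)\<^sup>2 + (exp y)\<^sup>2" using sum_squares_bound[of "exp x" "exp y"] by simp
  then show ?thesis by (simp add: exp_add exp_double)
qed

lemma ennreal_tendsto_0I:
  fixes a :: "nat \<Rightarrow> ennreal"
  assumes "\<And>e. 0 < e \<Longrightarrow> \<forall>\<^sub>F n in sequentially. a n \<le> ennreal e"
  shows "a \<longlonglongrightarrow> 0"
proof (rule order_tendstoI)
  fix y :: ennreal assume "0 < y"
  then obtain e where e: "0 < e" "ennreal e < y"
    by (metis dense ennreal_0 ennreal_less_iff ennreal_cases ennreal_less_top less_le not_less_zero top.not_eq_extremum)
  show "\<forall>\<^sub>F n in sequentially. a n < y"
    using assms[OF e(1)] by eventually_elim (rule le_less_trans[OF _ e(2)])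
qed simp

context decreasing_drift
begin

abbreviation gap_sum :: "nat \<Rightarrow> (nat \<Rightarrow> real) \<Rightarrow> (nat \<Rightarrow> real) \<Rightarrow> real" where
  "gap_sum n t g \<equiv> \<Sum>j\<in>{1..<n}. t j * g j"

lemma gaps_exp_linear:
  assumes t: "\<And>j. j \<in> {1..<n} \<Longrightarrow> t j < rate n j"
  shows "(\<integral>\<^sup>+g. ennreal (exp (gap_sum n t g)) \<partial>gaps n) = ennreal (\<Prod>j\<in>{1..<n}. 1 / (1 - t j / rate n j))"
proof -
  have "(\<integral>\<^sup>+g. ennreal (exp (gap_sum n t g)) \<partial>gaps n) = (\<integral>\<^sup>+g. (\<Prod>j\<in>{1..<n}. ennreal (exp (t j * g j))) \<partial>gaps n)"
    by (simp add: exp_sum prod_ennreal)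
  also have "\<dots> = (\<Prod>j\<in>{1..<n}. \<integral>\<^sup>+x. ennreal (exp (t j * x)) \<partial>gap_law n j)"
    unfolding gaps_def
    by (rule gap_prod.product_nn_integral_prod) (simp_all add: measurable_cong_sets[OF sets_gap_law refl])
  also have "\<dots> = (\<Prod>j\<in>{1..<n}. ennreal (1 / (1 - t j / rate n j)))"
    by (intro prod.cong refl gap_law_exp_moment t)
  also have "\<dots> = ennreal (\<Prod>j\<in>{1..<n}. 1 / (1 - t j / rate n j))"
    using t rate_pos by (intro prod_ennreal) (auto simp: less_imp_le)
  finally show ?thesis .
qed

text \<open>
  By \<open>gaps_nonneg\<close>, \<open>\<bar>from_gaps n g k\<bar>\<close> is at most the sum of the gaps below rank \<open>k\<close> and of those from \<open>k\<close>
  on, with coefficients in absolute value. \<open>exp_sum_le\<close> separates the two sums at the price of doubling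
  \<open>\<theta>\<close>; with \<open>\<theta> = 1 / (8 * C)\<close> each gap then falls under \<open>inverse_one_minus_quarter_le\<close>.
\<close>

lemma quantile_exp_moment:
  assumes \<theta>: "0 < \<theta>" and C: "\<forall>v. 0 < v \<longrightarrow> v < 1 \<longrightarrow> beta v \<le> 1 / (8 * \<theta>) / (v * (1 - v))"
    and k: "1 \<le> k" "k \<le> n"
  shows "(\<integral>\<^sup>+g. ennreal (exp (\<theta> * \<bar>from_gaps n g k\<bar>)) \<partial>gaps n)
    \<le> ennreal ((sqrt (real n / real (n + 1 - k)) + sqrt (real n / real k)) / 2)"
proof -
  (* the two halves of the sum, already doubled for exp_sum_le *)
  define t1 t2 where "t1 j = (if j < k then 2 * \<theta> * \<bar>gap_coeff n k j\<bar> else 0)"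
    and "t2 j = (if k \<le> j then 2 * \<theta> * \<bar>gap_coeff n k j\<bar> else 0)" for j
  have r1: "0 \<le> t1 j / rate n j" "t1 j / rate n j \<le> 1 / (4 * real (n - j))" if j: "j \<in> {1..<n}" for j
  proof -
    show "0 \<le> t1 j / rate n j" using rate_pos[of n j] \<theta> by (simp add: t1_def)
    show "t1 j / rate n j \<le> 1 / (4 * real (n - j))"
    proof (cases "j < k")
      case True
      then have "2 * \<theta> * (\<bar>gap_coeff n k j\<bar> / rate n j) \<le> 2 * \<theta> * (1 / (8 * \<theta>) / real (n - j))"
        using gap_coeff_rate_bound(2)[OF C, of j n k] j \<theta> by (intro mult_left_mono) auto
      then show ?thesis using True \<theta> by (simp add: t1_def)
    qed (simp add: t1_def)
  qed
  have r2: "0 \<le> t2 j / rate n j" "t2 j / rate n j \<le> 1 / (4 * real j)" if j: "j \<in> {1..<n}" for j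
  proof -
    show "0 \<le> t2 j / rate n j" using rate_pos[of n j] \<theta> by (simp add: t2_def)
    show "t2 j / rate n j \<le> 1 / (4 * real j)"
    proof (cases "k \<le> j")
      case True
      then have "2 * \<theta> * (\<bar>gap_coeff n k j\<bar> / rate n j) \<le> 2 * \<theta> * (1 / (8 * \<theta>) / real j)"
        using gap_coeff_rate_bound(1)[OF C, of j n k] j \<theta> by (intro mult_left_mono) auto
      then show ?thesis using True \<theta> by (simp add: t2_def)
    qed (simp add: t2_def)
  qed
  have lt_rate: "t < rate n j" if "t / rate n j \<le> 1 / (4 * real i)" "1 \<le> i" for t i j
  proof -
    have "1 / (4 * real i) < 1" using that(2) by simp
    then have "t / rate n j < 1" using that(1) by linarith
    then show ?thesis using rate_pos[of n j] by simp
  qed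
  have lt1: "t1 j < rate n j" if "j \<in> {1..<n}" for j using lt_rate[OF r1(2)[OF that]] that by auto
  have lt2: "t2 j < rate n j" if "j \<in> {1..<n}" for j using lt_rate[OF r2(2)[OF that]] that by auto
  have "(\<Prod>j\<in>{1..<n}. 1 / (1 - t1 j / rate n j)) = (\<Prod>j\<in>{1..<k}. 1 / (1 - t1 j / rate n j))"
    using k by (intro prod.mono_neutral_right) (auto simp: t1_def)
  also have "\<dots> \<le> (\<Prod>j\<in>{1..<k}. sqrt (real (Suc (n - j)) / real (n - j)))"
  proof (intro prod_mono conjI)
    fix j assume "j \<in> {1..<k}"
    then have j: "j \<in> {1..<n}" using k by auto
    show "0 \<le> 1 / (1 - t1 j / rate n j)" using lt1[OF j] rate_pos[of n j] by simp
    show "1 / (1 - t1 j / rate n j) \<le> sqrt (real (Suc (n - j)) / real (n - j))"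
      using j by (intro inverse_one_minus_quarter_le r1) auto
  qed
  also have "\<dots> = sqrt (real n / real (n + 1 - k))"
    using k
  proof (induction k rule: dec_induct)
    case (step k)
    then have "(\<Prod>j\<in>{1..<Suc k}. sqrt (real (Suc (n - j)) / real (n - j)))
        = sqrt (real n / real (n + 1 - k)) * sqrt (real (Suc (n - k)) / real (n - k))" by simp
    also have "Suc (n - k) = n + 1 - k" using step by simp
    also have "sqrt (real n / real (n + 1 - k)) * sqrt (real (n + 1 - k) / real (n - k)) = sqrt (real n / real (n - k))"
      unfolding real_sqrt_mult[symmetric] using step by simp
    also have "n - k = n + 1 - Suc k" by simp
    finally show ?case .
  qed simp
  finally have prod1: "(\<Prod>j\<in>{1..<n}. 1 / (1 - t1 j / rate n j)) \<le> sqrt (real n / real (n + 1 - k))" .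
  have "(\<Prod>j\<in>{1..<n}. 1 / (1 - t2 j / rate n j)) = (\<Prod>j\<in>{k..<n}. 1 / (1 - t2 j / rate n j))"
    using k by (intro prod.mono_neutral_right) (auto simp: t2_def)
  also have "\<dots> \<le> (\<Prod>j\<in>{k..<n}. sqrt (real (Suc j) / real j))"
  proof (intro prod_mono conjI)
    fix j assume "j \<in> {k..<n}"
    then have j: "j \<in> {1..<n}" using k by auto
    show "0 \<le> 1 / (1 - t2 j / rate n j)" using lt2[OF j] rate_pos[of n j] by simp
    show "1 / (1 - t2 j / rate n j) \<le> sqrt (real (Suc j) / real j)"
      using j by (intro inverse_one_minus_quarter_le r2) auto
  qed
  also have "\<dots> = sqrt (real n / real k)"
    using k(2)
  proof (induction n rule: dec_induct)
    case base then show ?case using k by simp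
  next
    case (step m)
    then have "(\<Prod>j\<in>{k..<Suc m}. sqrt (real (Suc j) / real j)) = sqrt (real m / real k) * sqrt (real (Suc m) / real m)"
      by simp
    also have "\<dots> = sqrt (real (Suc m) / real k)"
      unfolding real_sqrt_mult[symmetric] using step k by simp
    finally show ?case .
  qed
  finally have prod2: "(\<Prod>j\<in>{1..<n}. 1 / (1 - t2 j / rate n j)) \<le> sqrt (real n / real k)" .
  have "(\<integral>\<^sup>+g. ennreal (exp (\<theta> * \<bar>from_gaps n g k\<bar>)) \<partial>gaps n)
      \<le> (\<integral>\<^sup>+g. ennreal (1 / 2) * (ennreal (exp (gap_sum n t1 g)) + ennreal (exp (gap_sum n t2 g))) \<partial>gaps n)"
  proof (rule nn_integral_mono_AE, use gaps_nonneg in \<open>rule AE_mp\<close>, intro AE_I2 impI)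
    fix g :: "nat \<Rightarrow> real" assume g: "\<forall>j\<in>{1..<n}. 0 \<le> g j"
    have "\<bar>from_gaps n g k\<bar> \<le> (\<Sum>j\<in>{1..<n}. \<bar>gap_coeff n k j * g j\<bar>)"
      unfolding from_gaps_def by (rule sum_abs)
    also have "\<dots> = (\<Sum>j\<in>{1..<n}. \<bar>gap_coeff n k j\<bar> * g j)" using g by (intro sum.cong refl) (simp add: abs_mult)
    finally have "\<theta> * \<bar>from_gaps n g k\<bar> \<le> \<theta> * (\<Sum>j\<in>{1..<n}. \<bar>gap_coeff n k j\<bar> * g j)" using \<theta> by simp
    also have "\<dots> = (gap_sum n t1 g) / 2 + (gap_sum n t2 g) / 2"
      unfolding sum_distrib_left sum_divide_distrib sum.distrib[symmetric]
      by (intro sum.cong refl) (auto simp: t1_def t2_def)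
    finally have "exp (\<theta> * \<bar>from_gaps n g k\<bar>) \<le> exp ((gap_sum n t1 g) / 2 + (gap_sum n t2 g) / 2)" by simp
    also have "\<dots> \<le> (exp (gap_sum n t1 g) + exp (gap_sum n t2 g)) / 2"
      using exp_sum_le[of "(gap_sum n t1 g) / 2" "(gap_sum n t2 g) / 2"] by simp
    finally have "ennreal (exp (\<theta> * \<bar>from_gaps n g k\<bar>)) \<le> ennreal (1 / 2 * (exp (gap_sum n t1 g) + exp (gap_sum n t2 g)))"
      by (intro ennreal_leI) simp
    then show "ennreal (exp (\<theta> * \<bar>from_gaps n g k\<bar>))
        \<le> ennreal (1 / 2) * (ennreal (exp (gap_sum n t1 g)) + ennreal (exp (gap_sum n t2 g)))"
      by (subst ennreal_plus[symmetric], simp, simp, subst ennreal_mult[symmetric]) (auto simp: add_nonneg_nonneg)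
  qed
  also have "\<dots> = ennreal (1 / 2) * (ennreal (\<Prod>j\<in>{1..<n}. 1 / (1 - t1 j / rate n j)) + ennreal (\<Prod>j\<in>{1..<n}. 1 / (1 - t2 j / rate n j)))"
  proof -
    have comp: "(\<lambda>g. g j) \<in> borel_measurable (gaps n)" if "j \<in> {1..<n}" for j
      using measurable_component_singleton[OF that, of "gap_law n"] by (simp add: gaps_def cong: measurable_cong_sets)
    have "(\<lambda>g. \<Sum>j\<in>{1..<n}. t j * g j) \<in> borel_measurable (gaps n)" for t
      by (intro borel_measurable_sum borel_measurable_times borel_measurable_const comp)
    note this[measurable]
    have "(\<lambda>g. ennreal (exp (gap_sum n t g))) \<in> borel_measurable (gaps n)" for t by measurable
    then show ?thesis by (simp only: nn_integral_cmult nn_integral_add borel_measurable_add gaps_exp_linear[OF lt1] gaps_exp_linear[OF lt2])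
  qed
  also have "\<dots> \<le> ennreal (1 / 2) * (ennreal (sqrt (real n / real (n + 1 - k))) + ennreal (sqrt (real n / real k)))"
    by (intro mult_left_mono add_mono ennreal_leI prod1 prod2) simp
  also have "\<dots> = ennreal ((sqrt (real n / real (n + 1 - k)) + sqrt (real n / real k)) / 2)"
    by (subst ennreal_plus[symmetric], simp, simp, subst ennreal_mult[symmetric]) (auto simp: add_nonneg_nonneg)
  finally show ?thesis .
qed

text \<open>
  A single coordinate has no simple law, but by symmetry its moment is the average over all
  coordinates, that is, the average of the moments of the order statistics.
\<close>

lemma Pn_exp_moment:
  assumes \<theta>: "0 < \<theta>" and C: "\<forall>v. 0 < v \<longrightarrow> v < 1 \<longrightarrow> beta v \<le> 1 / (8 * \<theta>) / (v * (1 - v))"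
    and i: "i \<in> {1..n}"
  shows "(\<integral>\<^sup>+z. ennreal (exp (\<theta> * \<bar>z i\<bar>)) \<partial>Pn n) \<le> 2"
proof -
  have n: "1 \<le> n" using i by simp
  define f where "f l z = ennreal (exp (\<theta> * \<bar>z l\<bar>))" for l and z :: "nat \<Rightarrow> real"
  have f: "f l \<in> borel_measurable (Rn n)" if "l \<in> {1..n}" for l
  proof -
    have "(\<lambda>z. z l) \<in> borel_measurable (Rn n)" by (rule measurable_component_singleton[OF that])
    note this[measurable]
    show ?thesis unfolding f_def[abs_def] by measurable
  qed
  define S where "S z = (\<Sum>l\<in>{1..n}. f l z)" for z
  have S: "S \<in> borel_measurable (Rn n)" unfolding S_def[abs_def] using f by (intro borel_measurable_sum)
  have S_sym: "S (permute_coords n \<pi> z) = S z" if \<pi>: "\<pi> permutes {1..n}" for \<pi> z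
  proof -
    have "S (permute_coords n \<pi> z) = (\<Sum>l\<in>{1..n}. f (\<pi> l) z)"
      unfolding S_def by (intro sum.cong refl) (simp add: f_def permute_coords_def)
    also have "\<dots> = S z" unfolding S_def using sum.permute[OF \<pi>, of "\<lambda>l. f l z"] by (simp add: comp_def)
    finally show ?thesis .
  qed
  have all_equal: "(\<integral>\<^sup>+z. f l z \<partial>Pn n) = (\<integral>\<^sup>+z. f i z \<partial>Pn n)" if l: "l \<in> {1..n}" for l
  proof -
    define \<pi> where "\<pi> = Transposition.transpose i l"
    have \<pi>: "\<pi> permutes {1..n}" unfolding \<pi>_def using i l by (rule permutes_swap_id)
    have "(\<integral>\<^sup>+z. f i z \<partial>Pn n) = (\<integral>\<^sup>+z. f i (permute_coords n \<pi> z) \<partial>Pn n)"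
      by (rule nn_integral_Pn_permute[OF n f[OF i] \<pi>, symmetric])
    also have "\<dots> = (\<integral>\<^sup>+z. f l z \<partial>Pn n)"
      using i by (simp add: f_def permute_coords_def \<pi>_def)
    finally show ?thesis ..
  qed
  have "of_nat n * (\<integral>\<^sup>+z. f i z \<partial>Pn n) = (\<Sum>l\<in>{1..n}. \<integral>\<^sup>+z. f l z \<partial>Pn n)"
    using all_equal by simp
  also have "\<dots> = (\<integral>\<^sup>+z. S z \<partial>Pn n)"
    unfolding S_def using f by (intro nn_integral_sum[symmetric]) (simp add: measurable_cong_sets[OF sets_Pn refl])
  also have "\<dots> = (\<integral>\<^sup>+g. S (gap_point n g) \<partial>gaps n)"
    by (rule nn_integral_Pn_symmetric[OF n S]) (rule S_sym)
  also have "\<dots> = (\<integral>\<^sup>+g. (\<Sum>k\<in>{1..n}. ennreal (exp (\<theta> * \<bar>from_gaps n g k\<bar>))) \<partial>gaps n)"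
    unfolding S_def by (intro nn_integral_cong sum.cong refl) (simp add: f_def gap_point_def)
  also have "\<dots> = (\<Sum>k\<in>{1..n}. \<integral>\<^sup>+g. ennreal (exp (\<theta> * \<bar>from_gaps n g k\<bar>)) \<partial>gaps n)"
    by (rule nn_integral_sum) measurable
  also have "\<dots> \<le> (\<Sum>k\<in>{1..n}. ennreal ((sqrt (real n / real (n + 1 - k)) + sqrt (real n / real k)) / 2))"
    by (intro sum_mono quantile_exp_moment[OF \<theta> C]) auto
  also have "\<dots> = ennreal (\<Sum>k\<in>{1..n}. (sqrt (real n / real (n + 1 - k)) + sqrt (real n / real k)) / 2)"
    by (intro sum_ennreal) (auto intro!: divide_nonneg_pos add_nonneg_nonneg)
  also have "\<dots> \<le> ennreal (2 * real n)"
  proof (rule ennreal_leI)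
    have "(\<Sum>k\<in>{1..n}. sqrt (real n / real (n + 1 - k))) = (\<Sum>k\<in>{1..n}. sqrt (real n / real k))"
      by (rule sum.reindex_bij_witness[where i="\<lambda>k. n + 1 - k" and j="\<lambda>k. n + 1 - k"]) auto
    then show "(\<Sum>k\<in>{1..n}. (sqrt (real n / real (n + 1 - k)) + sqrt (real n / real k)) / 2) \<le> 2 * real n"
      using sum_sqrt_ratio[of n] by (simp add: sum_divide_distrib[symmetric] sum.distrib)
  qed
  also have "\<dots> = of_nat n * 2" by (simp add: ennreal_mult ennreal_of_nat_eq_real_of_nat mult.commute)
  finally have "of_nat n * (\<integral>\<^sup>+z. f i z \<partial>Pn n) \<le> of_nat n * 2" .
  then have "(\<integral>\<^sup>+z. f i z \<partial>Pn n) \<le> 2"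
    using n by (subst (asm) ennreal_mult_le_mult_iff) auto
  then show ?thesis by (simp only: f_def)
qed

text \<open>
  This replaces uniform integrability: a power is at most a small multiple of an exponential, up to an
  additive constant that only matters where the distance is not small.
\<close>

lemma powr_le_exp:
  fixes q \<theta> \<eta> :: real
  assumes q: "1 \<le> q" and \<theta>: "0 < \<theta>" and \<eta>: "0 < \<eta>"
  obtains K where "0 \<le> K" "\<And>s. 0 \<le> s \<Longrightarrow> s powr q \<le> \<eta> * exp (\<theta> * s) + K"
proof -
  have "((\<lambda>s. s powr q / exp (\<theta> * s)) \<longlongrightarrow> 0) at_top" using q \<theta> by real_asymp
  then have "\<forall>\<^sub>F s in at_top. s powr q / exp (\<theta> * s) < \<eta>" using \<eta> by (rule order_tendstoD(2))
  then obtain S where S: "\<And>s. S \<le> s \<Longrightarrow> s powr q / exp (\<theta> * s) < \<eta>" by (auto simp: eventually_at_top_linorder)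
  have "s powr q \<le> \<eta> * exp (\<theta> * s) + \<bar>S\<bar> powr q" if s: "0 \<le> s" for s
  proof (cases "S \<le> s")
    case True
    then have "s powr q \<le> \<eta> * exp (\<theta> * s)" using S[OF True] by (simp add: field_simps)
    then show ?thesis by (simp add: add_increasing2)
  next
    case False
    then have "s powr q \<le> \<bar>S\<bar> powr q" using s q by (intro powr_mono2) auto
    then show ?thesis using \<eta> by (simp add: add_increasing)
  qed
  then show ?thesis using that[of "\<bar>S\<bar> powr q"] by simp
qed

theorem particles_in_Lq:
  assumes i: "1 \<le> i" and q: "1 \<le> q"
  shows "(\<lambda>n. \<integral>\<^sup>+\<omega>. ennreal (\<bar>particles n \<omega> i - snd \<omega> i\<bar> powr q) \<partial>joint n) \<longlonglongrightarrow> 0"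
proof -
  obtain \<theta> M where \<theta>: "0 < \<theta>" and M: "(\<integral>\<^sup>+x. ennreal (exp (\<theta> * \<bar>x\<bar>)) \<partial>P) \<le> ennreal M"
    and C: "\<forall>v. 0 < v \<longrightarrow> v < 1 \<longrightarrow> beta v \<le> 1 / (8 * \<theta>) / (v * (1 - v))"
    using P_exp_moment .
  define A where "A = 2 + \<bar>M\<bar>"
  have A: "0 < A" by (simp add: A_def)
  have exp_bound: "(\<integral>\<^sup>+\<omega>. ennreal (exp (\<theta> / 2 * \<bar>particles n \<omega> i - snd \<omega> i\<bar>)) \<partial>joint n) \<le> ennreal A" if n: "i \<le> n" for n
  proof -
    have in_n: "i \<in> {1..n}" using i n by simp
    then have n1: "1 \<le> n" by simp
    note particle_measurable[OF in_n, measurable]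
    have comp_z: "(\<lambda>z. z i) \<in> borel_measurable (Rn n)" by (rule measurable_component_singleton[OF in_n])
    have comp_x: "(\<lambda>x. x i) \<in> measurable (samples n) P"
      using samples_component[OF in_n] by (simp cong: measurable_cong_sets)
    have "(\<integral>\<^sup>+\<omega>. ennreal (exp (\<theta> / 2 * \<bar>particles n \<omega> i - snd \<omega> i\<bar>)) \<partial>joint n)
        \<le> (\<integral>\<^sup>+\<omega>. ennreal (exp (\<theta> * \<bar>particles n \<omega> i\<bar>)) + ennreal (exp (\<theta> * \<bar>snd \<omega> i\<bar>)) \<partial>joint n)"
    proof (rule nn_integral_mono)
      fix \<omega>
      let ?z = "particles n \<omega> i" and ?x = "snd \<omega> i"
      have "\<theta> / 2 * \<bar>?z - ?x\<bar> \<le> \<theta> / 2 * (\<bar>?z\<bar> + \<bar>?x\<bar>)" using \<theta> by (intro mult_left_mono) auto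
      then have "exp (\<theta> / 2 * \<bar>?z - ?x\<bar>) \<le> exp (\<theta> / 2 * \<bar>?z\<bar> + \<theta> / 2 * \<bar>?x\<bar>)" by (simp add: distrib_left)
      also have "\<dots> \<le> (exp (\<theta> * \<bar>?z\<bar>) + exp (\<theta> * \<bar>?x\<bar>)) / 2"
        using exp_sum_le[of "\<theta> / 2 * \<bar>?z\<bar>" "\<theta> / 2 * \<bar>?x\<bar>"] by simp
      also have "\<dots> \<le> exp (\<theta> * \<bar>?z\<bar>) + exp (\<theta> * \<bar>?x\<bar>)" by (simp add: field_simps add_nonneg_nonneg)
      finally show "ennreal (exp (\<theta> / 2 * \<bar>?z - ?x\<bar>)) \<le> ennreal (exp (\<theta> * \<bar>?z\<bar>)) + ennreal (exp (\<theta> * \<bar>?x\<bar>))"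
        by (simp add: ennreal_leI flip: ennreal_plus)
    qed
    also have "\<dots> = (\<integral>\<^sup>+\<omega>. ennreal (exp (\<theta> * \<bar>particles n \<omega> i\<bar>)) \<partial>joint n) + (\<integral>\<^sup>+\<omega>. ennreal (exp (\<theta> * \<bar>snd \<omega> i\<bar>)) \<partial>joint n)"
      by (rule nn_integral_add) measurable
    also have "(\<integral>\<^sup>+\<omega>. ennreal (exp (\<theta> * \<bar>particles n \<omega> i\<bar>)) \<partial>joint n) = (\<integral>\<^sup>+z. ennreal (exp (\<theta> * \<bar>z i\<bar>)) \<partial>Pn n)"
      unfolding law_of_particles[OF n1, symmetric]
    proof (rule nn_integral_distr[symmetric, OF particles_measurable])
      have "(\<lambda>z. ennreal (exp (\<theta> * \<bar>z i\<bar>))) \<in> borel_measurable (Rn n)"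
        by (rule measurable_compose[OF comp_z]) measurable
      then show "(\<lambda>z. ennreal (exp (\<theta> * \<bar>z i\<bar>))) \<in> borel_measurable (distr (joint n) (Rn n) (particles n))" by simp
    qed
    also have "(\<integral>\<^sup>+\<omega>. ennreal (exp (\<theta> * \<bar>snd \<omega> i\<bar>)) \<partial>joint n) = (\<integral>\<^sup>+x. ennreal (exp (\<theta> * \<bar>x\<bar>)) \<partial>P)"
    proof -
      have "(\<integral>\<^sup>+x. ennreal (exp (\<theta> * \<bar>x\<bar>)) \<partial>P) = (\<integral>\<^sup>+x. ennreal (exp (\<theta> * \<bar>x\<bar>)) \<partial>distr (samples n) P (\<lambda>x. x i))"
        unfolding samples_def by (simp only: distr_PiM_component[OF P.prob_space_axioms in_n])
      also have "\<dots> = (\<integral>\<^sup>+x. ennreal (exp (\<theta> * \<bar>x i\<bar>)) \<partial>samples n)"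
      proof (rule nn_integral_distr[OF comp_x])
        have "(\<lambda>x. ennreal (exp (\<theta> * \<bar>x\<bar>))) \<in> borel_measurable (borel :: real measure)" by measurable
        then show "(\<lambda>x. ennreal (exp (\<theta> * \<bar>x\<bar>))) \<in> borel_measurable (distr (samples n) P (\<lambda>x. x i))"
          by (simp cong: measurable_cong_sets)
      qed
      also have "\<dots> = (\<integral>\<^sup>+x. ennreal (exp (\<theta> * \<bar>x i\<bar>)) \<partial>distr (joint n) (samples n) snd)"
        by (simp only: distr_joint_snd)
      also have "\<dots> = (\<integral>\<^sup>+\<omega>. ennreal (exp (\<theta> * \<bar>snd \<omega> i\<bar>)) \<partial>joint n)"
      proof (rule nn_integral_distr[OF joint_measurable(2)])
        have "(\<lambda>x. ennreal (exp (\<theta> * \<bar>x i\<bar>))) \<in> borel_measurable (samples n)"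
          by (rule measurable_compose[OF samples_component[OF in_n]]) measurable
        then show "(\<lambda>x. ennreal (exp (\<theta> * \<bar>x i\<bar>))) \<in> borel_measurable (distr (joint n) (samples n) snd)" by simp
      qed
      finally show ?thesis ..
    qed
    also have "(\<integral>\<^sup>+z. ennreal (exp (\<theta> * \<bar>z i\<bar>)) \<partial>Pn n) + (\<integral>\<^sup>+x. ennreal (exp (\<theta> * \<bar>x\<bar>)) \<partial>P) \<le> ennreal 2 + ennreal \<bar>M\<bar>"
      using Pn_exp_moment[OF \<theta> C in_n] M by (intro add_mono) (auto intro: order_trans ennreal_leI)
    also have "\<dots> = ennreal A" unfolding A_def by (rule ennreal_plus[symmetric]) auto
    finally show ?thesis .
  qed
  show ?thesis
  proof (rule ennreal_tendsto_0I)
    fix e :: real assume e: "0 < e"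
    (* each of the three contributions is made at most e / 3 *)
    define \<epsilon> where "\<epsilon> = (e / 3) powr (1 / q)"
    have \<epsilon>: "0 < \<epsilon>" "\<epsilon> powr q = e / 3" using e q by (simp_all add: \<epsilon>_def powr_powr)
    define \<eta> where "\<eta> = e / (3 * A)"
    have \<eta>: "0 < \<eta>" "\<eta> * A = e / 3" using e A by (simp_all add: \<eta>_def)
    obtain K where K: "0 \<le> K" "\<And>s. 0 \<le> s \<Longrightarrow> s powr q \<le> \<eta> * exp (\<theta> / 2 * s) + K"
      using powr_le_exp[OF q half_gt_zero[OF \<theta>] \<eta>(1)] by blast
    define p where "p n = \<P>(\<omega> in joint n. \<epsilon> \<le> \<bar>particles n \<omega> i - snd \<omega> i\<bar>)" for n
    have "p \<longlonglongrightarrow> 0" unfolding p_def by (rule particles_in_probability[OF i \<epsilon>(1)])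
    then have "(\<lambda>n. K * p n) \<longlonglongrightarrow> K * 0" by (rule tendsto_mult_left)
    then have "\<forall>\<^sub>F n in sequentially. K * p n < e / 3" using e by (intro order_tendstoD(2)) auto
    then show "\<forall>\<^sub>F n in sequentially. (\<integral>\<^sup>+\<omega>. ennreal (\<bar>particles n \<omega> i - snd \<omega> i\<bar> powr q) \<partial>joint n) \<le> ennreal e"
      using eventually_ge_at_top[of i]
    proof eventually_elim
      case (elim n)
      have in_n: "i \<in> {1..n}" using i elim by simp
      note particle_measurable[OF in_n, measurable]
      define D where "D \<omega> = \<bar>particles n \<omega> i - snd \<omega> i\<bar>" for \<omega>
      have D [measurable]: "D \<in> borel_measurable (joint n)" unfolding D_def[abs_def] by measurable
      define T where "T = {\<omega> \<in> space (joint n). \<epsilon> \<le> D \<omega>}"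
      have T [measurable]: "T \<in> sets (joint n)" unfolding T_def by measurable
      have "(\<integral>\<^sup>+\<omega>. ennreal (D \<omega> powr q) \<partial>joint n)
          \<le> (\<integral>\<^sup>+\<omega>. ennreal (e / 3) + (ennreal \<eta> * ennreal (exp (\<theta> / 2 * D \<omega>)) + ennreal K * indicator T \<omega>) \<partial>joint n)"
      proof (rule nn_integral_mono)
        fix \<omega> assume \<omega>: "\<omega> \<in> space (joint n)"
        have D0: "0 \<le> D \<omega>" by (simp add: D_def)
        have "D \<omega> powr q \<le> e / 3 + (\<eta> * exp (\<theta> / 2 * D \<omega>) + K * indicator T \<omega>)"
        proof (cases "\<omega> \<in> T")
          case True
          then show ?thesis using K(2)[OF D0] e by simp
        next
          case False
          then have "D \<omega> powr q \<le> \<epsilon> powr q" using \<omega> q D0 by (intro powr_mono2) (auto simp: T_def)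
          then show ?thesis using False \<eta>(1) unfolding \<epsilon>(2) by (simp add: add_increasing2)
        qed
        then have "ennreal (D \<omega> powr q) \<le> ennreal (e / 3 + (\<eta> * exp (\<theta> / 2 * D \<omega>) + K * indicator T \<omega>))" by (rule ennreal_leI)
        also have "\<dots> = ennreal (e / 3) + (ennreal \<eta> * ennreal (exp (\<theta> / 2 * D \<omega>)) + ennreal K * indicator T \<omega>)"
          using e \<eta>(1) K(1) by (simp add: ennreal_plus ennreal_mult ennreal_indicator[symmetric] add_nonneg_nonneg)
        finally show "ennreal (D \<omega> powr q) \<le> \<dots>" .
      qed
      also have "\<dots> = ennreal (e / 3) + (ennreal \<eta> * (\<integral>\<^sup>+\<omega>. ennreal (exp (\<theta> / 2 * D \<omega>)) \<partial>joint n) + ennreal K * emeasure (joint n) T)"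
        by (simp add: nn_integral_add nn_integral_cmult joint.emeasure_space_1)
      also have "\<dots> \<le> ennreal (e / 3) + (ennreal \<eta> * ennreal A + ennreal K * ennreal (p n))"
        using exp_bound[of n] elim(2)
        by (intro add_mono mult_left_mono) (auto simp: D_def T_def p_def joint.emeasure_eq_measure)
      also have "\<dots> = ennreal (e / 3 + (e / 3 + K * p n))"
        using e \<eta> A K(1) by (simp add: ennreal_mult[symmetric] ennreal_plus[symmetric] p_def del: ennreal_plus)
      also have "\<dots> \<le> ennreal e" using elim(1) by (intro ennreal_leI) simp
      finally show ?case by (simp add: D_def)
    qed
  qed
qed

end

section \<open>Weak convergence and Wasserstein distances\<close>

text \<open>
  Extending a test function by restriction of its argument turns it into a continuous function on the
  type \<open>nat \<Rightarrow> real\<close>, for which compactness, measurability and a metric are at hand.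
\<close>

lemma weak_test_function_extension:
  fixes f :: "(nat \<Rightarrow> real) \<Rightarrow> real"
  assumes "continuous_map (product_topology (\<lambda>_. euclidean) {1..k}) euclidean f"
  shows "continuous_on UNIV (\<lambda>x. f (restrict x {1..k}))"
proof -
  have "continuous_map (product_topology (\<lambda>_. euclidean) UNIV) (product_topology (\<lambda>_. euclidean) {1..k}) (\<lambda>x::nat\<Rightarrow>real. restrict x {1..k})"
    by (intro continuous_map_coordinatewise_then_product) (auto intro: continuous_map_product_projection)
  from continuous_map_compose[OF this assms]
  have "continuous_map euclidean euclidean (\<lambda>x::nat\<Rightarrow>real. f (restrict x {1..k}))"
    by (simp add: comp_def euclidean_product_topology)
  then show ?thesis by simp
qed

lemma weak_test_function_measurable:
  fixes f :: "(nat \<Rightarrow> real) \<Rightarrow> real"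
  assumes "continuous_map (product_topology (\<lambda>_. euclidean) {1..k}) euclidean f"
  shows "f \<in> borel_measurable (Rn k)"
proof -
  have g: "(\<lambda>x. f (restrict x {1..k})) \<in> borel_measurable (Pi\<^sub>M UNIV (\<lambda>_. borel))"
    using borel_measurable_continuous_onI[OF weak_test_function_extension[OF assms]]
    by (simp add: measurable_cong_sets[OF sets_PiM_equal_borel refl])
  have "(\<lambda>x. x) \<in> measurable (Rn k) (Pi\<^sub>M UNIV (\<lambda>_. borel :: real measure))"
  proof (rule measurable_PiM_single')
    fix i :: nat
    show "(\<lambda>x. x i) \<in> borel_measurable (Rn k)"
    proof (cases "i \<in> {1..k}")
      case False
      then have "x i = undefined" if "x \<in> space (Rn k)" for x
        using that by (auto simp: space_PiM PiE_def extensional_def)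
      then show ?thesis by (subst measurable_cong[where g="\<lambda>_. undefined"]) auto
    qed (rule measurable_component_singleton)
  qed simp
  from measurable_compose[OF this g]
  have "(\<lambda>x. f (restrict x {1..k})) \<in> borel_measurable (Rn k)" .
  moreover have "restrict x {1..k} = x" if "x \<in> space (Rn k)" for x
    using that by (auto simp: space_PiM PiE_restrict)
  ultimately show ?thesis by (subst measurable_cong[where g="\<lambda>x. f (restrict x {1..k})"]) auto
qed

text \<open>
  Only \<open>y\<close> is confined to the box; this suits a coupling in which the second law is fixed and the first
  one varies with \<open>n\<close>.
\<close>

lemma uniform_continuity_on_boxes:
  fixes f :: "(nat \<Rightarrow> real) \<Rightarrow> real"
  assumes f: "continuous_map (product_topology (\<lambda>_. euclidean) {1..k}) euclidean f" and e: "0 < e"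
  obtains \<delta> where "0 < \<delta>"
    "\<forall>x\<in>{1..k} \<rightarrow>\<^sub>E UNIV. \<forall>y\<in>{1..k} \<rightarrow>\<^sub>E UNIV. (\<forall>i\<in>{1..k}. \<bar>y i\<bar> \<le> L) \<longrightarrow>
      (\<forall>i\<in>{1..k}. \<bar>x i - y i\<bar> < \<delta>) \<longrightarrow> \<bar>f x - f y\<bar> < e"
proof -
  define g where "g x = f (restrict x {1..k})" for x
  define K where "K = (\<Pi>\<^sub>E i\<in>UNIV. if i \<in> {1..k} then {- (L + 1)..L + 1} else {0::real})"
  have "compact K"
  proof -
    have "compactin (product_topology (\<lambda>_. euclidean) UNIV) K"
      unfolding K_def compactin_PiE by (auto simp: compactin_euclidean_iff)
    then show ?thesis by (simp add: euclidean_product_topology)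
  qed
  then have "uniformly_continuous_on K g"
    using continuous_on_subset[OF weak_test_function_extension[OF f]] unfolding g_def[abs_def]
    by (intro compact_uniformly_continuous) auto
  then obtain d where d: "0 < d" "\<And>x y. x \<in> K \<Longrightarrow> y \<in> K \<Longrightarrow> dist y x < d \<Longrightarrow> dist (g y) (g x) < e"
    using e unfolding uniformly_continuous_on_def by meson
  obtain N where N: "(1 / 2) ^ N < d / 2" using real_arch_pow_inv[of "d / 2" "1 / 2"] d(1) by auto
  define \<delta> where "\<delta> = min 1 (d / 4)"
  have \<delta>: "0 < \<delta>" "\<delta> \<le> 1" "\<delta> \<le> d / 4" using d(1) by (auto simp: \<delta>_def)
  have "\<bar>f x - f y\<bar> < e" if x: "x \<in> {1..k} \<rightarrow>\<^sub>E UNIV" and y: "y \<in> {1..k} \<rightarrow>\<^sub>E UNIV"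
    and yL: "\<forall>i\<in>{1..k}. \<bar>y i\<bar> \<le> L" and xy: "\<forall>i\<in>{1..k}. \<bar>x i - y i\<bar> < \<delta>" for x y
  proof -
    define x' y' where "x' i = (if i \<in> {1..k} then x i else 0)" and "y' i = (if i \<in> {1..k} then y i else 0)" for i
    have "y' \<in> K"
    proof -
      have "- L - 1 \<le> y i \<and> y i \<le> L + 1" if "i \<in> {1..k}" for i using bspec[OF yL that] by linarith
      then show ?thesis by (auto simp: K_def y'_def)
    qed
    moreover have "x' \<in> K"
    proof -
      have "- L - 1 \<le> x i \<and> x i \<le> L + 1" if "i \<in> {1..k}" for i
        using bspec[OF yL that] bspec[OF xy that] \<delta>(2) by linarith
      then show ?thesis by (auto simp: K_def x'_def)
    qed
    moreover have "dist x' y' < d"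
    proof -
      have "dist (x' i) (y' i) < \<delta>" for i using xy \<delta>(1) by (auto simp: x'_def y'_def dist_real_def)
      then have "Max {dist (x' (from_nat n)) (y' (from_nat n)) |n. n \<le> N} < \<delta>"
        by (subst Max_less_iff) auto
      then show ?thesis using dist_fun_le_dist_first_terms[of x' y' N] N \<delta>(3) by linarith
    qed
    ultimately have "dist (g x') (g y') < e" using d(2) by blast
    moreover have "restrict x' {1..k} = x" "restrict y' {1..k} = y"
      using x y by (auto simp: x'_def y'_def fun_eq_iff PiE_def extensional_def)
    ultimately show ?thesis by (simp add: g_def dist_real_def)
  qed
  then show ?thesis using that[OF \<delta>(1)] by blast
qed

context decreasing_drift
begin

definition coupled :: "nat \<Rightarrow> nat \<Rightarrow> (nat \<Rightarrow> real) \<times> (nat \<Rightarrow> real) \<Rightarrow> (nat \<Rightarrow> real) \<times> (nat \<Rightarrow> real)" where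
  "coupled k n \<omega> = (restrict (particles n \<omega>) {1..k}, restrict (snd \<omega>) {1..k})"

lemma restrict_measurable: "k \<le> n \<Longrightarrow> (\<lambda>x. restrict x {1..k}) \<in> measurable (Rn n) (Rn k)"
  by (rule measurable_restrict_subset) auto

lemma coupled_components:
  assumes "k \<le> n"
  shows "(\<lambda>\<omega>. restrict (particles n \<omega>) {1..k}) \<in> measurable (joint n) (Rn k)"
    and "(\<lambda>\<omega>. restrict (snd \<omega>) {1..k}) \<in> measurable (joint n) (Rn k)"
proof -
  show "(\<lambda>\<omega>. restrict (particles n \<omega>) {1..k}) \<in> measurable (joint n) (Rn k)"
    by (rule measurable_compose[OF particles_measurable restrict_measurable[OF assms]])
  have "(\<lambda>x. restrict x {1..k}) \<in> measurable (samples n) (Rn k)"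
    using restrict_measurable[OF assms] by (simp add: measurable_cong_sets[OF sets_samples refl])
  then show "(\<lambda>\<omega>. restrict (snd \<omega>) {1..k}) \<in> measurable (joint n) (Rn k)"
    by (rule measurable_compose[OF joint_measurable(2)])
qed

lemma particles_marginal:
  assumes k: "k \<le> n" and n: "1 \<le> n"
  shows "distr (joint n) (Rn k) (\<lambda>\<omega>. restrict (particles n \<omega>) {1..k}) = marginal k (Pn n)"
  unfolding marginal_def law_of_particles[OF n, symmetric]
  by (simp add: distr_distr[OF restrict_measurable[OF k] particles_measurable] comp_def)

lemma samples_marginal:
  assumes k: "k \<le> n"
  shows "distr (joint n) (Rn k) (\<lambda>\<omega>. restrict (snd \<omega>) {1..k}) = Pi\<^sub>M {1..k} (\<lambda>_. P)"
proof -
  have m: "(\<lambda>x. restrict x {1..k}) \<in> measurable (samples n) (Rn k)"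
    using restrict_measurable[OF k] by (simp add: measurable_cong_sets[OF sets_samples refl])
  have "distr (joint n) (Rn k) (\<lambda>\<omega>. restrict (snd \<omega>) {1..k}) = distr (distr (joint n) (samples n) snd) (Rn k) (\<lambda>x. restrict x {1..k})"
    by (simp add: distr_distr[OF m joint_measurable(2)] comp_def)
  also have "\<dots> = distr (samples n) (Pi\<^sub>M {1..k} (\<lambda>_. P)) (\<lambda>x. restrict x {1..k})"
    unfolding distr_joint_snd using sets_samples[of k] by (intro distr_cong) (auto simp: samples_def)
  also have "\<dots> = Pi\<^sub>M {1..k} (\<lambda>_. P)"
    unfolding samples_def using k by (intro sample_prod.distr_restrict[symmetric]) auto
  finally show ?thesis .
qed

lemma coupled_coupling:
  assumes k: "k \<le> n" and n: "1 \<le> n"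
  shows "distr (joint n) (Rn k \<Otimes>\<^sub>M Rn k) (coupled k n) \<in> couplings k (marginal k (Pn n)) (Pi\<^sub>M {1..k} (\<lambda>_. P))"
proof -
  have m: "coupled k n \<in> measurable (joint n) (Rn k \<Otimes>\<^sub>M Rn k)"
    unfolding coupled_def[abs_def] by (intro measurable_Pair coupled_components k)
  have "distr (distr (joint n) (Rn k \<Otimes>\<^sub>M Rn k) (coupled k n)) (Rn k) fst = marginal k (Pn n)"
    by (simp add: distr_distr[OF measurable_fst m] comp_def particles_marginal[OF k n, symmetric] coupled_def)
  moreover have "distr (distr (joint n) (Rn k \<Otimes>\<^sub>M Rn k) (coupled k n)) (Rn k) snd = Pi\<^sub>M {1..k} (\<lambda>_. P)"
    by (simp add: distr_distr[OF measurable_snd m] comp_def samples_marginal[OF k, symmetric] coupled_def)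
  ultimately show ?thesis
    unfolding couplings_def using joint.prob_space_distr[OF m] by simp
qed

lemma coupled_cost_tendsto:
  assumes q: "1 \<le> q"
  shows "(\<lambda>n. \<Sum>i\<in>{1..k}. \<integral>\<^sup>+\<omega>. ennreal (\<bar>particles n \<omega> i - snd \<omega> i\<bar> powr q) \<partial>joint n) \<longlonglongrightarrow> 0"
  using tendsto_sum[of "{1..k}" "\<lambda>i n. \<integral>\<^sup>+\<omega>. ennreal (\<bar>particles n \<omega> i - snd \<omega> i\<bar> powr q) \<partial>joint n" "\<lambda>_. 0" sequentially]
    particles_in_Lq[OF _ q] by simp

lemma wasserstein_le:
  assumes k: "k \<le> n" and n: "1 \<le> n" and q: "1 \<le> q"
  shows "wasserstein q k (marginal k (Pn n)) (Pi\<^sub>M {1..k} (\<lambda>_. P))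
    \<le> ennreal_powr (\<Sum>i\<in>{1..k}. \<integral>\<^sup>+\<omega>. ennreal (\<bar>particles n \<omega> i - snd \<omega> i\<bar> powr q) \<partial>joint n) (1 / q)"
proof -
  have m: "coupled k n \<in> measurable (joint n) (Rn k \<Otimes>\<^sub>M Rn k)"
    unfolding coupled_def[abs_def] by (intro measurable_Pair coupled_components k)
  have norm: "ennreal (lq_norm q k (\<lambda>i. x i - y i) powr q) = (\<Sum>i\<in>{1..k}. ennreal (\<bar>x i - y i\<bar> powr q))" for x y
    using q by (simp add: lq_norm_def powr_powr sum_nonneg sum_ennreal)
  have cost_meas: "(\<lambda>\<omega>. ennreal (lq_norm q k (\<lambda>i. fst \<omega> i - snd \<omega> i) powr q)) \<in> borel_measurable (Rn k \<Otimes>\<^sub>M Rn k)"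
    unfolding norm
  proof (intro borel_measurable_sum)
    fix i assume i: "i \<in> {1..k}"
    have "(\<lambda>\<omega>. fst \<omega> i) \<in> borel_measurable (Rn k \<Otimes>\<^sub>M Rn k)" "(\<lambda>\<omega>. snd \<omega> i) \<in> borel_measurable (Rn k \<Otimes>\<^sub>M Rn k)"
      by (rule measurable_compose[OF measurable_fst measurable_component_singleton[OF i]],
          rule measurable_compose[OF measurable_snd measurable_component_singleton[OF i]])
    note this[measurable]
    show "(\<lambda>\<omega>. ennreal (\<bar>fst \<omega> i - snd \<omega> i\<bar> powr q)) \<in> borel_measurable (Rn k \<Otimes>\<^sub>M Rn k)" by measurable
  qed
  have "(\<integral>\<^sup>+(x, y). ennreal (lq_norm q k (\<lambda>i. x i - y i) powr q) \<partial>distr (joint n) (Rn k \<Otimes>\<^sub>M Rn k) (coupled k n))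
      = (\<integral>\<^sup>+\<omega>. ennreal (lq_norm q k (\<lambda>i. fst (coupled k n \<omega>) i - snd (coupled k n \<omega>) i) powr q) \<partial>joint n)"
    using cost_meas by (simp add: split_beta' nn_integral_distr[OF m])
  also have "\<dots> = (\<integral>\<^sup>+\<omega>. (\<Sum>i\<in>{1..k}. ennreal (\<bar>particles n \<omega> i - snd \<omega> i\<bar> powr q)) \<partial>joint n)"
    unfolding norm by (intro nn_integral_cong sum.cong refl) (simp add: coupled_def)
  also have "\<dots> = (\<Sum>i\<in>{1..k}. \<integral>\<^sup>+\<omega>. ennreal (\<bar>particles n \<omega> i - snd \<omega> i\<bar> powr q) \<partial>joint n)"
  proof (rule nn_integral_sum)
    fix i assume "i \<in> {1..k}"
    then have "i \<in> {1..n}" using k by auto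
    note particle_measurable[OF this, measurable]
    show "(\<lambda>\<omega>. ennreal (\<bar>particles n \<omega> i - snd \<omega> i\<bar> powr q)) \<in> borel_measurable (joint n)" by measurable
  qed
  finally show ?thesis
    unfolding wasserstein_def by (intro INF_lower2[OF coupled_coupling[OF k n]]) simp
qed

lemma ennreal_powr_tendsto_0:
  assumes q: "1 \<le> q" and a: "a \<longlonglongrightarrow> 0"
  shows "(\<lambda>n. ennreal_powr (a n) (1 / q)) \<longlonglongrightarrow> 0"
proof (rule ennreal_tendsto_0I)
  fix e :: real assume e: "0 < e"
  have "\<forall>\<^sub>F n in sequentially. a n < ennreal (e powr q)" using a e by (intro order_tendstoD(2)) auto
  then show "\<forall>\<^sub>F n in sequentially. ennreal_powr (a n) (1 / q) \<le> ennreal e"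
  proof eventually_elim
    case (elim n)
    then have fin: "a n \<noteq> \<top>" by auto
    have "enn2real (a n) \<le> e powr q" using elim by (intro enn2real_leI) auto
    then have "enn2real (a n) powr (1 / q) \<le> (e powr q) powr (1 / q)" using q by (intro powr_mono2) auto
    also have "\<dots> = e" using q e by (simp add: powr_powr)
    finally show ?case using fin by (simp add: ennreal_powr_def ennreal_leI)
  qed
qed

theorem wasserstein_tendsto_0:
  assumes q: "1 \<le> q"
  shows "(\<lambda>n. wasserstein q k (marginal k (Pn n)) (Pi\<^sub>M {1..k} (\<lambda>_. P))) \<longlonglongrightarrow> 0"
proof (rule tendsto_sandwich[OF _ _ tendsto_const ennreal_powr_tendsto_0[OF q coupled_cost_tendsto[OF q, of k]]])
  show "\<forall>\<^sub>F n in sequentially. wasserstein q k (marginal k (Pn n)) (Pi\<^sub>M {1..k} (\<lambda>_. P))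
      \<le> ennreal_powr (\<Sum>i\<in>{1..k}. \<integral>\<^sup>+\<omega>. ennreal (\<bar>particles n \<omega> i - snd \<omega> i\<bar> powr q) \<partial>joint n) (1 / q)"
    using eventually_ge_at_top[of "max 1 k"] by eventually_elim (intro wasserstein_le q; simp)
qed simp

text \<open>
  Outside of the events that some particle is not close to its sample point or that some sample point
  leaves \<open>[- L, L]\<close>, the two values of the test function are close by uniform continuity.
\<close>

theorem weak_convergence:
  "weak_conv_Rn k (\<lambda>n. marginal k (Pn n)) (Pi\<^sub>M {1..k} (\<lambda>_. P))"
  unfolding weak_conv_Rn_def
proof (intro allI impI)
  fix f :: "(nat \<Rightarrow> real) \<Rightarrow> real"
  assume f: "continuous_map (product_topology (\<lambda>_. euclidean) {1..k}) euclidean f"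
    and bdd: "bounded (f ` ({1..k} \<rightarrow>\<^sub>E UNIV))"
  obtain c where c: "0 < c" "\<And>x. x \<in> {1..k} \<rightarrow>\<^sub>E UNIV \<Longrightarrow> \<bar>f x\<bar> \<le> c"
    using bdd unfolding bounded_pos by auto
  have f_meas: "f \<in> borel_measurable (Rn k)" by (rule weak_test_function_measurable[OF f])
  have in_ext: "restrict x {1..k} \<in> {1..k} \<rightarrow>\<^sub>E UNIV" for x :: "nat \<Rightarrow> real" by auto
  show "(\<lambda>n. \<integral>x. f x \<partial>marginal k (Pn n)) \<longlonglongrightarrow> (\<integral>x. f x \<partial>Pi\<^sub>M {1..k} (\<lambda>_. P))"
  proof (rule tendstoI)
    fix e :: real assume e: "0 < e"
    (* chosen so that the k tail events, each weighted by 2 * c, contribute at most e / 2 *)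
    define \<eta> where "\<eta> = e / (4 * c * (real k + 1))"
    have \<eta>: "0 < \<eta>" using e c(1) by (simp add: \<eta>_def)
    obtain L where L: "0 < L" "measure P {x. L \<le> \<bar>x\<bar>} < \<eta>" using P_tail_small[OF \<eta>] .
    have "0 < e / 4" using e by simp
    from uniform_continuity_on_boxes[OF f this, of L]
    obtain \<delta> where \<delta>: "0 < \<delta>"
      "\<forall>x\<in>{1..k} \<rightarrow>\<^sub>E UNIV. \<forall>y\<in>{1..k} \<rightarrow>\<^sub>E UNIV. (\<forall>i\<in>{1..k}. \<bar>y i\<bar> \<le> L) \<longrightarrow>
        (\<forall>i\<in>{1..k}. \<bar>x i - y i\<bar> < \<delta>) \<longrightarrow> \<bar>f x - f y\<bar> < e / 4" .
    define p where "p n i = \<P>(\<omega> in joint n. \<delta> \<le> \<bar>particles n \<omega> i - snd \<omega> i\<bar>)" for n i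
    have "(\<lambda>n. \<Sum>i\<in>{1..k}. p n i) \<longlonglongrightarrow> (\<Sum>i\<in>{1..k}. 0)"
      unfolding p_def using \<delta>(1) by (intro tendsto_sum particles_in_probability) auto
    then have "\<forall>\<^sub>F n in sequentially. (\<Sum>i\<in>{1..k}. p n i) < e / (8 * c)"
      using e c(1) by (intro order_tendstoD(2)) auto
    then show "\<forall>\<^sub>F n in sequentially. dist (\<integral>x. f x \<partial>marginal k (Pn n)) (\<integral>x. f x \<partial>Pi\<^sub>M {1..k} (\<lambda>_. P)) < e"
      using eventually_ge_at_top[of "max 1 k"]
    proof eventually_elim
      case (elim n)
      then have k: "k \<le> n" and n: "1 \<le> n" by auto
      define Z X where "Z \<omega> = restrict (particles n \<omega>) {1..k}" and "X \<omega> = restrict (snd \<omega>) {1..k}"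
        for \<omega> :: "(nat \<Rightarrow> real) \<times> (nat \<Rightarrow> real)"
      have Zm: "Z \<in> measurable (joint n) (Rn k)" and Xm: "X \<in> measurable (joint n) (Rn k)"
        unfolding Z_def[abs_def] X_def[abs_def] by (rule coupled_components[OF k])+
      have fZ: "(\<lambda>\<omega>. f (Z \<omega>)) \<in> borel_measurable (joint n)" and fX: "(\<lambda>\<omega>. f (X \<omega>)) \<in> borel_measurable (joint n)"
        by (rule measurable_compose[OF Zm f_meas], rule measurable_compose[OF Xm f_meas])
      have fb: "\<bar>f (Z \<omega>)\<bar> \<le> c" "\<bar>f (X \<omega>)\<bar> \<le> c" for \<omega> unfolding Z_def X_def by (intro c(2) in_ext)+
      have int: "integrable (joint n) (\<lambda>\<omega>. f (Z \<omega>))" "integrable (joint n) (\<lambda>\<omega>. f (X \<omega>))"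
        using fb fZ fX by (auto intro!: joint.integrable_const_bound[where B=c] AE_I2)
      have 1: "(\<integral>x. f x \<partial>marginal k (Pn n)) = (\<integral>\<omega>. f (Z \<omega>) \<partial>joint n)"
        unfolding particles_marginal[OF k n, symmetric] Z_def[symmetric] by (rule integral_distr[OF Zm f_meas])
      have 2: "(\<integral>x. f x \<partial>Pi\<^sub>M {1..k} (\<lambda>_. P)) = (\<integral>\<omega>. f (X \<omega>) \<partial>joint n)"
        unfolding samples_marginal[OF k, symmetric] X_def[symmetric] by (rule integral_distr[OF Xm f_meas])
      define S T where "S i = {\<omega> \<in> space (joint n). \<delta> \<le> \<bar>particles n \<omega> i - snd \<omega> i\<bar>}"
        and "T i = {\<omega> \<in> space (joint n). snd \<omega> i \<in> {x. L \<le> \<bar>x\<bar>}}" for i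
      have ST_sets: "S i \<in> sets (joint n)" "T i \<in> sets (joint n)" if "i \<in> {1..k}" for i
      proof -
        have "i \<in> {1..n}" using that k by auto
        note particle_measurable[OF this, measurable]
        show "S i \<in> sets (joint n)" "T i \<in> sets (joint n)" unfolding S_def T_def by measurable
      qed
      have T_measure: "measure (joint n) (T i) = measure P {x. L \<le> \<bar>x\<bar>}" if "i \<in> {1..k}" for i
        unfolding T_def using that k by (intro sample_marginal) auto
      have bound: "\<bar>f (Z \<omega>) - f (X \<omega>)\<bar> \<le> e / 4 + (\<Sum>i\<in>{1..k}. 2 * c * indicator (S i) \<omega> + 2 * c * indicator (T i) \<omega>)"
        if \<omega>: "\<omega> \<in> space (joint n)" for \<omega>
      proof (cases "\<exists>i\<in>{1..k}. \<omega> \<in> S i \<union> T i")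
        case True
        then obtain i where i: "i \<in> {1..k}" "\<omega> \<in> S i \<union> T i" by blast
        have "2 * c \<le> 2 * c * indicator (S i) \<omega> + 2 * c * indicator (T i) \<omega>" using i(2) c(1) by (auto simp: indicator_def)
        also have "\<dots> \<le> (\<Sum>i\<in>{1..k}. 2 * c * indicator (S i) \<omega> + 2 * c * indicator (T i) \<omega>)"
          using i(1) c(1) by (intro member_le_sum) (auto simp: indicator_def)
        finally show ?thesis using fb[of \<omega>] e by linarith
      next
        case False
        have "\<bar>f (Z \<omega>) - f (X \<omega>)\<bar> < e / 4"
        proof (rule \<delta>(2)[rule_format])
          show "\<bar>X \<omega> i\<bar> \<le> L" if "i \<in> {1..k}" for i using that False \<omega> by (auto simp: X_def T_def not_le intro: less_imp_le)
          show "\<bar>Z \<omega> i - X \<omega> i\<bar> < \<delta>" if "i \<in> {1..k}" for i using that False \<omega> by (auto simp: X_def Z_def S_def not_le)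
        qed (unfold Z_def X_def, (rule in_ext)+)
        moreover have "0 \<le> (\<Sum>i\<in>{1..k}. 2 * c * indicator (S i) \<omega> + 2 * c * indicator (T i) \<omega> :: real)"
          using c(1) by (intro sum_nonneg) (auto simp: indicator_def)
        ultimately show ?thesis by linarith
      qed
      have int_bound: "integrable (joint n) (\<lambda>\<omega>. e / 4 + (\<Sum>i\<in>{1..k}. 2 * c * indicator (S i) \<omega> + 2 * c * indicator (T i) \<omega>))"
        using ST_sets by (intro Bochner_Integration.integrable_add Bochner_Integration.integrable_sum integrable_mult_right
            integrable_real_indicator joint.integrable_const) (auto simp: joint.emeasure_eq_measure)
      have "\<bar>(\<integral>\<omega>. f (Z \<omega>) \<partial>joint n) - (\<integral>\<omega>. f (X \<omega>) \<partial>joint n)\<bar> = \<bar>\<integral>\<omega>. f (Z \<omega>) - f (X \<omega>) \<partial>joint n\<bar>"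
        using int by simp
      also have "\<dots> \<le> (\<integral>\<omega>. \<bar>f (Z \<omega>) - f (X \<omega>)\<bar> \<partial>joint n)" by (rule integral_abs_bound)
      also have "\<dots> \<le> (\<integral>\<omega>. e / 4 + (\<Sum>i\<in>{1..k}. 2 * c * indicator (S i) \<omega> + 2 * c * indicator (T i) \<omega>) \<partial>joint n)"
        using int by (intro integral_mono int_bound bound) auto
      also have "\<dots> = e / 4 + (\<Sum>i\<in>{1..k}. 2 * c * measure (joint n) (S i) + 2 * c * measure (joint n) (T i))"
        using ST_sets sets.sets_into_space
        by (subst Bochner_Integration.integral_add)
          (auto simp: Bochner_Integration.integral_sum joint.prob_space joint.emeasure_eq_measure Int_absorb2
            intro!: Bochner_Integration.integrable_sum sum.cong)
      also have "\<dots> = e / 4 + (2 * c * (\<Sum>i\<in>{1..k}. p n i) + 2 * c * (real k * measure P {x. L \<le> \<bar>x\<bar>}))"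
        using T_measure by (simp add: sum.distrib sum_distrib_left[symmetric] p_def S_def)
      also have "\<dots> < e"
      proof -
        have "2 * c * (\<Sum>i\<in>{1..k}. p n i) < 2 * c * (e / (8 * c))"
          using elim(1) c(1) by (intro mult_strict_left_mono) auto
        then have "2 * c * (\<Sum>i\<in>{1..k}. p n i) < e / 4" using c(1) by simp
        moreover have "2 * c * (real k * measure P {x. L \<le> \<bar>x\<bar>}) \<le> 2 * c * ((real k + 1) * \<eta>)"
          using L(2) c(1) \<eta> by (intro mult_left_mono mult_mono) auto
        moreover have "2 * c * ((real k + 1) * \<eta>) = e / 2"
        proof -
          have "2 * c * (a * (e / (4 * c * a))) = e / 2" if "a \<noteq> 0" for a using c(1) that by (simp add: field_simps)
          moreover have "real k + 1 \<noteq> 0" by simp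
          ultimately show ?thesis unfolding \<eta>_def by blast
        qed
        ultimately show ?thesis by linarith
      qed
      finally show ?case unfolding 1 2 by (simp add: dist_real_def)
    qed
  qed
qed

end

theorem corollary8:
  fixes b :: "real \<Rightarrow> real" and \<sigma> :: real
  assumes "continuous_on {0..1} b"
    and "\<sigma> \<noteq> 0"
    and "B_fun b 1 = 0"
    and "strict_antimono_on {0..1} b"
  shows "chaotic (Pn_inf b \<sigma>) (P_inf b \<sigma>) \<and>
    (\<forall>k\<ge>1. \<forall>q\<ge>1.
       (\<lambda>n. wasserstein q k (marginal k (Pn_inf b \<sigma> n)) (Pi\<^sub>M {1..k} (\<lambda>_. P_inf b \<sigma>)))
         \<longlonglongrightarrow> 0)"
proof -
  interpret decreasing_drift b \<sigma> by (rule decreasing_drift.intro) (fact assms)+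
  show ?thesis
    unfolding chaotic_def
    using symmetric_distribution_Pn P_real_distribution weak_convergence wasserstein_tendsto_0 by blast
qed

end
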